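(* Let $D\subset\mathbb{R}^{n-1}$ be a bounded $C^\infty$ domain, $\ell>0$, $\Omega=D\times(0,\ell)$ with points $(x,y)$, $\partial\Omega_1=(D\times\{0\})\cup(D\times\{\ell\})$, $\partial\Omega_2=\partial D\times[0,\ell]$, $\alpha\ge0$ a constant, and $f\in L^2(\Omega)$. Let $u,v$ solve \[ -\Delta u=f\text{ in }\Omega,\quad \tfrac{\partial u}{\partial\nu}=0\text{ on }\partial\Omega_1,\quad \tfrac{\partial u}{\partial\nu}+\alpha u=0\text{ on }\partial\Omega_2, \] \[ -\Delta v=f^{\#}\text{ in }\Omega,\quad \tfrac{\partial v}{\partial\nu}=0\text{ on }\partial\Omega_1,\quad \tfrac{\partial v}{\partial\nu}+\alpha v=0\text{ on }\partial\Omega_2, \] where $f^{\#}$ is the decreasing rearrangement of $f$ in the $y$-direction; when $\alpha=0$ assume $f,u,v$ have zero mean on $\Omega$. Assume $f$ and $f^{\#}$ are continuous on $\overline\Omega$ and such that $u,v\in C^2(\overline\Omega)$. Then for each $x\in D$, $u^{\bigstar}(x,y)\le Jv(x,y)$ for every $0\le y\le\ell$. In particular, for each $x\in D$ and each convex $\phi:\mathbb{R}\to\mathbb{R}$, \[ \int_0^\ell\phi(u(x,y))\,dy\le\int_0^\ell\phi(v(x,y))\,dy. \]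
   Context: For $g\in L^1(0,\ell)$, the decreasing rearrangement is $g^*(t)=\inf\{s:|\{g>s\}|\le t\}$ for $0<t<\ell$ ($|\cdot|$ Lebesgue measure), $g^*(0)=\operatorname{ess\,sup}g$, $g^*(\ell)=\operatorname{ess\,inf}g$. For $f$ on $\Omega$, $f^{\#}(x,y)=(f^x)^*(y)$ where $f^x(y)=f(x,y)$. Define $Jf(x,y)=\int_0^yf(x,t)\,dt$ and $f^{\bigstar}(x,y)=\int_0^yf^{\#}(x,t)\,dt=\max_{|E|=y}\int_Ef(x,t)\,dt$ (max over measurable $E\subseteq(0,\ell)$). $\nu$ is the outer unit normal. *)

theory Defs
  imports "HOL-Analysis.Analysis"
begin

fun Ck_on :: "nat \<Rightarrow> 'a::euclidean_space set \<Rightarrow> ('a \<Rightarrow> real) \<Rightarrow> bool" where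
  "Ck_on 0 U g = continuous_on U g"
| "Ck_on (Suc k) U g =
     ((\<forall>p\<in>U. g differentiable (at p)) \<and>
      (\<forall>b\<in>Basis. Ck_on k U (\<lambda>p. frechet_derivative g (at p) b)))"

definition Cinf_on :: "'a::euclidean_space set \<Rightarrow> ('a \<Rightarrow> real) \<Rightarrow> bool" where
  "Cinf_on U g \<longleftrightarrow> open U \<and> (\<forall>k. Ck_on k U g)"

definition grad_at :: "('a::euclidean_space \<Rightarrow> real) \<Rightarrow> 'a \<Rightarrow> 'a" where
  "grad_at g p = (\<Sum>b\<in>Basis. frechet_derivative g (at p) b *\<^sub>R b)"

definition local_defining_fn :: "'a::euclidean_space set \<Rightarrow> 'a \<Rightarrow> 'a set \<Rightarrow> ('a \<Rightarrow> real) \<Rightarrow> bool" where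
  "local_defining_fn D p U \<rho> \<longleftrightarrow>
     open U \<and> p \<in> U \<and> Cinf_on U \<rho> \<and>
     (\<forall>q\<in>U. q \<in> D \<longleftrightarrow> \<rho> q < 0) \<and>
     (\<forall>q\<in>U. q \<in> frontier D \<longleftrightarrow> \<rho> q = 0) \<and>
     (\<forall>q\<in>U \<inter> frontier D. grad_at \<rho> q \<noteq> 0)"

definition smooth_bounded_domain :: "'a::euclidean_space set \<Rightarrow> bool" where
  "smooth_bounded_domain D \<longleftrightarrow> open D \<and> connected D \<and> D \<noteq> {} \<and> bounded D \<and>
     (\<forall>p\<in>frontier D. \<exists>U \<rho>. local_defining_fn D p U \<rho>)"

definition outer_normal :: "'a::euclidean_space set \<Rightarrow> 'a \<Rightarrow> 'a" where
  "outer_normal D p =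
     (SOME \<nu>. \<exists>U \<rho>. local_defining_fn D p U \<rho> \<and> \<nu> = sgn (grad_at \<rho> p))"

definition C2_closure_with ::
  "'a::euclidean_space set \<Rightarrow> ('a \<Rightarrow> real) \<Rightarrow> ('a \<Rightarrow> 'a) \<Rightarrow> ('a \<Rightarrow> 'a \<Rightarrow> 'a) \<Rightarrow> bool" where
  "C2_closure_with W u g H \<longleftrightarrow>
     (\<forall>p\<in>W. (u has_derivative (\<lambda>h. g p \<bullet> h)) (at p)) \<and>
     (\<forall>p\<in>W. (g has_derivative H p) (at p)) \<and>
     continuous_on (closure W) u \<and> continuous_on (closure W) g \<and>
     (\<forall>h. continuous_on (closure W) (\<lambda>p. H p h))"

definition laplacian_of :: "('a::euclidean_space \<Rightarrow> 'a \<Rightarrow> 'a) \<Rightarrow> 'a \<Rightarrow> real" where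
  "laplacian_of H p = (\<Sum>b\<in>Basis. H p b \<bullet> b)"

definition decr_rearr :: "real \<Rightarrow> (real \<Rightarrow> real) \<Rightarrow> real \<Rightarrow> real" where
  "decr_rearr l g t =
     (if t = l then Sup {s. emeasure lebesgue {y\<in>{0<..<l}. g y < s} = 0}   \<comment> \<open>ess inf\<close>
      else if t = 0 then Inf {s. emeasure lebesgue {y\<in>{0<..<l}. s < g y} = 0}  \<comment> \<open>ess sup\<close>
      else Inf {s. emeasure lebesgue {y\<in>{0<..<l}. s < g y} \<le> ennreal t})"

definition sharp :: "real \<Rightarrow> ('a \<times> real \<Rightarrow> real) \<Rightarrow> 'a \<times> real \<Rightarrow> real" where
  "sharp l f = (\<lambda>(x, y). decr_rearr l (\<lambda>t. f (x, t)) y)"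

definition Jop :: "('a \<times> real \<Rightarrow> real) \<Rightarrow> 'a \<times> real \<Rightarrow> real" where
  "Jop f = (\<lambda>(x, y). integral {0..y} (\<lambda>t. f (x, t)))"

definition star :: "real \<Rightarrow> ('a \<times> real \<Rightarrow> real) \<Rightarrow> 'a \<times> real \<Rightarrow> real" where
  "star l f = (\<lambda>(x, y). integral {0..y} (\<lambda>t. sharp l f (x, t)))"

definition solves_mixed_problem ::
  "'a::euclidean_space set \<Rightarrow> real \<Rightarrow> real \<Rightarrow> ('a \<times> real \<Rightarrow> real) \<Rightarrow>
   ('a \<times> real \<Rightarrow> real) \<Rightarrow> ('a \<times> real \<Rightarrow> 'a \<times> real) \<Rightarrow> ('a \<times> real \<Rightarrow> 'a \<times> real \<Rightarrow> 'a \<times> real) \<Rightarrow> bool" where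
  "solves_mixed_problem D l \<alpha> F w g H \<longleftrightarrow>
     C2_closure_with (D \<times> {0<..<l}) w g H \<and>
     (\<forall>p\<in>D \<times> {0<..<l}. - laplacian_of H p = F p) \<and>
     (\<forall>x\<in>D. g (x, 0) \<bullet> (0, -1) = 0 \<and> g (x, l) \<bullet> (0, 1) = 0) \<and>
     (\<forall>x\<in>frontier D. \<forall>y\<in>{0..l}. g (x, y) \<bullet> (outer_normal D x, 0) + \<alpha> * w (x, y) = 0)"

end

theory Submission
  imports Defs
begin

text \<open>
  The function \<open>w = u\<^sup>\<star> - Jv\<close> vanishes on the bottom and, after comparing the harmonic function
  \<open>\<integral> u dy - \<integral> v dy\<close> with zero, also on the top of the cylinder. It is subharmonic in the weak sense
  that its symmetric second differences, summed over the coordinate directions, are bounded below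
  by \<open>- o(t\<^sup>2)\<close>. Indeed, at a given point \<open>u\<^sup>\<star>(x, y)\<close> is the integral of \<open>u(x, \<sqdot>)\<close> against a weight
  \<open>\<theta>\<close> concentrated on a superlevel set at height \<open>s\<close>, and freezing \<open>\<theta>\<close> bounds \<open>u\<^sup>\<star>\<close> from below
  at nearby \<open>x\<close>. The horizontal Laplacian of the frozen integral is \<open>- \<integral> \<theta> f - \<integral> \<theta> u\<^sub>y\<^sub>y\<close>, where
  \<open>\<integral> \<theta> f \<le> f\<^sup>\<star>\<close>, and the second difference of \<open>u\<^sup>\<star>\<close> in \<open>y\<close> compensates \<open>\<integral> \<theta> u\<^sub>y\<^sub>y\<close>, because
  the latter is at most \<open>- \<bar>u\<^sub>y\<bar>\<close> at every point of the level set \<open>u(x, \<sqdot>) = s\<close>. The strong maximum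
  principle and Hopf's lemma only need this weak form of subharmonicity, and Hopf's lemma together
  with the Robin condition excludes a positive maximum on the lateral boundary. The convex
  inequality follows from the majorization by the second mean value theorem.
\<close>

section \<open>Maximum principles\<close>

text \<open>The obstacle is that \<open>star l u\<close> has no usable second derivatives: a
  superlevel set of a slice of u may have infinitely many components, and a level set may have
  positive measure. So no moving level set is differentiated; difference quotients are bounded from
  one side. For a C2 function \<open>weakly_subharmonic_at\<close> says that the Laplacian is
  nonnegative. The compensation in y rests on a single point of the level set. Let m be minus the
  integral of \<theta> u_yy. Lowering the level by (m + \<epsilon>) r sweeps a whole crossing
  interval, on which the slope stays below m + \<epsilon>, and so gains measure more than r, unless
  everything already lies above the new level. Hence the rearrangement changes at rate at most m +
  \<epsilon> on either side of y, and its integral has second difference at least -(m + \<epsilon>)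
  t^2. The Neumann condition enters by removing the terms at 0 and l when |u_y| is bounded by
  m.\<close>

definition weakly_subharmonic_at :: "('a::euclidean_space \<Rightarrow> real) \<Rightarrow> 'a \<Rightarrow> bool" where
  "weakly_subharmonic_at w p \<longleftrightarrow>
     (\<forall>\<epsilon>>0. \<forall>\<^sub>F t in at_right 0. - \<epsilon> * t\<^sup>2 \<le>
        (\<Sum>b\<in>Basis. w (p + t *\<^sub>R b) + w (p - t *\<^sub>R b) - 2 * w p))"

lemma exp_plus_exp_minus_ge:
  fixes x :: real
  shows "2 + x\<^sup>2 / 2 \<le> exp x + exp (- x)"
proof -
  have *: "2 + y\<^sup>2 / 2 \<le> exp y + exp (- y)" if "y \<ge> 0" for y :: real
    using exp_lower_Taylor_quadratic[OF that] exp_ge_add_one_self[of "- y"] by simp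
  show ?thesis
    using *[of x] *[of "- x"] by (cases "x \<ge> 0") auto
qed

text \<open>Barrier for Hopf's lemma: with n the dimension and rho = |p - c|^2, the Laplacian of
  \<open>G\<close> is (4 A^2 rho - 2 n A) G, which is positive once A rho dominates n. The discrete
  bound is quantitative, with a smaller constant, because it has to beat the error \<epsilon> t^2 in
  \<open>weakly_subharmonic_at\<close>.\<close>

lemma gaussian_second_difference:
  fixes c p :: "'a::euclidean_space" and A t :: real
  assumes "A > 0" and far: "2 * DIM('a) \<le> A * (norm (p - c))\<^sup>2" and t: "4 * A * t\<^sup>2 \<le> 1"
  defines "G \<equiv> \<lambda>x. exp (- A * (norm (x - c))\<^sup>2)"
  shows "G p * (A\<^sup>2 * (norm (p - c))\<^sup>2 / 2) * t\<^sup>2 \<le>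
    (\<Sum>b\<in>Basis. G (p + t *\<^sub>R b) + G (p - t *\<^sub>R b) - 2 * G p)"
proof -
  define \<rho> where "\<rho> = (norm (p - c))\<^sup>2"
  have shift: "G (p + s *\<^sub>R b) = G p * (exp (- A * s\<^sup>2) * exp (- (2 * A * s * ((p - c) \<bullet> b))))"
    if "b \<in> Basis" for b s
  proof -
    have n: "(norm (p + s *\<^sub>R b - c))\<^sup>2 = (norm (p - c))\<^sup>2 + 2 * s * ((p - c) \<bullet> b) + s\<^sup>2"
      using that unfolding power2_norm_eq_inner
      by (simp add: algebra_simps inner_commute power2_eq_square)
    show ?thesis
      unfolding G_def n exp_add[symmetric] by (simp add: algebra_simps)
  qed
  have one: "G p * (2 * A\<^sup>2 * t\<^sup>2 * ((p - c) \<bullet> b)\<^sup>2 * (1 - A * t\<^sup>2) - 2 * A * t\<^sup>2)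
      \<le> G (p + t *\<^sub>R b) + G (p - t *\<^sub>R b) - 2 * G p" if b: "b \<in> Basis" for b
  proof -
    define d where "d = (p - c) \<bullet> b"
    define x where "x = 2 * A * t * d"
    have eq: "G (p + t *\<^sub>R b) + G (p - t *\<^sub>R b) - 2 * G p
      = G p * (exp (- A * t\<^sup>2) * (exp x + exp (- x)) - 2)"
      using shift[OF b, of t] shift[OF b, of "- t"] by (simp add: x_def d_def algebra_simps)
    have "(1 - A * t\<^sup>2) * (2 + x\<^sup>2 / 2) \<le> exp (- A * t\<^sup>2) * (exp x + exp (- x))"
      using exp_ge_add_one_self[of "- A * t\<^sup>2"] exp_plus_exp_minus_ge[of x] t \<open>A > 0\<close>
      by (intro mult_mono) (auto intro!: add_nonneg_nonneg)
    moreover have "(1 - A * t\<^sup>2) * (2 + x\<^sup>2 / 2) - 2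
        = 2 * A\<^sup>2 * t\<^sup>2 * d\<^sup>2 * (1 - A * t\<^sup>2) - 2 * A * t\<^sup>2"
      unfolding x_def by (simp add: field_simps power2_eq_square)
    ultimately have "2 * A\<^sup>2 * t\<^sup>2 * d\<^sup>2 * (1 - A * t\<^sup>2) - 2 * A * t\<^sup>2
        \<le> exp (- A * t\<^sup>2) * (exp x + exp (- x)) - 2" by linarith
    then show ?thesis unfolding eq d_def[symmetric]
      by (intro mult_left_mono) (auto simp: G_def)
  qed
  have sq: "(\<Sum>b\<in>Basis. ((p - c) \<bullet> b)\<^sup>2) = \<rho>"
    unfolding \<rho>_def power2_norm_eq_inner euclidean_inner[of "p - c" "p - c"]
      by (simp add: power2_eq_square)
  \<comment> \<open>In units of A^2 \<rho> t^2, the coefficient 2 loses at most 1 to the dimension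
    term by \<open>far\<close>, and at most 1/2 to the factor 1 - A t^2.\<close>
  have "A\<^sup>2 * \<rho> / 2 * t\<^sup>2 \<le> 2 * A\<^sup>2 * t\<^sup>2 * \<rho> * (1 - A * t\<^sup>2) - DIM('a) * (2 * A * t\<^sup>2)"
  proof -
    have "A * t\<^sup>2 * (2 * DIM('a)) \<le> A * t\<^sup>2 * (A * \<rho>)"
      using far \<open>A > 0\<close> unfolding \<rho>_def by (intro mult_left_mono) auto
    moreover have "(A\<^sup>2 * t\<^sup>2 * \<rho>) * (4 * (A * t\<^sup>2)) \<le> (A\<^sup>2 * t\<^sup>2 * \<rho>) * 1"
      using t unfolding \<rho>_def by (intro mult_left_mono) auto
    ultimately show ?thesis by (simp add: algebra_simps power2_eq_square)
  qed
  then have "G p * (A\<^sup>2 * \<rho> / 2 * t\<^sup>2) \<le>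
      G p * (2 * A\<^sup>2 * t\<^sup>2 * \<rho> * (1 - A * t\<^sup>2) - DIM('a) * (2 * A * t\<^sup>2))"
    by (intro mult_left_mono) (auto simp: G_def)
  also have "\<dots> = (\<Sum>b\<in>Basis. G p * (2 * A\<^sup>2 * t\<^sup>2 * ((p - c) \<bullet> b)\<^sup>2 * (1 - A * t\<^sup>2) - 2 * A * t\<^sup>2))"
    unfolding sum_distrib_left[symmetric] sum_subtractf sq[symmetric] sum_distrib_right
    by (simp add: sum_distrib_left sum_distrib_right algebra_simps)
  also have "\<dots> \<le> (\<Sum>b\<in>Basis. G (p + t *\<^sub>R b) + G (p - t *\<^sub>R b) - 2 * G p)"
    by (intro sum_mono one)
  finally show ?thesis by (simp add: \<rho>_def algebra_simps)
qed

lemma eventually_at_right_offset_in_open: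
  fixes p b :: "'a::real_normed_vector"
  assumes "open U" "p \<in> U"
  shows "\<forall>\<^sub>F t in at_right 0. p + t *\<^sub>R b \<in> U" "\<forall>\<^sub>F t in at_right 0. p - t *\<^sub>R b \<in> U"
proof -
  have "((\<lambda>t. p + t *\<^sub>R b) \<longlongrightarrow> p + 0 *\<^sub>R b) (at_right 0)"
    "((\<lambda>t. p - t *\<^sub>R b) \<longlongrightarrow> p - 0 *\<^sub>R b) (at_right 0)"
    by (intro tendsto_intros)+
  then show "\<forall>\<^sub>F t in at_right 0. p + t *\<^sub>R b \<in> U" "\<forall>\<^sub>F t in at_right 0. p - t *\<^sub>R b \<in> U"
    using assms by (auto dest: topological_tendstoD)
qed

lemma eventually_at_right_square_less:
  assumes "(0::real) < c" shows "\<forall>\<^sub>F t in at_right (0::real). K * t\<^sup>2 < c"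
proof -
  have "((\<lambda>t. K * t\<^sup>2) \<longlongrightarrow> K * 0\<^sup>2) (at_right 0)" by (intro tendsto_intros)
  then show ?thesis using assms order_tendstoD(2) by fastforce
qed

text \<open>Add to \<open>w\<close> a multiple of the Gaussian, normalised to vanish on the outer
  sphere. The sum cannot exceed M on the annulus: on the two spheres by the choice of \<eta>, and
  inside because second differences at a maximum are nonpositive while those of the Gaussian
  outweigh the error of \<open>w\<close>. The conclusion is a pointwise drop below M, since
  \<open>w\<close> may lack a normal derivative.\<close>

lemma hopf_boundary_estimate:
  fixes w :: "'a::euclidean_space \<Rightarrow> real"
  assumes "r > 0" and cont: "continuous_on (cball c r) w"
    and sub: "\<And>p. p \<in> ball c r \<Longrightarrow> weakly_subharmonic_at w p"
    and le: "\<And>p. p \<in> cball c r \<Longrightarrow> w p \<le> M"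
    and less: "\<And>p. p \<in> ball c r \<Longrightarrow> w p < M"
  obtains \<kappa> where "\<kappa> > 0"
    "\<And>p. r / 2 \<le> norm (p - c) \<Longrightarrow> norm (p - c) \<le> r \<Longrightarrow> w p \<le> M - \<kappa> * (r\<^sup>2 - (norm (p - c))\<^sup>2)"
proof -
  \<comment> \<open>The smallest value for which \<open>far\<close> holds already on the inner
    sphere |p - c| = r / 2.\<close>
  define A where "A = 8 * DIM('a) / r\<^sup>2"
  have "A > 0" using \<open>r > 0\<close> by (simp add: A_def)
  define G where "G = (\<lambda>x::'a. exp (- A * (norm (x - c))\<^sup>2))"
  define K where "K = {p. r / 2 \<le> norm (p - c) \<and> norm (p - c) \<le> r}"
  have Kc: "K \<subseteq> cball c r" by (auto simp: K_def dist_norm norm_minus_commute)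
  have "K = cball c r - ball c (r / 2)" by (auto simp: K_def dist_norm norm_minus_commute)
  then have "compact K" by (simp add: compact_diff)
  have "compact (sphere c (r / 2))" "sphere c (r / 2) \<noteq> {}" using \<open>r > 0\<close> by auto
  moreover have "continuous_on (sphere c (r / 2)) w"
    using \<open>r > 0\<close> by (intro continuous_on_subset[OF cont]) auto
  ultimately obtain m where m: "m \<in> sphere c (r / 2)" "\<And>p. p \<in> sphere c (r / 2) \<Longrightarrow> w p \<le> w m"
    using continuous_attains_sup[of "sphere c (r / 2)" w] by blast
  \<comment> \<open>The inner sphere lies in the open ball, where \<open>less\<close> is strict, so
    by compactness the gap is positive even if \<open>w\<close> attains M on the outer
    sphere.\<close>
  define \<eta> where "\<eta> = M - w m"
  have "\<eta> > 0" using less[of m] m(1) \<open>r > 0\<close> by (simp add: \<eta>_def)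
  define z where "z = (\<lambda>x. w x + \<eta> * (G x - exp (- A * r\<^sup>2)))"
  have "K \<noteq> {}" using m(1) \<open>r > 0\<close> by (auto simp: K_def dist_norm norm_minus_commute)
  moreover have "continuous_on K z" unfolding z_def G_def
    by (intro continuous_intros continuous_on_subset[OF cont Kc])
  ultimately obtain p where p: "p \<in> K" "\<And>x. x \<in> K \<Longrightarrow> z x \<le> z p"
    using continuous_attains_sup[of K z] \<open>compact K\<close> by blast
  have "z p \<le> M"
  proof -
    consider "norm (p - c) = r" | "norm (p - c) = r / 2" | "r / 2 < norm (p - c)" "norm (p - c) < r"
      using p(1) by (fastforce simp: K_def)
    then show ?thesis
    proof cases
      case 1
      then show ?thesis using le[of p] p(1) Kc by (auto simp: z_def G_def)
    next
      case 2
      have "G p \<le> 1" using \<open>A > 0\<close> by (simp add: G_def)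
      then have "G p - exp (- A * r\<^sup>2) \<le> 1" by (smt (verit) exp_gt_zero)
      then have "\<eta> * (G p - exp (- A * r\<^sup>2)) \<le> \<eta> * 1" using \<open>\<eta> > 0\<close> by (intro mult_left_mono) auto
      moreover have "w p \<le> w m" using 2 by (intro m(2)) (simp add: dist_norm norm_minus_commute)
      ultimately show ?thesis by (simp add: z_def \<eta>_def)
    next
      case 3
      define U where "U = {x. r / 2 < norm (x - c)} \<inter> {x. norm (x - c) < r}"
      have "open U" unfolding U_def by (intro open_Int open_Collect_less continuous_intros)
      have "p \<in> U" "U \<subseteq> K" using 3 by (auto simp: U_def K_def)
      define k where "k = G p * (A\<^sup>2 * (norm (p - c))\<^sup>2 / 2)"
      have "norm (p - c) > 0" using 3 \<open>r > 0\<close> by linarith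
      then have "k > 0" using \<open>A > 0\<close> by (simp add: k_def G_def)
      have "(r/2)\<^sup>2 \<le> (norm (p - c))\<^sup>2" using 3 \<open>r > 0\<close> by (intro power_mono) auto
      then have "A * (r/2)\<^sup>2 \<le> A * (norm (p - c))\<^sup>2" using \<open>A > 0\<close> by (intro mult_left_mono) auto
      then have far: "2 * DIM('a) \<le> A * (norm (p - c))\<^sup>2"
        using \<open>r > 0\<close> by (simp add: A_def power2_eq_square)
      have "p \<in> ball c r" using 3 by (auto simp: dist_norm norm_minus_commute)
      then have 1: "\<forall>\<^sub>F t in at_right 0. - (\<eta> * k / 2) * t\<^sup>2 \<le>
          (\<Sum>b\<in>Basis. w (p + t *\<^sub>R b) + w (p - t *\<^sub>R b) - 2 * w p)"
        using \<open>\<eta> > 0\<close> \<open>k > 0\<close>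
        by (intro sub[unfolded weakly_subharmonic_at_def, rule_format]) auto
      have 2: "\<forall>\<^sub>F t in at_right 0. 4 * A * t\<^sup>2 < 1" by (rule eventually_at_right_square_less) simp
      have 4: "\<forall>\<^sub>F t in at_right 0. \<forall>b\<in>Basis. p + t *\<^sub>R b \<in> U \<and> p - t *\<^sub>R b \<in> U"
        using eventually_at_right_offset_in_open[OF \<open>open U\<close> \<open>p \<in> U\<close>]
        by (intro eventually_ball_finite finite_Basis) (simp add: eventually_conj)
      have "\<forall>\<^sub>F t in at_right (0::real). False"
        using 1 2 4 eventually_at_right_less[of "0::real"]
      proof eventually_elim
        case (elim t)
        have g: "k * t\<^sup>2 \<le> (\<Sum>b\<in>Basis. G (p + t *\<^sub>R b) + G (p - t *\<^sub>R b) - 2 * G p)"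
          using gaussian_second_difference[OF \<open>A > 0\<close> far, of t] elim(2) by (simp add: k_def G_def)
        have "(\<Sum>b\<in>Basis. z (p + t *\<^sub>R b) + z (p - t *\<^sub>R b) - 2 * z p) \<le> 0"
          using elim(3) p(2) \<open>U \<subseteq> K\<close> by (intro sum_nonpos) (smt (verit) subsetD)
        moreover have "(\<Sum>b\<in>Basis. z (p + t *\<^sub>R b) + z (p - t *\<^sub>R b) - 2 * z p) =
          (\<Sum>b\<in>Basis. w (p + t *\<^sub>R b) + w (p - t *\<^sub>R b) - 2 * w p) +
          \<eta> * (\<Sum>b\<in>Basis. G (p + t *\<^sub>R b) + G (p - t *\<^sub>R b) - 2 * G p)"
          unfolding sum_distrib_left sum.distrib[symmetric]
          by (intro sum.cong) (auto simp: z_def algebra_simps)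
        moreover have "\<eta> * (k * t\<^sup>2) \<le> \<eta> * (\<Sum>b\<in>Basis. G (p + t *\<^sub>R b) + G (p - t *\<^sub>R b) - 2 * G p)"
          using g \<open>\<eta> > 0\<close> by (intro mult_left_mono) auto
        moreover have "\<eta> * k * t\<^sup>2 > 0" using \<open>\<eta> > 0\<close> \<open>k > 0\<close> elim(4) by simp
        ultimately show False using elim(1) by (simp add: algebra_simps)
      qed
      then show ?thesis by simp
    qed
  qed
  show ?thesis
  proof
    show "\<eta> * (A * exp (- A * r\<^sup>2)) > 0" using \<open>\<eta> > 0\<close> \<open>A > 0\<close> by simp
    fix x assume x: "r / 2 \<le> norm (x - c)" "norm (x - c) \<le> r"
    \<comment> \<open>The inequality exp s - 1 >= s turns the Gaussian difference into a multiple of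
      r^2 - |x - c|^2.\<close>
    have "A * (r\<^sup>2 - (norm (x - c))\<^sup>2) \<le> exp (A * (r\<^sup>2 - (norm (x - c))\<^sup>2)) - 1"
      using exp_ge_add_one_self[of "A * (r\<^sup>2 - (norm (x - c))\<^sup>2)"] by linarith
    then have "exp (- A * r\<^sup>2) * (A * (r\<^sup>2 - (norm (x - c))\<^sup>2)) \<le>
        exp (- A * r\<^sup>2) * (exp (A * (r\<^sup>2 - (norm (x - c))\<^sup>2)) - 1)"
      by (intro mult_left_mono) auto
    also have "\<dots> = G x - exp (- A * r\<^sup>2)"
      by (simp add: G_def algebra_simps exp_add[symmetric])
    finally have "\<eta> * (exp (- A * r\<^sup>2) * (A * (r\<^sup>2 - (norm (x - c))\<^sup>2)))
      \<le> \<eta> * (G x - exp (- A * r\<^sup>2))"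
      using \<open>\<eta> > 0\<close> by (intro mult_left_mono) auto
    moreover have "z x \<le> M" using p(2)[of x] x \<open>z p \<le> M\<close> by (auto simp: K_def)
    ultimately show "w x \<le> M - \<eta> * (A * exp (- A * r\<^sup>2)) * (r\<^sup>2 - (norm (x - c))\<^sup>2)"
      by (simp add: z_def algebra_simps)
  qed
qed

text \<open>The set where \<open>w\<close> equals M is closed, and it has to be shown open. A point
  off it near \<open>a\<close> is the centre of a largest ball avoiding it, which touches it at
  \<open>z\<close>. Classically Hopf's lemma contradicts the vanishing gradient at \<open>z\<close>;
  here the linear drop along one coordinate direction contradicts the lower bound -t^2 for the
  second differences, all other terms being nonpositive at a maximum.\<close>

lemma strong_maximum_principle:
  fixes w :: "'a::euclidean_space \<Rightarrow> real"
  assumes "open S" "connected S" and cont: "continuous_on S w"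
    and sub: "\<And>p. p \<in> S \<Longrightarrow> weakly_subharmonic_at w p"
    and le: "\<And>p. p \<in> S \<Longrightarrow> w p \<le> M"
    and p0: "p0 \<in> S" "w p0 = M" and "p \<in> S"
  shows "w p = M"
proof -
  define N where "N = {x\<in>S. w x = M}"
  have cl: "closedin (top_of_set S) N"
    unfolding N_def using continuous_closedin_preimage_constant[OF cont, of M]
      by (simp add: vimage_def Int_def)
  have "\<exists>R>0. ball a R \<subseteq> N" if a: "a \<in> N" for a
  proof -
    obtain R0 where "R0 > 0" "cball a R0 \<subseteq> S"
      using a \<open>open S\<close> open_contains_cball unfolding N_def by blast
    \<comment> \<open>Half the radius: the ball about \<open>x\<close> that touches the set is
      smaller than R, because \<open>a\<close> itself belongs to the set, and so it stays in
      \<open>cball a (2 * R)\<close>.\<close>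
    define R where "R = R0 / 2"
    have "R > 0" and R: "cball a (2 * R) \<subseteq> S" using \<open>R0 > 0\<close> \<open>cball a R0 \<subseteq> S\<close> by (auto simp: R_def)
    have "w x = M" if x: "x \<in> ball a R" for x
    proof (rule ccontr)
      assume neq: "w x \<noteq> M"
      define C where "C = cball a (2 * R) \<inter> {y\<in>S. w y = M}"
      have C_eq: "C = {y\<in>cball a (2 * R). w y = M}" using R by (auto simp: C_def)
      have "closed C" unfolding C_eq
        using continuous_closed_preimage_constant[OF continuous_on_subset[OF cont R], of M]
        by (simp add: vimage_def Int_def)
      then have "compact C" unfolding C_def by (metis C_def compact_Int_closed compact_cball
        inf.left_idem)
      have aC: "a \<in> C" using a \<open>R > 0\<close> by (auto simp: C_def N_def)
      obtain z where z: "z \<in> C" "\<And>y. y \<in> C \<Longrightarrow> dist x z \<le> dist x y"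
        using distance_attains_inf[OF \<open>closed C\<close>, of x] aC by blast
      define r where "r = dist x z"
      have "r < R" using z(2)[OF aC] x by (simp add: r_def dist_commute)
      have "r > 0" using z(1) neq by (auto simp: r_def C_def)
      have sub_cball: "cball x r \<subseteq> cball a (2 * R)"
      proof
        fix y assume "y \<in> cball x r"
        then show "y \<in> cball a (2 * R)" using x \<open>r < R\<close> dist_triangle[of a y x] by auto
      qed
      have lt: "w y < M" if "y \<in> ball x r" for y
      proof -
        have "y \<in> cball a (2 * R)" using that sub_cball ball_subset_cball by blast
        moreover have "y \<notin> C" using that z(2)[of y] by (auto simp: r_def)
        ultimately show ?thesis using le[of y] R by (auto simp: C_eq)
      qed
      obtain \<kappa> where k: "\<kappa> > 0" "\<And>p. r / 2 \<le> norm (p - x) \<Longrightarrow> norm (p - x) \<le> r \<Longrightarrow>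
          w p \<le> M - \<kappa> * (r\<^sup>2 - (norm (p - x))\<^sup>2)"
      proof (rule hopf_boundary_estimate[OF \<open>r > 0\<close>, of x w M])
        show "continuous_on (cball x r) w" using sub_cball R
          by (intro continuous_on_subset[OF cont]) auto
        show "weakly_subharmonic_at w q" if "q \<in> ball x r" for q
          using that sub_cball R ball_subset_cball by (intro sub) blast
        show "w q \<le> M" if "q \<in> cball x r" for q using that sub_cball R by (intro le) auto
      qed (use lt in auto)
      have "z - x \<noteq> 0" using \<open>r > 0\<close> by (auto simp: r_def)
      \<comment> \<open>Weak subharmonicity only moves along \<open>Basis\<close>, so the direction
        from z to x is replaced by a basis vector not orthogonal to it, with a sign s that makes it
        point into the ball.\<close>
      then obtain e where e: "e \<in> Basis" "(z - x) \<bullet> e \<noteq> 0" using euclidean_all_zero_iff by blast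
      define d where "d = \<bar>(z - x) \<bullet> e\<bar>"
      define s where "s = - sgn ((z - x) \<bullet> e)"
      have "d > 0" using e by (simp add: d_def)
      have s2: "s * s = 1" using e(2) by (simp add: s_def sgn_if)
      have sd: "s * ((z - x) \<bullet> e) = - d" by (simp add: s_def d_def abs_sgn mult.commute)
      have zS: "z \<in> S" "w z = M" using z(1) by (auto simp: C_def)
      have nrm: "(norm (z + t *\<^sub>R (s *\<^sub>R e) - x))\<^sup>2 = r\<^sup>2 - 2 * t * d + t\<^sup>2" for t
      proof -
        have n1: "(norm ((z - x) + t *\<^sub>R (s *\<^sub>R e)))\<^sup>2
          = (norm (z - x))\<^sup>2 + 2 * t * (s * ((z - x) \<bullet> e)) + t\<^sup>2 * (s * s)"
          using e(1) unfolding power2_norm_eq_inner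
          by (simp add: inner_add_left inner_add_right inner_commute power2_eq_square algebra_simps)
        have n2: "norm (z - x) = r" by (simp add: r_def dist_norm norm_minus_commute)
        have n3: "(z - x) + t *\<^sub>R (s *\<^sub>R e) = z + t *\<^sub>R (s *\<^sub>R e) - x" by (rule diff_add_eq)
        show ?thesis using n1 unfolding n3 n2 s2 sd by linarith
      qed
      have 1: "\<forall>\<^sub>F t in at_right 0. - 1 * t\<^sup>2 \<le> (\<Sum>b\<in>Basis. w (z + t *\<^sub>R b) + w (z - t *\<^sub>R b) - 2 *
        w z)"
        by (rule sub[OF zS(1), unfolded weakly_subharmonic_at_def, rule_format]) simp
      have 2: "\<forall>\<^sub>F t in at_right 0. \<forall>b\<in>Basis. z + t *\<^sub>R b \<in> S \<and> z - t *\<^sub>R b \<in> S"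
        using eventually_at_right_offset_in_open[OF \<open>open S\<close> zS(1)]
        by (intro eventually_ball_finite finite_Basis) (simp add: eventually_conj)
      have 3: "\<forall>\<^sub>F t in at_right 0. z + t *\<^sub>R (s *\<^sub>R e) \<in> {q. r / 2 < norm (q - x)}"
        using \<open>r > 0\<close> by (intro eventually_at_right_offset_in_open open_Collect_less
          continuous_intros)
          (simp add: r_def dist_norm norm_minus_commute)
      \<comment> \<open>t < d keeps the moved point inside the ball. Hopf's drop and the bound -t^2
        give 2 \<kappa> d <= (1 + \<kappa>) t; the second entry is half of the least t compatible
        with that.\<close>
      have 4: "\<forall>\<^sub>F t in at_right 0. t < min d (2 * \<kappa> * d / (2 + 2 * \<kappa>))"
        using \<open>d > 0\<close> \<open>\<kappa> > 0\<close>
        by (intro eventually_mono[OF eventually_at_right_real[of 0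
          "min d (2 * \<kappa> * d / (2 + 2 * \<kappa>))"]]) auto
      have "\<forall>\<^sub>F t in at_right (0::real). False"
        using 1 2 3 4 eventually_at_right_less[of "0::real"]
      proof eventually_elim
        case (elim t)
        have "t * t < t * d" using elim by simp
        then have n: "(norm (z + t *\<^sub>R (s *\<^sub>R e) - x))\<^sup>2 \<le> r\<^sup>2" using elim nrm[of t]
          by (simp add: power2_eq_square)
        then have "norm (z + t *\<^sub>R (s *\<^sub>R e) - x) \<le> r"
          using \<open>r > 0\<close> power2_le_imp_le by fastforce
        then have up: "w (z + t *\<^sub>R (s *\<^sub>R e)) \<le> M - \<kappa> * (2 * t * d - t\<^sup>2)"
          using k(2)[of "z + t *\<^sub>R (s *\<^sub>R e)"] elim(3) nrm[of t] by simp
        have each: "w (z + t *\<^sub>R b) + w (z - t *\<^sub>R b) - 2 * w z \<le> 0" if "b \<in> Basis" for b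
          using elim(2) that le[of "z + t *\<^sub>R b"] le[of "z - t *\<^sub>R b"] zS by force
        have "(\<Sum>b\<in>Basis. w (z + t *\<^sub>R b) + w (z - t *\<^sub>R b) - 2 * w z) \<le>
            w (z + t *\<^sub>R e) + w (z - t *\<^sub>R e) - 2 * w z"
          using e(1) each by (subst sum.remove[OF finite_Basis e(1)]) (auto intro!: sum_nonpos)
        then have "- 1 * t\<^sup>2 \<le> w (z + t *\<^sub>R e) + w (z - t *\<^sub>R e) - 2 * M" using elim(1) zS(2)
          by linarith
        moreover have "w (z + t *\<^sub>R e) \<le> M" "w (z - t *\<^sub>R e) \<le> M" using elim(2) e(1) le by auto
        moreover have "s = 1 \<or> s = - 1" using e(2) by (auto simp: s_def sgn_if)
        ultimately have "- 1 * t\<^sup>2 \<le> w (z + t *\<^sub>R (s *\<^sub>R e)) - M" by auto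
        then have "\<kappa> * (2 * t * d - t\<^sup>2) \<le> t\<^sup>2" using up by linarith
        then have "t * (2 * \<kappa> * d) \<le> t * ((1 + \<kappa>) * t)"
          by (simp add: algebra_simps power2_eq_square)
        then have "2 * \<kappa> * d \<le> (1 + \<kappa>) * t" using elim by simp
        moreover have "t * (2 + 2 * \<kappa>) < 2 * \<kappa> * d" using elim(4) \<open>\<kappa> > 0\<close>
          by (simp add: pos_less_divide_eq)
        moreover have "0 < (1 + \<kappa>) * t" using elim(5) \<open>\<kappa> > 0\<close> by simp
        ultimately show False by (simp add: algebra_simps)
      qed
      then show False by simp
    qed
    moreover have "ball a R \<subseteq> S" using R \<open>R > 0\<close> by (intro order.trans[OF _ R]) auto
    ultimately show ?thesis using \<open>R > 0\<close> by (auto simp: N_def)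
  qed
  then have "open N" using open_contains_ball by blast
  then have "openin (top_of_set S) N" by (auto simp: N_def intro!: openin_open_eq[THEN iffD2]
    \<open>open S\<close>)
  then have "N = S" using \<open>connected S\<close> cl p0 unfolding connected_clopen N_def by blast
  then show ?thesis using \<open>p \<in> S\<close> by (auto simp: N_def)
qed

section \<open>Interior balls in smooth domains\<close>

lemma differentiable_at_imp_lipschitz_at:
  fixes f :: "'a::real_normed_vector \<Rightarrow> 'b::real_normed_vector"
  assumes "f differentiable (at p)"
  obtains C d where "C \<ge> 0" "d > 0" "\<And>q. norm (q - p) < d \<Longrightarrow> norm (f q - f p) \<le> C * norm (q - p)"
proof -
  obtain f' where f': "(f has_derivative f') (at p)" using assms by (auto simp: differentiable_def)
  then have "bounded_linear f'" by (rule has_derivative_bounded_linear)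
  then obtain K where K: "K \<ge> 0" "\<And>x. norm (f' x) \<le> norm x * K"
    using bounded_linear.nonneg_bounded by blast
  from f' obtain d where d: "d > 0"
    "\<And>q. norm (q - p) < d \<Longrightarrow> norm (f q - f p - f' (q - p)) \<le> 1 * norm (q - p)"
    unfolding has_derivative_at_alt by (metis zero_less_one)
  show ?thesis
  proof
    show "0 \<le> K + 1" "d > 0" using K d by auto
    fix q assume "norm (q - p) < d"
    then have "norm (f q - f p - f' (q - p)) \<le> norm (q - p)" using d(2) by force
    moreover have "norm (f q - f p) \<le> norm (f q - f p - f' (q - p)) + norm (f' (q - p))"
      using norm_triangle_ineq[of "f q - f p - f' (q - p)" "f' (q - p)"] by simp
    ultimately show "norm (f q - f p) \<le> (K + 1) * norm (q - p)" using K(2)[of "q - p"]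
      by (simp add: algebra_simps)
  qed
qed

lemma frechet_derivative_eq_grad_at:
  fixes g :: "'a::euclidean_space \<Rightarrow> real"
  assumes "g differentiable (at p)"
  shows "frechet_derivative g (at p) k = grad_at g p \<bullet> k"
proof -
  have lin: "linear (frechet_derivative g (at p))"
    using assms by (simp add: linear_frechet_derivative)
  have "frechet_derivative g (at p) k = frechet_derivative g (at p) (\<Sum>b\<in>Basis. (k \<bullet> b) *\<^sub>R b)"
    by (simp add: euclidean_representation)
  also have "\<dots> = (\<Sum>b\<in>Basis. (k \<bullet> b) * frechet_derivative g (at p) b)"
    by (simp add: linear_sum[OF lin] linear_scale[OF lin])
  also have "\<dots> = grad_at g p \<bullet> k"
    by (simp add: grad_at_def inner_sum_left mult.commute) (simp add: inner_commute)
  finally show ?thesis .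
qed

text \<open>Taylor's bound with the remainder taken from a Lipschitz estimate of the first partials
  at the one point \<open>p\<close>: the mean value theorem on a segment from \<open>p\<close>
  compares the gradient at an intermediate point with that at \<open>p\<close>.\<close>

lemma C2_quadratic_upper_bound:
  fixes \<rho> :: "'a::euclidean_space \<Rightarrow> real"
  assumes "open U" "p \<in> U" and C2: "Ck_on (Suc (Suc k)) U \<rho>"
  obtains K d where "K > 0" "d > 0" "ball p d \<subseteq> U"
    "\<And>q. q \<in> ball p d \<Longrightarrow> \<rho> q \<le> \<rho> p + grad_at \<rho> p \<bullet> (q - p) + K * (norm (q - p))\<^sup>2"
proof -
  have diff: "\<rho> differentiable (at q)" if "q \<in> U" for q using C2 that by simp
  have "\<exists>C d. C \<ge> 0 \<and> d > 0 \<and> (\<forall>q. norm (q - p) < d \<longrightarrow>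
      norm (frechet_derivative \<rho> (at q) b - frechet_derivative \<rho> (at p) b) \<le> C * norm (q - p))"
    if "b \<in> Basis" for b
  proof -
    have "(\<lambda>q. frechet_derivative \<rho> (at q) b) differentiable (at p)" using C2 that \<open>p \<in> U\<close> by simp
    from differentiable_at_imp_lipschitz_at[OF this] show ?thesis by metis
  qed
  then obtain C d where Cd: "\<And>b. b \<in> Basis \<Longrightarrow> C b \<ge> 0" "\<And>b. b \<in> Basis \<Longrightarrow> d b > 0"
    "\<And>b q. b \<in> Basis \<Longrightarrow> norm (q - p) < d b \<Longrightarrow>
      norm (frechet_derivative \<rho> (at q) b - frechet_derivative \<rho> (at p) b) \<le> C b * norm (q - p)"
    by metis
  obtain d0 where d0: "d0 > 0" "ball p d0 \<subseteq> U" using \<open>open U\<close> \<open>p \<in> U\<close> open_contains_ball by blast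
  define d1 where "d1 = Min (insert d0 (d ` Basis))"
  have "d1 > 0" "d1 \<le> d0" "\<And>b. b \<in> Basis \<Longrightarrow> d1 \<le> d b"
    unfolding d1_def using d0(1) Cd(2) by (simp_all add: Min_gr_iff del: Min_insert)
  define K where "K = (\<Sum>b\<in>Basis. C b) + 1"
  have "K > 0" unfolding K_def using Cd(1) sum_nonneg[of Basis C] by force
  show ?thesis
  proof
    show "K > 0" "d1 > 0" by fact+
    show "ball p d1 \<subseteq> U" using d0 \<open>d1 \<le> d0\<close> by (meson order.trans subset_ball)
    fix q assume q: "q \<in> ball p d1"
    define h where "h = q - p"
    have h: "norm h < d1" using q by (simp add: h_def dist_norm norm_minus_commute)
    have seg: "p + t *\<^sub>R h \<in> U \<and> norm (t *\<^sub>R h) < d1 \<and> norm (t *\<^sub>R h) \<le> norm h"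
      if "0 \<le> t" "t \<le> 1" for t
    proof -
      have "norm (t *\<^sub>R h) \<le> norm h" using that by (simp add: mult_left_le_one_le)
      moreover have "p + t *\<^sub>R h \<in> ball p d0" using calculation h \<open>d1 \<le> d0\<close> by (simp add: dist_norm)
      ultimately show ?thesis using h d0 by auto
    qed
    have der: "((\<lambda>t. \<rho> (p + t *\<^sub>R h)) has_derivative (\<lambda>s. grad_at \<rho> (p + t *\<^sub>R h) \<bullet> (s *\<^sub>R h)))
      (at t)"
      if "0 \<le> t" "t \<le> 1" for t
    proof -
      have "(\<rho> has_derivative (\<lambda>k. grad_at \<rho> (p + t *\<^sub>R h) \<bullet> k)) (at (p + t *\<^sub>R h))"
        using diff[of "p + t *\<^sub>R h"] seg[OF that] frechet_derivative_works[of \<rho> "at (p + t *\<^sub>R h)"]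
        by (simp add: frechet_derivative_eq_grad_at[symmetric])
      moreover have "((\<lambda>t. p + t *\<^sub>R h) has_derivative (\<lambda>s. s *\<^sub>R h)) (at t)"
        by (auto intro!: derivative_eq_intros)
      ultimately show ?thesis using has_derivative_compose by blast
    qed
    obtain \<xi> where \<xi>: "0 < \<xi>" "\<xi> < 1" "\<rho> (p + 1 *\<^sub>R h) - \<rho> (p + 0 *\<^sub>R h)
      = grad_at \<rho> (p + \<xi> *\<^sub>R h) \<bullet> ((1 - 0) *\<^sub>R h)"
    proof (rule mvt[of 0 1 "\<lambda>t. \<rho> (p + t *\<^sub>R h)" "\<lambda>t s. grad_at \<rho> (p + t *\<^sub>R h) \<bullet> (s *\<^sub>R h)"])
      show "continuous_on {0..1} (\<lambda>t. \<rho> (p + t *\<^sub>R h))"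
        by (intro continuous_at_imp_continuous_on ballI has_derivative_continuous[OF der]) auto
    qed (use that der in auto)
    have "(grad_at \<rho> (p + \<xi> *\<^sub>R h) - grad_at \<rho> p) \<bullet> h
        = (\<Sum>b\<in>Basis. (frechet_derivative \<rho> (at (p + \<xi> *\<^sub>R h)) b - frechet_derivative \<rho> (at p) b) *
          (h \<bullet> b))"
      unfolding grad_at_def sum_subtractf[symmetric] inner_sum_left
      by (intro sum.cong refl) (simp add: inner_diff_left left_diff_distrib inner_commute[of h])
    also have "\<dots> \<le> (\<Sum>b\<in>Basis. C b * (norm h)\<^sup>2)"
    proof (rule sum_mono)
      fix b :: 'a assume b: "b \<in> Basis"
      have "norm (p + \<xi> *\<^sub>R h - p) < d b" using seg[of \<xi>] \<xi> \<open>\<And>b. b \<in> Basis \<Longrightarrow> d1 \<le> d b\<close>[OF b] by auto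
      from Cd(3)[OF b this]
      have "\<bar>frechet_derivative \<rho> (at (p + \<xi> *\<^sub>R h)) b - frechet_derivative \<rho> (at p) b\<bar>
        \<le> C b * norm (\<xi> *\<^sub>R h)" by simp
      also have "\<dots> \<le> C b * norm h" using seg[of \<xi>] \<xi> Cd(1)[OF b] by (intro mult_left_mono) auto
      finally have "\<bar>frechet_derivative \<rho> (at (p + \<xi> *\<^sub>R h)) b - frechet_derivative \<rho> (at p) b\<bar> *
        \<bar>h \<bullet> b\<bar>
          \<le> (C b * norm h) * norm h"
        using Basis_le_norm[OF b, of h] Cd(1)[OF b] by (intro mult_mono) auto
      then show "(frechet_derivative \<rho> (at (p + \<xi> *\<^sub>R h)) b - frechet_derivative \<rho> (at p) b) * (h
        \<bullet> b) \<le> C b * (norm h)\<^sup>2"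
        unfolding abs_mult[symmetric] by (simp add: power2_eq_square)
    qed
    also have "\<dots> \<le> K * (norm h)\<^sup>2"
      unfolding sum_distrib_right[symmetric] K_def by (intro mult_right_mono) auto
    finally show "\<rho> q \<le> \<rho> p + grad_at \<rho> p \<bullet> (q - p) + K * (norm (q - p))\<^sup>2"
      using \<xi>(3) by (simp add: h_def inner_diff_left)
  qed
qed

text \<open>A point p + k of the ball of radius r tangent at p satisfies |k|^2 < - 2 r (\<nu> . k).
  In the quadratic bound for the defining function the linear term then outweighs K |k|^2 as soon as
  2 K r <= n, where n is the length of the gradient. All small radii are offered because in the
  cylinder the ball must also fit between bottom and top.\<close>

lemma interior_ball_condition:
  fixes D :: "'a::euclidean_space set"
  assumes D: "smooth_bounded_domain D" and p: "p \<in> frontier D"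
  defines "\<nu> \<equiv> outer_normal D p"
  obtains R where "R > 0" "norm \<nu> = 1" "\<And>r. 0 < r \<Longrightarrow> r \<le> R \<Longrightarrow> ball (p - r *\<^sub>R \<nu>) r \<subseteq> D"
proof -
  have "\<exists>U \<rho>. local_defining_fn D p U \<rho>" using D p by (auto simp: smooth_bounded_domain_def)
  \<comment> \<open>\<open>outer_normal\<close> is a choice among normalised gradients of local
    defining functions, so the ball is built from a defining function that produces the chosen
    vector.\<close>
  then have "\<exists>\<nu> U \<rho>. local_defining_fn D p U \<rho> \<and> \<nu> = sgn (grad_at \<rho> p)" by blast
  then have "\<exists>U \<rho>. local_defining_fn D p U \<rho> \<and> \<nu> = sgn (grad_at \<rho> p)"
    unfolding \<nu>_def outer_normal_def by (rule someI_ex)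
  then obtain U \<rho> where \<rho>: "local_defining_fn D p U \<rho>" and \<nu>: "\<nu> = sgn (grad_at \<rho> p)" by blast
  then have U: "open U" "p \<in> U" and smooth: "Ck_on (Suc (Suc 0)) U \<rho>"
    and inD: "\<And>q. q \<in> U \<Longrightarrow> \<rho> q < 0 \<Longrightarrow> q \<in> D" and "\<rho> p = 0" "grad_at \<rho> p \<noteq> 0"
    using p unfolding local_defining_fn_def Cinf_on_def by blast+
  obtain K d where Kd: "K > 0" "d > 0" "ball p d \<subseteq> U"
    "\<And>q. q \<in> ball p d \<Longrightarrow> \<rho> q \<le> \<rho> p + grad_at \<rho> p \<bullet> (q - p) + K * (norm (q - p))\<^sup>2"
    using C2_quadratic_upper_bound[OF U smooth] by metis
  define n where "n = norm (grad_at \<rho> p)"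
  have "n > 0" using \<open>grad_at \<rho> p \<noteq> 0\<close> by (simp add: n_def)
  have gr: "grad_at \<rho> p = n *\<^sub>R \<nu>" using \<open>n > 0\<close> by (simp add: \<nu> n_def sgn_div_norm)
  have n1: "norm \<nu> = 1" using \<open>grad_at \<rho> p \<noteq> 0\<close> by (simp add: \<nu> norm_sgn)
  then have nn: "\<nu> \<bullet> \<nu> = 1" by (simp add: norm_eq_1)
  show ?thesis
  proof
    \<comment> \<open>Points of the ball are within 2 r of p, so d / 2 keeps them where the
      quadratic bound holds; n / (2 K) lets the linear term win.\<close>
    show "min (d / 2) (n / (2 * K)) > 0" using Kd \<open>n > 0\<close> by simp
    show "norm \<nu> = 1" by fact
    fix r assume r: "0 < r" "r \<le> min (d / 2) (n / (2 * K))"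
    show "ball (p - r *\<^sub>R \<nu>) r \<subseteq> D"
    proof
      fix q assume q: "q \<in> ball (p - r *\<^sub>R \<nu>) r"
      define k where "k = q - p"
      have less: "norm (k + r *\<^sub>R \<nu>) < r" using q by
        (simp add: k_def dist_norm norm_minus_commute algebra_simps)
      then have "(norm (k + r *\<^sub>R \<nu>))\<^sup>2 < r\<^sup>2" by (intro power_strict_mono) auto
      moreover have "(norm (k + r *\<^sub>R \<nu>))\<^sup>2 = (norm k)\<^sup>2 + 2 * r * (\<nu> \<bullet> k) + r\<^sup>2"
        unfolding power2_norm_eq_inner using nn
        by (simp add: inner_add_left inner_add_right inner_commute power2_eq_square algebra_simps)
      ultimately have 1: "(norm k)\<^sup>2 + 2 * r * (\<nu> \<bullet> k) < 0" by linarith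
      have "norm k \<le> norm (k + r *\<^sub>R \<nu>) + norm (r *\<^sub>R \<nu>)"
        using norm_triangle_ineq4[of "k + r *\<^sub>R \<nu>" "r *\<^sub>R \<nu>"] by simp
      then have "norm k < d" using less r n1 by simp
      then have qd: "q \<in> ball p d" by (simp add: k_def dist_norm norm_minus_commute)
      have "r * (2 * K) \<le> n" using r Kd(1) by (simp add: pos_le_divide_eq)
      then have "(r * (2 * K)) * (norm k)\<^sup>2 \<le> n * (norm k)\<^sup>2" by (intro mult_right_mono) auto
      moreover have "n * ((norm k)\<^sup>2 + 2 * r * (\<nu> \<bullet> k)) < 0" using 1 \<open>n > 0\<close>
        by (simp add: mult_pos_neg)
      ultimately have "(2 * r) * (n * (\<nu> \<bullet> k) + K * (norm k)\<^sup>2) < 0" by (simp add: algebra_simps)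
      then have "n * (\<nu> \<bullet> k) + K * (norm k)\<^sup>2 < 0" using r by (simp add: mult_less_0_iff)
      then have "\<rho> q < 0" using Kd(4)[OF qd] \<open>\<rho> p = 0\<close> gr by (simp add: k_def)
      then show "q \<in> D" using inD qd Kd(3) by blast
    qed
  qed
qed

lemmas hk_integral_add = Henstock_Kurzweil_Integration.integral_add
lemmas hk_integral_diff = Henstock_Kurzweil_Integration.integral_diff
lemmas hk_integral_combine = Henstock_Kurzweil_Integration.integral_combine

section \<open>Decreasing rearrangement of continuous functions\<close>

lemma compact_continuous_abs_bound:
  fixes f :: "'a::topological_space \<Rightarrow> real"
  assumes "compact S" "continuous_on S f"
  obtains B where "\<And>x. x \<in> S \<Longrightarrow> \<bar>f x\<bar> \<le> B"
  using compact_imp_bounded[OF compact_continuous_image[OF assms(2,1)]] unfolding bounded_real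
    by blast

lemma integral_abs_bound_interval:
  fixes f :: "real \<Rightarrow> real"
  assumes "f integrable_on {a..b}" "a \<le> b" "\<And>x. x \<in> {a<..<b} \<Longrightarrow> \<bar>f x\<bar> \<le> B"
  shows "\<bar>integral {a..b} f\<bar> \<le> B * (b - a)"
proof -
  have "\<bar>integral {a<..<b} f\<bar> \<le> integral {a<..<b} (\<lambda>x. B)"
    unfolding real_norm_def[symmetric] using assms
    by (intro integral_norm_bound_integral)
      (auto simp: integrable_on_open_interval_real integrable_continuous_interval)
  also have "\<dots> = integral {a..b} (\<lambda>x. B)" by (rule integral_open_interval_real[symmetric])
  also have "\<dots> = B * (b - a)" using assms by simp
  finally show ?thesis by (simp add: integral_open_interval_real)
qed

definition superlevel :: "real \<Rightarrow> (real \<Rightarrow> real) \<Rightarrow> real \<Rightarrow> real set" where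
  "superlevel l p s = {y\<in>{0<..<l}. s < p y}"

definition superlevel_measure :: "real \<Rightarrow> (real \<Rightarrow> real) \<Rightarrow> real \<Rightarrow> real" where
  "superlevel_measure l p s = measure lebesgue (superlevel l p s)"

lemma open_superlevel:
  fixes p :: "real \<Rightarrow> real"
  assumes "continuous_on {0..l} p"
  shows "open (superlevel l p s)"
proof -
  have "continuous_on {0<..<l} p" by (rule continuous_on_subset[OF assms]) auto
  then have "open ({0<..<l} \<inter> p -` {s<..})"
    by (intro continuous_open_preimage) auto
  moreover have "superlevel l p s = {0<..<l} \<inter> p -` {s<..}" by (auto simp: superlevel_def)
  ultimately show ?thesis by simp
qed

lemma superlevel_lmeasurable:
  fixes p :: "real \<Rightarrow> real"
  assumes "continuous_on {0..l} p"
  shows "superlevel l p s \<in> lmeasurable"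
  by (rule lmeasurable_open[OF _ open_superlevel[OF assms]])
     (rule bounded_subset[of "{0..l}"], auto simp: superlevel_def)

lemma emeasure_superlevel:
  fixes p :: "real \<Rightarrow> real"
  assumes "continuous_on {0..l} p"
  shows "emeasure lebesgue (superlevel l p s) = ennreal (superlevel_measure l p s)"
  using superlevel_lmeasurable[OF assms] unfolding superlevel_measure_def
  by (rule emeasure_eq_measure2)

lemma superlevel_measure_bounds:
  fixes p :: "real \<Rightarrow> real"
  assumes "continuous_on {0..l} p" "l > 0"
  shows "0 \<le> superlevel_measure l p s" "superlevel_measure l p s \<le> l"
proof -
  show "0 \<le> superlevel_measure l p s" by (simp add: superlevel_measure_def)
  have "superlevel_measure l p s \<le> measure lebesgue {0<..<l}"
    unfolding superlevel_measure_def
    using superlevel_lmeasurable[OF assms(1), of s]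
    by (intro measure_mono_fmeasurable) (auto simp: superlevel_def dest: fmeasurableD)
  then show "superlevel_measure l p s \<le> l" using assms by simp
qed

lemma superlevel_measure_antimono:
  fixes p :: "real \<Rightarrow> real"
  assumes "continuous_on {0..l} p" "s \<le> s'"
  shows "superlevel_measure l p s' \<le> superlevel_measure l p s"
  unfolding superlevel_measure_def using assms
  by (intro measure_mono_fmeasurable superlevel_lmeasurable fmeasurableD)
    (auto simp: superlevel_def)

lemma superlevel_measure_above:
  assumes "\<And>y. y \<in> {0<..<l} \<Longrightarrow> p y \<le> B"
  shows "superlevel_measure l p B = 0"
proof -
  have "superlevel l p B = {}" using assms by (force simp: superlevel_def)
  then show ?thesis by (simp add: superlevel_measure_def)
qed

lemma superlevel_measure_below:
  assumes "\<And>y. y \<in> {0<..<l} \<Longrightarrow> b < p y" "l > 0"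
  shows "superlevel_measure l p b = l"
proof -
  have "superlevel l p b = {0<..<l}" using assms by (force simp: superlevel_def)
  then show ?thesis using assms by (simp add: superlevel_measure_def)
qed

lemma superlevel_measure_right_continuous:
  fixes p :: "real \<Rightarrow> real"
  assumes "continuous_on {0..l} p"
  shows "(\<lambda>n. superlevel_measure l p (s + 1 / Suc n)) \<longlonglongrightarrow> superlevel_measure l p s"
proof -
  have "(\<Union>n. superlevel l p (s + 1 / Suc n)) = superlevel l p s"
  proof (intro subset_antisym subsetI)
    fix y assume y: "y \<in> superlevel l p s"
    then obtain n where "1 / real (Suc n) < p y - s"
      using nat_approx_posE[of "p y - s"] by (auto simp: superlevel_def)
    then show "y \<in> (\<Union>n. superlevel l p (s + 1 / Suc n))"
      using y by (auto intro!: exI[of _ n] simp: superlevel_def)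
  next
    fix y assume "y \<in> (\<Union>n. superlevel l p (s + 1 / Suc n))"
    then obtain n where "y \<in> {0<..<l}" "s + 1 / Suc n < p y" by (auto simp: superlevel_def)
    moreover have "1 / real (Suc n) > 0" by simp
    ultimately have "y \<in> {0<..<l}" "s < p y" by linarith+
    then show "y \<in> superlevel l p s" by (simp add: superlevel_def)
  qed
  moreover have "incseq (\<lambda>n. superlevel l p (s + 1 / Suc n))"
  proof (intro incseq_SucI subsetI)
    fix n y assume y: "y \<in> superlevel l p (s + 1 / Suc n)"
    have "1 / real (Suc (Suc n)) \<le> 1 / real (Suc n)" by (simp add: frac_le)
    then have "s + 1 / Suc (Suc n) < p y" using y unfolding superlevel_def mem_Collect_eq
      by linarith
    then show "y \<in> superlevel l p (s + 1 / Suc (Suc n))" using y by (simp add: superlevel_def)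
  qed
  ultimately show ?thesis
    using Lim_measure_incseq[of "\<lambda>n. superlevel l p (s + 1 / Suc n)" lebesgue]
      superlevel_lmeasurable[OF assms] emeasure_superlevel[OF assms]
    unfolding superlevel_measure_def by (simp add: fmeasurableD image_subset_iff)
qed

text \<open>Rearrangement and distribution function are generalised inverses. Strictness on both
  sides comes from right continuity in s: a threshold slightly above s still has superlevel measure
  greater than t, so the infimum exceeds s. The endpoints are excluded because
  \<open>decr_rearr\<close> takes its essential bounds there.\<close>

lemma less_decr_rearr_iff:
  fixes p :: "real \<Rightarrow> real"
  assumes p: "continuous_on {0..l} p" and t: "0 < t" "t < l"
  shows "s < decr_rearr l p t \<longleftrightarrow> t < superlevel_measure l p s"
proof -
  let ?\<mu> = "superlevel_measure l p"
  have "l > 0" using t by simp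
  define S where "S = {s. ?\<mu> s \<le> t}"
  have "S = {s. emeasure lebesgue {y\<in>{0<..<l}. s < p y} \<le> ennreal t}"
    unfolding superlevel_def[symmetric] emeasure_superlevel[OF p] S_def using t by simp
  then have dr: "decr_rearr l p t = Inf S"
    using t by (simp add: decr_rearr_def)
  obtain B where B: "\<And>y. y \<in> {0..l} \<Longrightarrow> \<bar>p y\<bar> \<le> B"
    using compact_continuous_abs_bound[OF compact_Icc p] by blast
  have "p y \<le> B" if "y \<in> {0<..<l}" for y using B[of y] that by auto
  then have "B \<in> S" using superlevel_measure_above[of l p B] t by (simp add: S_def)
  have "bdd_below S"
  proof (rule bdd_belowI[of _ "- B - 1"])
    fix x assume "x \<in> S"
    show "- B - 1 \<le> x"
    proof (rule ccontr)
      assume "\<not> - B - 1 \<le> x"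
      then have "x < p y" if "y \<in> {0<..<l}" for y using B[of y] that by auto
      then have "?\<mu> x = l" using \<open>l > 0\<close> by (intro superlevel_measure_below) auto
      then show False using \<open>x \<in> S\<close> t by (simp add: S_def)
    qed
  qed
  show ?thesis
  proof
    assume "s < decr_rearr l p t"
    then have "s \<notin> S" using cInf_lower[OF _ \<open>bdd_below S\<close>, of s] by (auto simp: dr)
    then show "t < ?\<mu> s" by (simp add: S_def)
  next
    assume "t < ?\<mu> s"
    then have "\<forall>\<^sub>F n in sequentially. t < ?\<mu> (s + 1 / Suc n)"
      using superlevel_measure_right_continuous[OF p, of s] by (intro order_tendstoD(1))
    then obtain n where n: "t < ?\<mu> (s + 1 / Suc n)" using eventually_sequentially by auto
    have "s + 1 / Suc n \<le> Inf S"
    proof (rule cInf_greatest)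
      show "S \<noteq> {}" using \<open>B \<in> S\<close> by auto
      fix x assume "x \<in> S"
      show "s + 1 / Suc n \<le> x"
      proof (rule ccontr)
        assume "\<not> s + 1 / Suc n \<le> x"
        then have "?\<mu> (s + 1 / Suc n) \<le> ?\<mu> x" by (intro superlevel_measure_antimono[OF p]) auto
        then show False using \<open>x \<in> S\<close> n by (simp add: S_def)
      qed
    qed
    moreover have "1 / real (Suc n) > 0" by simp
    ultimately show "s < decr_rearr l p t" unfolding dr by linarith
  qed
qed

lemma decr_rearr_antimono:
  fixes p :: "real \<Rightarrow> real"
  assumes "continuous_on {0..l} p" "0 < t" "t \<le> t'" "t' < l"
  shows "decr_rearr l p t' \<le> decr_rearr l p t"
proof (rule ccontr)
  assume "\<not> ?thesis"
  then have "decr_rearr l p t < decr_rearr l p t'" by simp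
  then have "t' < superlevel_measure l p (decr_rearr l p t)"
    using less_decr_rearr_iff[OF assms(1), of t'] assms by auto
  then show False using less_decr_rearr_iff[OF assms(1), of t "decr_rearr l p t"] assms by auto
qed

lemma decr_rearr_bounds:
  fixes p :: "real \<Rightarrow> real"
  assumes p: "continuous_on {0..l} p" and t: "0 < t" "t < l"
    and B: "\<And>y. y \<in> {0<..<l} \<Longrightarrow> a \<le> p y \<and> p y \<le> b"
  shows "a \<le> decr_rearr l p t" "decr_rearr l p t \<le> b"
proof -
  show "decr_rearr l p t \<le> b"
    using less_decr_rearr_iff[OF p t, of b] superlevel_measure_above[of l p b] B t by fastforce
  show "a \<le> decr_rearr l p t"
  proof (rule ccontr)
    assume "\<not> ?thesis"
    then obtain c where "decr_rearr l p t < c" "c < a" using dense not_le by blast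
    moreover have "superlevel_measure l p c = l" using \<open>c < a\<close> B t
      by (intro superlevel_measure_below) force+
    ultimately show False using less_decr_rearr_iff[OF p t, of c] t by auto
  qed
qed

lemma decr_rearr_superlevel:
  fixes p :: "real \<Rightarrow> real"
  assumes p: "continuous_on {0..l} p" and l: "l > 0"
  shows "{t\<in>{0<..<l}. s < decr_rearr l p t} = {0<..<superlevel_measure l p s}"
  using less_decr_rearr_iff[OF p] superlevel_measure_bounds[OF p l, of s] by fastforce

text \<open>By \<open>decr_rearr_superlevel\<close> both functions give every upper ray the same
  finite measure, and upper rays determine a measure on the line. Working on the open interval
  avoids the separately defined endpoint values.\<close>

lemma distr_decr_rearr:
  fixes p :: "real \<Rightarrow> real"
  assumes p: "continuous_on {0..l} p" and l: "l > 0"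
  defines "N \<equiv> restrict_space lborel {0<..<l}"
  shows "p \<in> borel_measurable N" "decr_rearr l p \<in> borel_measurable N"
    "distr N borel (decr_rearr l p) = distr N borel p"
proof -
  have spN: "space N = {0<..<l}" by (simp add: N_def space_restrict_space)
  have setsI: "A \<in> sets N" if "A \<subseteq> {0<..<l}" "open A" for A
    using that by (auto simp: N_def sets_restrict_space_iff)
  show m1: "p \<in> borel_measurable N"
    by (rule borel_measurableI_greater, unfold spN superlevel_def[symmetric],
        rule setsI[OF _ open_superlevel[OF p]]) (auto simp: superlevel_def)
  show m2: "decr_rearr l p \<in> borel_measurable N"
  proof (rule borel_measurableI_greater)
    fix y
    show "{x \<in> space N. y < decr_rearr l p x} \<in> sets N"
      unfolding spN decr_rearr_superlevel[OF p l]
      by (rule setsI) (use superlevel_measure_bounds[OF p l, of y] in auto)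
  qed
  have emN: "emeasure N A = emeasure lebesgue A" if "A \<subseteq> {0<..<l}" "open A" for A
    using that by (simp add: N_def emeasure_restrict_space)
  have e1: "emeasure (distr N borel p) {x<..} = ennreal (superlevel_measure l p x)" for x
  proof -
    have "p -` {x<..} \<inter> space N = superlevel l p x" by (auto simp: spN superlevel_def)
    moreover have "superlevel l p x \<subseteq> {0<..<l}" by (auto simp: superlevel_def)
    ultimately show ?thesis using emN[OF _ open_superlevel[OF p, of x]] emeasure_superlevel[OF p,
      of x]
      by (simp add: emeasure_distr[OF m1])
  qed
  have e2: "emeasure (distr N borel (decr_rearr l p)) {x<..}
    = ennreal (superlevel_measure l p x)" for x
  proof -
    have "decr_rearr l p -` {x<..} \<inter> space N = {t\<in>{0<..<l}. x < decr_rearr l p t}"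
      by (auto simp: spN)
    then have "decr_rearr l p -` {x<..} \<inter> space N = {0<..<superlevel_measure l p x}"
      unfolding decr_rearr_superlevel[OF p l] .
    moreover have "emeasure N {0<..<superlevel_measure l p x} = ennreal (superlevel_measure l p x)"
      using superlevel_measure_bounds[OF p l, of x] by (subst emN) auto
    ultimately show ?thesis using emeasure_distr[OF m2, of "{x<..}"] by (metis greaterThan_borel)
  qed
  show "distr N borel (decr_rearr l p) = distr N borel p"
    by (rule measure_eqI_lessThan) (simp_all only: sets_distr e1 e2 ennreal_less_top
      infinity_ennreal_def)
qed

lemma equimeasurable_integral:
  fixes p \<phi> :: "real \<Rightarrow> real"
  assumes p: "continuous_on {0..l} p" and l: "l > 0" and \<phi>: "continuous_on UNIV \<phi>"
  shows "(\<lambda>t. \<phi> (decr_rearr l p t)) integrable_on {0..l}"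
    "integral {0..l} (\<lambda>t. \<phi> (decr_rearr l p t)) = integral {0..l} (\<lambda>t. \<phi> (p t))"
proof -
  define N where "N = restrict_space lborel {0<..<l}"
  note d = distr_decr_rearr[OF p l, folded N_def]
  have spN: "space N = {0<..<l}" by (simp add: N_def space_restrict_space)
  have b\<phi>: "\<phi> \<in> borel_measurable borel" using \<phi> by (rule borel_measurable_continuous_onI)
  obtain B where B: "\<And>y. y \<in> {0..l} \<Longrightarrow> \<bar>p y\<bar> \<le> B"
    using compact_continuous_abs_bound[OF compact_Icc p] by blast
  obtain C where C: "\<And>y. y \<in> {-B..B} \<Longrightarrow> \<bar>\<phi> y\<bar> \<le> C"
    using compact_continuous_abs_bound[OF compact_Icc continuous_on_subset[OF \<phi>]] by blast
  have "finite_measure N" unfolding N_def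
    by (rule finite_measureI) (use l in \<open>simp add: emeasure_restrict_space space_restrict_space\<close>)
  then interpret finite_measure N .
  have i1: "integrable N (\<lambda>t. \<phi> (p t))"
  proof (rule integrable_const_bound)
    show "AE x in N. norm (\<phi> (p x)) \<le> C"
    proof (rule AE_I2)
      fix x assume "x \<in> space N"
      then show "norm (\<phi> (p x)) \<le> C" using B[of x] by (auto simp: spN intro!: C)
    qed
    show "(\<lambda>t. \<phi> (p t)) \<in> borel_measurable N" using measurable_compose[OF d(1) b\<phi>] by simp
  qed
  have i2: "integrable N (\<lambda>t. \<phi> (decr_rearr l p t))"
  proof (rule integrable_const_bound)
    show "AE x in N. norm (\<phi> (decr_rearr l p x)) \<le> C"
    proof (rule AE_I2)
      fix x assume "x \<in> space N"
      then have "0 < x" "x < l" by (auto simp: spN)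
      moreover have "-B \<le> p y \<and> p y \<le> B" if "y \<in> {0<..<l}" for y using B[of y] that by auto
      ultimately show "norm (\<phi> (decr_rearr l p x)) \<le> C"
        using decr_rearr_bounds[OF p, of x "-B" B] by (auto intro!: C)
    qed
    show "(\<lambda>t. \<phi> (decr_rearr l p t)) \<in> borel_measurable N" using measurable_compose[OF d(2) b\<phi>]
      by simp
  qed
  have conv: "f integrable_on {0..l} \<and> integral {0..l} f = integral\<^sup>L N f"
    if "integrable N f" for f :: "real \<Rightarrow> real"
  proof -
    have si: "set_integrable lborel {0<..<l} f"
      using that unfolding N_def set_integrable_def by (subst (asm) integrable_restrict_space) auto
    have "f integrable_on {0<..<l}" "integral {0<..<l} f = (LINT x:{0<..<l}|lborel. f x)"
      using set_borel_integral_eq_integral[OF si] by auto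
    moreover have "(LINT x:{0<..<l}|lborel. f x) = integral\<^sup>L N f"
      unfolding N_def set_lebesgue_integral_def by (subst integral_restrict_space) auto
    ultimately show ?thesis
      by (simp add: integrable_on_open_interval_real integral_open_interval_real)
  qed
  show "(\<lambda>t. \<phi> (decr_rearr l p t)) integrable_on {0..l}" using conv[OF i2] by simp
  have "integral\<^sup>L N (\<lambda>t. \<phi> (decr_rearr l p t)) = integral\<^sup>L (distr N borel (decr_rearr l p)) \<phi>"
    by (rule integral_distr[OF d(2) b\<phi>, symmetric])
  also have "\<dots> = integral\<^sup>L N (\<lambda>t. \<phi> (p t))"
    unfolding d(3) by (rule integral_distr[OF d(1) b\<phi>])
  finally show "integral {0..l} (\<lambda>t. \<phi> (decr_rearr l p t)) = integral {0..l} (\<lambda>t. \<phi> (p t))"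
    using conv[OF i1] conv[OF i2] by simp
qed

lemma decr_rearr_integrable:
  fixes p :: "real \<Rightarrow> real"
  assumes "continuous_on {0..l} p" "l > 0" "0 \<le> a" "b \<le> l"
  shows "decr_rearr l p integrable_on {a..b}"
  using equimeasurable_integral(1)[OF assms(1,2), of "\<lambda>x. x"] assms(3,4)
  by (auto intro: integrable_on_subinterval continuous_on_id)

lemma integral_decr_rearr_total:
  fixes p :: "real \<Rightarrow> real"
  assumes "continuous_on {0..l} p" "l > 0"
  shows "integral {0..l} (decr_rearr l p) = integral {0..l} p"
  using equimeasurable_integral(2)[OF assms, of "\<lambda>x. x"] by (simp add: continuous_on_id)

text \<open>The rearrangement is at least s on (0, y) and at most s on (y, l), so its integral up to
  y is s y plus the total of its excess over s, which equimeasurability transfers to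
  \<open>p\<close>. After this, the bathtub arguments see the rearrangement only through the number
  s.\<close>

lemma integral_decr_rearr_eq:
  fixes p :: "real \<Rightarrow> real"
  assumes p: "continuous_on {0..l} p" and y: "0 < y" "y < l"
  defines "s \<equiv> decr_rearr l p y"
  shows "integral {0..y} (decr_rearr l p) = s * y + integral {0..l} (\<lambda>t. max 0 (p t - s))"
proof -
  have l: "l > 0" using y by simp
  note e = equimeasurable_integral[OF p l, of "\<lambda>x. max 0 (x - s)"]
  have c: "continuous_on UNIV (\<lambda>x::real. max 0 (x - s))" by (intro continuous_intros)
  have "integral {0..l} (\<lambda>t. max 0 (p t - s)) = integral {0..l} (\<lambda>t. max 0 (decr_rearr l p t - s))"
    using e(2)[OF c] by simp
  also have "\<dots> = integral {0..y} (\<lambda>t. max 0 (decr_rearr l p t - s)) + integral {y..l} (\<lambda>t. max 0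
    (decr_rearr l p t - s))"
    using hk_integral_combine[of 0 y l, OF _ _ e(1)[OF c]] y by simp
  also have "integral {0..y} (\<lambda>t. max 0 (decr_rearr l p t - s))
    = integral {0..y} (\<lambda>t. decr_rearr l p t - s)"
    by (rule integral_spike[of "{0}"]) (use decr_rearr_antimono[OF p] y in \<open>auto simp: s_def\<close>)
  also have "\<dots> = integral {0..y} (decr_rearr l p) - integral {0..y} (\<lambda>t. s)"
    using decr_rearr_integrable[OF p l, of 0 y] y by (intro hk_integral_diff) auto
  also have "integral {y..l} (\<lambda>t. max 0 (decr_rearr l p t - s)) = integral {y..l} (\<lambda>t. 0)"
  proof (rule integral_spike[of "{l}"])
    fix x assume "x \<in> {y..l} - {l}"
    then show "0 = max 0 (decr_rearr l p x - s)"
      using decr_rearr_antimono[OF p, of y x] y by (auto simp: s_def)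
  qed simp
  finally show ?thesis using y by simp
qed

section \<open>Weights with values in [0, 1] and the bathtub principle\<close>

definition weight_on :: "real set \<Rightarrow> (real \<Rightarrow> real) \<Rightarrow> bool" where
  "weight_on S \<theta> \<longleftrightarrow> \<theta> \<in> borel_measurable (lebesgue_on S) \<and> (\<forall>t\<in>S. 0 \<le> \<theta> t \<and> \<theta> t \<le> 1)"

lemma weight_on_bounds: "weight_on S \<theta> \<Longrightarrow> t \<in> S \<Longrightarrow> 0 \<le> \<theta> t \<and> \<theta> t \<le> 1"
  by (simp add: weight_on_def)

lemma weight_mult_integrable:
  fixes g \<theta> :: "real \<Rightarrow> real"
  assumes "weight_on {a..b} \<theta>"
    and g: "continuous_on {a..b} g"
  shows "(\<lambda>t. \<theta> t * g t) integrable_on {a..b}"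
proof -
  have "(\<lambda>t. \<theta> t * g t) absolutely_integrable_on {a..b}"
  proof (rule measurable_bounded_by_integrable_imp_absolutely_integrable[where g = "\<lambda>t. \<bar>g t\<bar>"])
    show "(\<lambda>t. \<theta> t * g t) \<in> borel_measurable (lebesgue_on {a..b})"
      using assms(1)[unfolded weight_on_def] continuous_imp_measurable_on_sets_lebesgue[OF g]
        by (intro borel_measurable_times) auto
    show "(\<lambda>t. \<bar>g t\<bar>) integrable_on {a..b}"
      using g by (intro integrable_continuous_interval continuous_intros)
    show "norm (\<theta> t * g t) \<le> \<bar>g t\<bar>" if "t \<in> {a..b}" for t
      using weight_on_bounds[OF assms(1) that] by (auto simp: abs_mult intro: mult_left_le_one_le)
  qed simp
  then show ?thesis by (rule set_lebesgue_integral_eq_integral(1))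
qed

text \<open>Pointwise \<theta> p <= s \<theta> + max 0 (p - s) for any weight and any s. With s the
  value of the rearrangement at y, the integral of the right-hand side is the one in
  \<open>integral_decr_rearr_eq\<close>.\<close>

lemma weighted_integral_le_rearr:
  fixes p \<theta> :: "real \<Rightarrow> real"
  assumes p: "continuous_on {0..l} p" and y: "0 < y" "y < l"
    and \<theta>: "weight_on {0..l} \<theta>"
    and int: "integral {0..l} \<theta> = y"
  shows "integral {0..l} (\<lambda>t. \<theta> t * p t) \<le> integral {0..y} (decr_rearr l p)"
proof -
  define s where "s = decr_rearr l p y"
  have i\<theta>: "\<theta> integrable_on {0..l}" using weight_mult_integrable[OF \<theta>, of "\<lambda>t. 1"] by simp
  have im: "(\<lambda>t. max 0 (p t - s)) integrable_on {0..l}"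
    by (intro integrable_continuous_interval continuous_intros p)
  have "integral {0..l} (\<lambda>t. \<theta> t * p t) \<le> integral {0..l} (\<lambda>t. s * \<theta> t + max 0 (p t - s))"
  proof (rule integral_le)
    show "(\<lambda>t. \<theta> t * p t) integrable_on {0..l}" by (rule weight_mult_integrable[OF \<theta> p])
    show "(\<lambda>t. s * \<theta> t + max 0 (p t - s)) integrable_on {0..l}"
      by (intro integrable_add integrable_on_mult_right i\<theta> im)
    fix t assume t: "t \<in> {0..l}"
    have "\<theta> t * (p t - s) \<le> \<theta> t * max 0 (p t - s)" using weight_on_bounds[OF \<theta> t]
      by (intro mult_left_mono) auto
    also have "\<dots> \<le> max 0 (p t - s)" using weight_on_bounds[OF \<theta> t]
      by (intro mult_left_le_one_le) auto
    finally show "\<theta> t * p t \<le> s * \<theta> t + max 0 (p t - s)" by (simp add: algebra_simps)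
  qed
  also have "\<dots> = s * y + integral {0..l} (\<lambda>t. max 0 (p t - s))"
    using i\<theta> im int by (subst hk_integral_add) (auto intro: integrable_on_mult_right)
  finally show ?thesis using integral_decr_rearr_eq[OF p y] by (simp add: s_def)
qed

text \<open>\<beta> is the share given to the level set x = s: when that set has positive measure,
  neither x > s nor x >= s may single out a set of the prescribed measure y.\<close>

definition level_weight :: "real \<Rightarrow> real \<Rightarrow> real \<Rightarrow> real" where
  "level_weight \<beta> s x = (if s < x then 1 else if x = s then \<beta> else 0)"

lemma level_weight_bounds:
  assumes "0 \<le> \<beta>" "\<beta> \<le> 1" shows "0 \<le> level_weight \<beta> s x" "level_weight \<beta> s x \<le> 1"
  using assms by (auto simp: level_weight_def)

lemma weight_on_level_weight:
  fixes p :: "real \<Rightarrow> real"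
  assumes "0 \<le> \<beta>" "\<beta> \<le> 1" and p: "continuous_on {a..b} p"
  shows "weight_on {a..b} (\<lambda>t. level_weight \<beta> s (p t))"
proof -
  have "mono (level_weight \<beta> s)" using assms by (auto simp: mono_def level_weight_def)
  then have "level_weight \<beta> s \<in> borel_measurable borel" by (rule borel_measurable_mono)
  moreover have "p \<in> borel_measurable (lebesgue_on {a..b})"
    by (rule continuous_imp_measurable_on_sets_lebesgue[OF p]) simp
  ultimately have "(\<lambda>t. level_weight \<beta> s (p t)) \<in> borel_measurable (lebesgue_on {a..b})"
    using measurable_compose by blast
  then show ?thesis using level_weight_bounds[OF assms(1,2)] by (simp add: weight_on_def)
qed

lemma level_weight_mult_integrable:
  fixes p g :: "real \<Rightarrow> real"
  assumes "0 \<le> \<beta>" "\<beta> \<le> 1" "continuous_on {a..b} p" "continuous_on {a..b} g"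
  shows "(\<lambda>t. level_weight \<beta> s (p t) * g t) integrable_on {a..b}"
  using assms by (intro weight_mult_integrable weight_on_level_weight)

lemma integral_level_weight_0:
  fixes p :: "real \<Rightarrow> real"
  assumes p: "continuous_on {0..l} p"
  shows "integral {0..l} (\<lambda>t. level_weight 0 s (p t)) = superlevel_measure l p s"
proof -
  have "integral {0..l} (\<lambda>t. level_weight 0 s (p t))
    = integral {0..l} (indicator (superlevel l p s))"
    by (rule integral_spike[of "{0,l}"]) (auto simp: level_weight_def indicator_def superlevel_def)
  also have "\<dots> = measure lebesgue (superlevel l p s \<inter> {0..l})"
    using integral_indicator[of "superlevel l p s" "{0..l}"] superlevel_lmeasurable[OF p, of s]
    by (simp add: fmeasurable_Int_fmeasurable fmeasurableD)
  also have "superlevel l p s \<inter> {0..l} = superlevel l p s" by (auto simp: superlevel_def)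
  finally show ?thesis by (simp add: superlevel_measure_def)
qed

text \<open>The measures of p > s and p >= s enclose y. The first bound is
  \<open>less_decr_rearr_iff\<close> at s itself; for the second, thresholds increasing to s have
  superlevel measure above y, and their superlevel sets shrink to p >= s.\<close>

lemma decr_rearr_level_bounds:
  fixes p :: "real \<Rightarrow> real"
  assumes p: "continuous_on {0..l} p" and y: "0 < y" "y < l"
  defines "s \<equiv> decr_rearr l p y"
  shows "integral {0..l} (\<lambda>t. level_weight 0 s (p t)) \<le> y"
    "y \<le> integral {0..l} (\<lambda>t. level_weight 1 s (p t))"
proof -
  show "integral {0..l} (\<lambda>t. level_weight 0 s (p t)) \<le> y"
    unfolding integral_level_weight_0[OF p] using less_decr_rearr_iff[OF p y, of s]
      by (simp add: s_def)
  have "(\<lambda>n. integral {0..l} (\<lambda>t. level_weight 0 (s - 1 / Suc n) (p t))) \<longlonglongrightarrow> integral {0..l} (\<lambda>t.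
    level_weight 1 s (p t))"
  proof (rule dominated_convergence(2)[where h = "\<lambda>t. 1"])
    show "(\<lambda>t. level_weight 0 (s - 1 / Suc k) (p t)) integrable_on {0..l}" for k
      using level_weight_mult_integrable[of 0 0 l p "\<lambda>t. 1"] p by simp
    fix t assume "t \<in> {0..l}"
    show "(\<lambda>k. level_weight 0 (s - 1 / Suc k) (p t)) \<longlonglongrightarrow> level_weight 1 s (p t)"
    proof (cases "s \<le> p t")
      case True
      have "level_weight 0 (s - 1 / Suc k) (p t) = level_weight 1 s (p t)" for k
      proof -
        have "1 / real (Suc k) > 0" by simp
        then have "s - 1 / real (Suc k) < p t" using True by linarith
        then show ?thesis using True by (auto simp: level_weight_def)
      qed
      then show ?thesis by simp
    next
      case False
      have "(\<lambda>k. s - 1 / real (Suc k)) \<longlonglongrightarrow> s - 0"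
        by (intro tendsto_intros LIMSEQ_Suc[OF lim_1_over_n])
      then have "\<forall>\<^sub>F k in sequentially. p t < s - 1 / real (Suc k)"
        using False by (intro order_tendstoD(1)) auto
      then have "\<forall>\<^sub>F k in sequentially. level_weight 0 (s - 1 / Suc k) (p t)
        = level_weight 1 s (p t)"
        by eventually_elim (use False in \<open>auto simp: level_weight_def\<close>)
      then show ?thesis by (rule tendsto_eventually)
    qed
  qed (auto simp: level_weight_def)
  moreover have "y \<le> integral {0..l} (\<lambda>t. level_weight 0 (s - 1 / Suc n) (p t))" for n
  proof -
    have "1 / real (Suc n) > 0" by simp
    then have "s - 1 / Suc n < decr_rearr l p y" unfolding s_def by linarith
    then show ?thesis unfolding integral_level_weight_0[OF p] using less_decr_rearr_iff[OF p y]
      by simp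
  qed
  ultimately show "y \<le> integral {0..l} (\<lambda>t. level_weight 1 s (p t))"
    by (intro LIMSEQ_le_const) auto
qed

text \<open>Equality case of \<open>weighted_integral_le_rearr\<close>: a weight that is 1 above s
  and 0 below satisfies \<theta> p = s \<theta> + max 0 (p - s) pointwise whatever its value at
  level s, which leaves \<beta> free to adjust the mass to y.\<close>

lemma optimal_weight:
  fixes p :: "real \<Rightarrow> real"
  assumes p: "continuous_on {0..l} p" and y: "0 < y" "y < l"
  defines "s \<equiv> decr_rearr l p y"
  obtains \<beta> where "0 \<le> \<beta>" "\<beta> \<le> 1" "integral {0..l} (\<lambda>t. level_weight \<beta> s (p t)) = y"
    "integral {0..l} (\<lambda>t. level_weight \<beta> s (p t) * p t) = integral {0..y} (decr_rearr l p)"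
proof -
  define m0 where "m0 = integral {0..l} (\<lambda>t. level_weight 0 s (p t))"
  define m1 where "m1 = integral {0..l} (\<lambda>t. level_weight 1 s (p t))"
  have "m0 \<le> y" "y \<le> m1" using decr_rearr_level_bounds[OF p y] by (auto simp: m0_def m1_def s_def)
  obtain \<beta> where \<beta>: "0 \<le> \<beta>" "\<beta> \<le> 1" "m0 + \<beta> * (m1 - m0) = y"
  proof (cases "m0 = m1")
    case True then show ?thesis using that[of 0] \<open>m0 \<le> y\<close> \<open>y \<le> m1\<close> by auto
  next
    case False then show ?thesis using that[of "(y - m0) / (m1 - m0)"] \<open>m0 \<le> y\<close> \<open>y \<le> m1\<close>
      by (auto simp: field_simps)
  qed
  have int: "(\<lambda>t. level_weight \<beta>' s (p t)) integrable_on {0..l}" if "0 \<le> \<beta>'" "\<beta>' \<le> 1" for \<beta>'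
    using level_weight_mult_integrable[of \<beta>' 0 l p "\<lambda>t. 1"] p that by simp
  have "integral {0..l} (\<lambda>t. level_weight \<beta> s (p t)) =
      integral {0..l} (\<lambda>t. (1 - \<beta>) * level_weight 0 s (p t) + \<beta> * level_weight 1 s (p t))"
    by (intro integral_cong) (auto simp: level_weight_def)
  also have "\<dots> = (1 - \<beta>) * m0 + \<beta> * m1" unfolding m0_def m1_def using int[of 0] int[of 1]
    by (subst hk_integral_add) (auto intro!: integrable_on_mult_right)
  also have "\<dots> = y" using \<beta>(3) by (simp add: algebra_simps)
  finally have iy: "integral {0..l} (\<lambda>t. level_weight \<beta> s (p t)) = y" .
  have im: "(\<lambda>t. max 0 (p t - s)) integrable_on {0..l}"
    by (intro integrable_continuous_interval continuous_intros p)
  have "integral {0..l} (\<lambda>t. level_weight \<beta> s (p t) * p t) =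
      integral {0..l} (\<lambda>t. s * level_weight \<beta> s (p t) + max 0 (p t - s))"
    by (intro integral_cong) (auto simp: level_weight_def)
  also have "\<dots> = s * y + integral {0..l} (\<lambda>t. max 0 (p t - s))"
    using int[OF \<beta>(1,2)] im iy by (subst hk_integral_add) (auto intro: integrable_on_mult_right)
  also have "\<dots> = integral {0..y} (decr_rearr l p)" using integral_decr_rearr_eq[OF p y]
    by (simp add: s_def)
  finally show ?thesis using that[OF \<beta>(1,2) iy] by simp
qed

text \<open>Away from the endpoints, the optimal weight of \<open>p\<close> serves as a competitor
  for \<open>q\<close>. With d a sup norm distance of two slices, this yields the continuity of the
  star function in x.\<close>

lemma rearr_integral_mono_bound:
  fixes p q :: "real \<Rightarrow> real"
  assumes p: "continuous_on {0..l} p" and q: "continuous_on {0..l} q" and y: "0 \<le> y" "y \<le> l"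
    and d: "\<And>t. t \<in> {0..l} \<Longrightarrow> p t \<le> q t + d"
  shows "integral {0..y} (decr_rearr l p) \<le> integral {0..y} (decr_rearr l q) + d * y"
proof -
  consider "y = 0" | "0 < y" "y < l" | "y = l" "l > 0" using y by linarith
  then show ?thesis
  proof cases
    case 3
    have "integral {0..l} p \<le> integral {0..l} (\<lambda>t. q t + d)"
      by (intro integral_le integrable_continuous_interval continuous_intros p q d)
    also have "\<dots> = integral {0..l} q + integral {0..l} (\<lambda>t. d)"
      by (intro hk_integral_add integrable_continuous_interval continuous_intros p q)
    finally show ?thesis using 3 integral_decr_rearr_total[OF p] integral_decr_rearr_total[OF q]
      by (simp add: mult.commute)
  next
    case 2
    obtain \<beta> where \<beta>: "0 \<le> \<beta>" "\<beta> \<le> 1" "integral {0..l} (\<lambda>t. level_weight \<beta> (decr_rearr l p y) (p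
      t)) = y"
      "integral {0..l} (\<lambda>t. level_weight \<beta> (decr_rearr l p y) (p t) * p t)
        = integral {0..y} (decr_rearr l p)"
      using optimal_weight[OF p 2] .
    define \<theta> where "\<theta> = (\<lambda>t. level_weight \<beta> (decr_rearr l p y) (p t))"
    have \<theta>: "weight_on {0..l} \<theta>"
      unfolding \<theta>_def by (rule weight_on_level_weight[OF \<beta>(1,2) p])
    have i: "(\<lambda>t. \<theta> t * g t) integrable_on {0..l}" if "continuous_on {0..l} g" for g
      using weight_mult_integrable[OF \<theta> that] .
    have "integral {0..l} (\<lambda>t. \<theta> t * p t) \<le> integral {0..l} (\<lambda>t. \<theta> t * (q t + d))"
      using weight_on_bounds[OF \<theta>] d by (intro integral_le i p q continuous_intros mult_left_mono)
        auto
    also have "\<dots> = integral {0..l} (\<lambda>t. \<theta> t * q t + d * \<theta> t)"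
      by (simp add: algebra_simps)
    also have "\<dots> = integral {0..l} (\<lambda>t. \<theta> t * q t) + d * integral {0..l} \<theta>"
      using i[of "\<lambda>t. 1"] i[OF q] by (subst hk_integral_add) (auto intro!: integrable_on_mult_right)
    also have "\<dots> \<le> integral {0..y} (decr_rearr l q) + d * y"
      using weighted_integral_le_rearr[OF q 2 \<theta>] \<beta>(3) by (simp add: \<theta>_def)
    finally show ?thesis using \<beta>(4) by (simp add: \<theta>_def)
  qed simp
qed

lemma rearr_integral_lipschitz:
  fixes p :: "real \<Rightarrow> real"
  assumes p: "continuous_on {0..l} p" and y: "0 \<le> y" "y \<le> y'" "y' \<le> l" and "l > 0"
    and B: "\<And>t. t \<in> {0..l} \<Longrightarrow> \<bar>p t\<bar> \<le> B"
  shows "\<bar>integral {0..y'} (decr_rearr l p) - integral {0..y} (decr_rearr l p)\<bar> \<le> B * (y' - y)"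
proof -
  have i: "decr_rearr l p integrable_on {0..y'}" "decr_rearr l p integrable_on {y..y'}"
    using decr_rearr_integrable[OF p \<open>l > 0\<close>] y by auto
  have "integral {0..y'} (decr_rearr l p) - integral {0..y} (decr_rearr l p)
    = integral {y..y'} (decr_rearr l p)"
    using hk_integral_combine[of 0 y y', OF _ _ i(1)] y by simp
  also have "\<bar>\<dots>\<bar> \<le> B * (y' - y)"
  proof (rule integral_abs_bound_interval[OF i(2) y(2)])
    fix x assume x: "x \<in> {y<..<y'}"
    have "-B \<le> p t \<and> p t \<le> B" if "t \<in> {0<..<l}" for t using B[of t] that by auto
    then show "\<bar>decr_rearr l p x\<bar> \<le> B"
      using decr_rearr_bounds[OF p, of x "-B" B] x y by auto
  qed
  finally show ?thesis .
qed

section \<open>Second differences of the integrated rearrangement\<close>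

text \<open>Squaring makes the positive part C1, so a function of it can be differentiated across
  the level s.\<close>

lemma has_real_derivative_square_pos_part:
  fixes x :: real
  shows "((\<lambda>x. (max 0 x)\<^sup>2) has_real_derivative 2 * max 0 x) (at x)"
proof -
  consider "x < 0" | "x > 0" | "x = 0" by linarith
  then show ?thesis
  proof cases
    case 1
    have "((\<lambda>x. 0) has_real_derivative 2 * max 0 x) (at x)" using 1 by simp
    then show ?thesis
      by (rule has_field_derivative_transform_within_open[where S = "{..<0}"]) (use 1 in auto)
  next
    case 2
    have "((\<lambda>x. x\<^sup>2) has_real_derivative 2 * max 0 x) (at x)"
      using 2 by (auto intro!: derivative_eq_intros)
    then show ?thesis
      by (rule has_field_derivative_transform_within_open[where S = "{0<..}"]) (use 2 in auto)
  next
    case 3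
    have "((\<lambda>h. (max 0 h)\<^sup>2 / h) \<longlongrightarrow> 0) (at (0::real))"
    proof (rule Lim_null_comparison[where g = "\<lambda>h. \<bar>h\<bar>"])
      show "\<forall>\<^sub>F h in at 0. norm ((max 0 h)\<^sup>2 / h) \<le> \<bar>h::real\<bar>"
        by (rule always_eventually) (auto simp: max_def power2_eq_square)
      show "((\<lambda>h. \<bar>h\<bar>) \<longlongrightarrow> 0) (at (0::real))" by (intro tendsto_rabs_zero tendsto_ident_at)
    qed
    then show ?thesis unfolding 3 by (simp add: has_field_derivative_iff)
  qed
qed

text \<open>Approximating the step function by smooth increasing functions, the boundary terms survive
  and the remaining integrand is a nonnegative multiple of the squared first derivative.\<close>

lemma integral_strict_level_weight_second_derivative:
  fixes q q1 q2 :: "real \<Rightarrow> real"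
  assumes "a \<le> b" and c: "continuous_on {a..b} q" "continuous_on {a..b} q1"
    "continuous_on {a..b} q2"
    and d: "\<And>t. t \<in> {a<..<b} \<Longrightarrow> (q has_real_derivative q1 t) (at t)"
      "\<And>t. t \<in> {a<..<b} \<Longrightarrow> (q1 has_real_derivative q2 t) (at t)"
  shows "integral {a..b} (\<lambda>t. level_weight 0 s (q t) * q2 t) \<le>
    level_weight 0 s (q b) * q1 b - level_weight 0 s (q a) * q1 a"
proof -
  \<comment> \<open>It vanishes for x <= s and tends to 1 for x > s, so the limit is the strict
    step, \<beta> = 0.\<close>
  define \<Phi> where "\<Phi> = (\<lambda>n x. 1 - exp (- (real n * (max 0 (x - s))\<^sup>2)))"
  define \<Phi>' where "\<Phi>' = (\<lambda>n x. exp (- (real n * (max 0 (x - s))\<^sup>2)) * (real n * (2 * max 0 (x -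
    s))))"
  have \<Phi>_lim: "(\<lambda>n. \<Phi> n x) \<longlonglongrightarrow> level_weight 0 s x" for x
  proof (cases "s < x")
    case True
    have "(\<lambda>n. exp (- ((max 0 (x - s))\<^sup>2)) ^ n) \<longlonglongrightarrow> 0"
      using True by (intro LIMSEQ_power_zero) (simp add: abs_of_pos max_def)
    then have "(\<lambda>n. 1 - exp (- ((max 0 (x - s))\<^sup>2)) ^ n) \<longlonglongrightarrow> 1 - 0"
      by (rule tendsto_diff[OF tendsto_const])
    moreover have "exp (- ((max 0 (x - s))\<^sup>2)) ^ n = exp (- (real n * (max 0 (x - s))\<^sup>2))" for n
      by (simp add: exp_of_nat_mult[symmetric])
    ultimately show ?thesis using True by (simp add: \<Phi>_def level_weight_def)
  qed (simp add: \<Phi>_def level_weight_def)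
  have \<Phi>_cont: "continuous_on {a..b} (\<lambda>t. \<Phi> n (q t) * g t)" if "continuous_on {a..b} g" for n g
    unfolding \<Phi>_def by (intro continuous_intros c that)
  have \<Phi>_bd: "0 \<le> \<Phi> n x" "\<Phi> n x \<le> 1" for n x by (auto simp: \<Phi>_def)
  have le: "integral {a..b} (\<lambda>t. \<Phi> n (q t) * q2 t) \<le> \<Phi> n (q b) * q1 b - \<Phi> n (q a) * q1 a" for n
  proof -
    have "((\<lambda>t. \<Phi>' n (q t) * q1 t * q1 t + \<Phi> n (q t) * q2 t) has_integral
        (\<Phi> n (q b) * q1 b - \<Phi> n (q a) * q1 a)) {a..b}"
    proof (rule fundamental_theorem_of_calculus_interior[OF \<open>a \<le> b\<close>])
      show "continuous_on {a..b} (\<lambda>t. \<Phi> n (q t) * q1 t)" by (rule \<Phi>_cont[OF c(2)])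
      fix t assume t: "t \<in> {a<..<b}"
      have "((\<lambda>t. q t - s) has_real_derivative q1 t) (at t)"
        using d(1)[OF t] by (auto intro!: derivative_eq_intros)
      then have "((\<lambda>t. (max 0 (q t - s))\<^sup>2) has_real_derivative 2 * max 0 (q t - s) * q1 t) (at t)"
        by (rule DERIV_chain2[OF has_real_derivative_square_pos_part])
      from DERIV_diff[OF DERIV_const DERIV_fun_exp[OF DERIV_minus[OF DERIV_cmult[OF this, of
        "real n"]]], of 1]
      have "((\<lambda>t. \<Phi> n (q t)) has_real_derivative \<Phi>' n (q t) * q1 t) (at t)"
        unfolding \<Phi>_def \<Phi>'_def by (simp add: mult.assoc)
      then have "((\<lambda>t. \<Phi> n (q t) * q1 t) has_real_derivative \<Phi>' n (q t) * q1 t * q1 t + \<Phi> n (q t)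
        * q2 t) (at t)"
        using d(2)[OF t] by (auto intro!: derivative_eq_intros)
      then show "((\<lambda>t. \<Phi> n (q t) * q1 t) has_vector_derivative \<Phi>' n (q t) * q1 t * q1 t + \<Phi> n (q
        t) * q2 t) (at t)"
        by (simp add: has_real_derivative_iff_has_vector_derivative)
    qed
    then have "\<Phi> n (q b) * q1 b - \<Phi> n (q a) * q1 a =
        integral {a..b} (\<lambda>t. \<Phi>' n (q t) * q1 t * q1 t + \<Phi> n (q t) * q2 t)"
      "(\<lambda>t. \<Phi>' n (q t) * q1 t * q1 t + \<Phi> n (q t) * q2 t) integrable_on {a..b}"
      by (auto simp: integral_unique)
    moreover have "((\<lambda>t. \<Phi> n (q t) * q2 t) has_integral integral {a..b} (\<lambda>t. \<Phi> n (q t) * q2 t))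
      {a..b}"
      by (intro integrable_integral integrable_continuous_interval \<Phi>_cont c)
    moreover have "\<Phi> n (q t) * q2 t \<le> \<Phi>' n (q t) * q1 t * q1 t + \<Phi> n (q t) * q2 t" for t
      unfolding \<Phi>'_def by (simp add: mult.assoc)
    ultimately show ?thesis by (auto intro!: integral_le)
  qed
  have "(\<lambda>n. integral {a..b} (\<lambda>t. \<Phi> n (q t) * q2 t)) \<longlonglongrightarrow> integral {a..b} (\<lambda>t. level_weight 0 s (q t)
    * q2 t)"
  proof (rule dominated_convergence(2)[where h = "\<lambda>t. \<bar>q2 t\<bar>"])
    show "(\<lambda>t. \<Phi> k (q t) * q2 t) integrable_on {a..b}" for k
      by (intro integrable_continuous_interval \<Phi>_cont c)
    show "(\<lambda>t. \<bar>q2 t\<bar>) integrable_on {a..b}"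
      by (intro integrable_continuous_interval continuous_intros c)
    show "norm (\<Phi> k (q t) * q2 t) \<le> \<bar>q2 t\<bar>" for k t
      using \<Phi>_bd[of k "q t"] by (simp add: abs_mult mult_left_le_one_le)
    show "(\<lambda>k. \<Phi> k (q t) * q2 t) \<longlonglongrightarrow> level_weight 0 s (q t) * q2 t" for t
      by (intro tendsto_intros \<Phi>_lim)
  qed
  moreover have "(\<lambda>n. \<Phi> n (q b) * q1 b - \<Phi> n (q a) * q1 a) \<longlonglongrightarrow>
      level_weight 0 s (q b) * q1 b - level_weight 0 s (q a) * q1 a"
    by (intro tendsto_intros \<Phi>_lim)
  ultimately show ?thesis using le by (intro LIMSEQ_le) auto
qed

text \<open>The case \<beta> = 1 is the case \<beta> = 0 for - q and - s, since the indicator of q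
  >= s is 1 minus that of - q > - s, and the extra term q2 integrates to its boundary values. Every
  other \<beta> is a convex combination of these two on both sides of the inequality.\<close>

lemma integral_level_weight_second_derivative:
  fixes q q1 q2 :: "real \<Rightarrow> real"
  assumes "a \<le> b" and c: "continuous_on {a..b} q" "continuous_on {a..b} q1"
    "continuous_on {a..b} q2"
    and d: "\<And>t. t \<in> {a<..<b} \<Longrightarrow> (q has_real_derivative q1 t) (at t)"
      "\<And>t. t \<in> {a<..<b} \<Longrightarrow> (q1 has_real_derivative q2 t) (at t)"
    and \<beta>: "0 \<le> \<beta>" "\<beta> \<le> 1"
  shows "integral {a..b} (\<lambda>t. level_weight \<beta> s (q t) * q2 t) \<le>
    level_weight \<beta> s (q b) * q1 b - level_weight \<beta> s (q a) * q1 a"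
proof -
  let ?L = "\<lambda>\<beta> t. level_weight \<beta> s (q t)"
  note i = level_weight_mult_integrable[OF _ _ c(1) c(3)]
  have "integral {a..b} (\<lambda>t. ?L 0 t * q2 t) \<le> ?L 0 b * q1 b - ?L 0 a * q1 a" (is "?I0 \<le> ?R0")
    by (rule integral_strict_level_weight_second_derivative[OF assms(1-6)])
  have 0: "integral {a..b} (\<lambda>t. level_weight 0 (-s) (- q t) * (- q2 t)) \<le>
      level_weight 0 (-s) (- q b) * (- q1 b) - level_weight 0 (-s) (- q a) * (- q1 a)"
    by (rule integral_strict_level_weight_second_derivative[OF assms(1)])
      (use c d in \<open>auto intro!: continuous_intros derivative_eq_intros\<close>)
  have L1: "?L 1 t = 1 - level_weight 0 (- s) (- q t)" for t by (auto simp: level_weight_def)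
  have iq2: "(q2 has_integral (q1 b - q1 a)) {a..b}"
    using d(2) \<open>a \<le> b\<close> c(2) by (intro fundamental_theorem_of_calculus_interior)
      (auto simp: has_real_derivative_iff_has_vector_derivative)
  have "(\<lambda>t. level_weight 0 (-s) (- q t) * (- q2 t)) integrable_on {a..b}"
    using c by (intro level_weight_mult_integrable continuous_intros) auto
  then have "integral {a..b} (\<lambda>t. q2 t + level_weight 0 (-s) (- q t) * (- q2 t)) =
      q1 b - q1 a + integral {a..b} (\<lambda>t. level_weight 0 (-s) (- q t) * (- q2 t))"
    using iq2 by (subst hk_integral_add) (auto simp: integral_unique has_integral_integrable)
  then have "integral {a..b} (\<lambda>t. ?L 1 t * q2 t) \<le> ?L 1 b * q1 b - ?L 1 a * q1 a" (is "?I1 \<le> ?R1")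
    using 0 unfolding L1 by (simp add: algebra_simps)
  have "integral {a..b} (\<lambda>t. ?L \<beta> t * q2 t) = integral {a..b} (\<lambda>t. (1 - \<beta>) * (?L 0 t * q2 t) + \<beta> *
    (?L 1 t * q2 t))"
    by (intro integral_cong) (auto simp: level_weight_def algebra_simps)
  also have "\<dots> = (1 - \<beta>) * ?I0 + \<beta> * ?I1"
    using i[of 0 s] i[of 1 s] by (subst hk_integral_add) (auto intro!: integrable_on_mult_right)
  also have "\<dots> \<le> (1 - \<beta>) * ?R0 + \<beta> * ?R1"
    using \<beta> \<open>?I0 \<le> ?R0\<close> \<open>?I1 \<le> ?R1\<close> by (intro add_mono mult_left_mono) auto
  also have "\<dots> = ?L \<beta> b * q1 b - ?L \<beta> a * q1 a"
    by (auto simp: level_weight_def algebra_simps)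
  finally show ?thesis .
qed

text \<open>Cut out a small interval about b. On the two outer pieces the previous bound leaves
  boundary terms, and those at 0 and l vanish by \<open>neumann\<close>. If the slope at b is
  nonzero, the weight is 1 on one side of b and 0 on the other, so the surviving term tends to - |q1
  b|, while the middle piece is O(\<delta>). Other points of the level set, however many, are
  absorbed by the inequality.\<close>

lemma integral_level_weight_second_derivative_le_slope:
  fixes q q1 q2 :: "real \<Rightarrow> real"
  assumes c: "continuous_on {0..l} q" "continuous_on {0..l} q1" "continuous_on {0..l} q2"
    and d: "\<And>t. t \<in> {0<..<l} \<Longrightarrow> (q has_real_derivative q1 t) (at t)"
      "\<And>t. t \<in> {0<..<l} \<Longrightarrow> (q1 has_real_derivative q2 t) (at t)"
    and neumann: "q1 0 = 0" "q1 l = 0"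
    and \<beta>: "0 \<le> \<beta>" "\<beta> \<le> 1" and b: "b \<in> {0..l}" "q b = s"
  shows "integral {0..l} (\<lambda>t. level_weight \<beta> s (q t) * q2 t) \<le> - \<bar>q1 b\<bar>"
proof -
  define I where "I = (\<lambda>x y. integral {x..y} (\<lambda>t. level_weight \<beta> s (q t) * q2 t))"
  have le: "I x y \<le> level_weight \<beta> s (q y) * q1 y - level_weight \<beta> s (q x) * q1 x"
    if "0 \<le> x" "x \<le> y" "y \<le> l" for x y
    unfolding I_def using that c d
    by (intro integral_level_weight_second_derivative[OF _ _ _ _ _ _ \<beta>])
      (auto elim!: continuous_on_subset)
  show ?thesis
  proof (cases "q1 b = 0")
    case True
    then show ?thesis using le[of 0 l] neumann b by (simp add: I_def)
  next
    case False
    \<comment> \<open>At an endpoint the slope would vanish by \<open>neumann\<close>.\<close>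
    then have b0: "0 < b" "b < l" using b neumann by (auto simp: less_le)
    then have db: "(q has_real_derivative q1 b) (at b)" using d by auto
    obtain C where C: "\<And>y. y \<in> {0..l} \<Longrightarrow> \<bar>q2 y\<bar> \<le> C"
      using compact_continuous_abs_bound[OF compact_Icc c(3)] by blast
    have int: "(\<lambda>t. level_weight \<beta> s (q t) * q2 t) integrable_on {x..y}" if "0 \<le> x" "y \<le> l" for x y
      using that c \<beta> by (intro level_weight_mult_integrable) (auto elim!: continuous_on_subset)
    have main: "I 0 l \<le> level_weight \<beta> s (q (b - \<delta>)) * q1 (b - \<delta>)
        - level_weight \<beta> s (q (b + \<delta>)) * q1 (b + \<delta>) + C * (2 * \<delta>)"
      if \<delta>: "0 < \<delta>" "\<delta> < min b (l - b)" for \<delta>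
    proof -
      have "I 0 l = I 0 (b - \<delta>) + (I (b - \<delta>) (b + \<delta>) + I (b + \<delta>) l)"
        unfolding I_def using \<delta> b0
        by (simp add: hk_integral_combine int)
      moreover have "I (b - \<delta>) (b + \<delta>) \<le> C * (2 * \<delta>)"
      proof -
        have "I (b - \<delta>) (b + \<delta>) \<le> integral {b - \<delta>..b + \<delta>} (\<lambda>t. C)"
          unfolding I_def
        proof (intro integral_le int)
          fix t assume "t \<in> {b - \<delta>..b + \<delta>}"
          then have "\<bar>q2 t\<bar> \<le> C" using \<delta> b0 by (intro C) auto
          moreover have "\<bar>level_weight \<beta> s (q t) * q2 t\<bar> \<le> \<bar>q2 t\<bar>"
            using level_weight_bounds[OF \<beta>, of s "q t"] by (simp add: abs_mult mult_left_le_one_le)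
          ultimately show "level_weight \<beta> s (q t) * q2 t \<le> C" by linarith
        qed (use \<delta> b0 in auto)
        then show ?thesis using \<delta> by (simp add: algebra_simps)
      qed
      ultimately show ?thesis
        using le[of 0 "b - \<delta>"] le[of "b + \<delta>" l] \<delta> b0 neumann by simp
    qed
    have small: "\<forall>\<^sub>F \<delta> in at_right 0. 0 < \<delta> \<and> \<delta> < min b (l - b)"
      using eventually_at_right_real[of 0 "min b (l - b)"] b0 by simp
    have cont1: "isCont q1 b" using d(2)[of b] b0 by (auto intro: DERIV_isCont)
    \<comment> \<open>A nonzero slope makes q cross s at b, so close to b the weight takes only its
      values off the level set and \<beta> disappears.\<close>
    have sides: "\<forall>\<^sub>F \<delta> in at_right 0. level_weight \<beta> s (q (b - \<delta>)) = (if q1 b < 0 then 1 else 0) \<and>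
        level_weight \<beta> s (q (b + \<delta>)) = (if q1 b < 0 then 0 else 1)"
    proof -
      obtain e1 e2 where e: "e1 > 0" "e2 > 0"
        "\<And>h. 0 < h \<Longrightarrow> h < e1 \<Longrightarrow> if q1 b < 0 then q b < q (b - h) else q (b - h) < q b"
        "\<And>h. 0 < h \<Longrightarrow> h < e2 \<Longrightarrow> if q1 b < 0 then q (b + h) < q b else q b < q (b + h)"
        using DERIV_neg_dec_left[OF db] DERIV_neg_dec_right[OF db]
          DERIV_pos_inc_left[OF db] DERIV_pos_inc_right[OF db] False
        by (cases "q1 b < 0") (auto simp: not_less le_less)
      have "\<forall>\<^sub>F \<delta> in at_right 0. \<delta> \<in> {0<..<min e1 e2}"
        using e by (intro eventually_at_right_real) auto
      then show ?thesis
      proof eventually_elim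
        case (elim \<delta>)
        then show ?case using e(3)[of \<delta>] e(4)[of \<delta>] b(2)
          by (auto simp: level_weight_def split: if_splits)
      qed
    qed
    define R where "R = (\<lambda>\<delta>. (if q1 b < 0 then q1 (b - \<delta>) else - q1 (b + \<delta>)) + C * (2 * \<delta>))"
    have "((\<lambda>\<delta>. b - \<delta>) \<longlongrightarrow> b - 0) (at_right 0)" "((\<lambda>\<delta>. b + \<delta>) \<longlongrightarrow> b + 0) (at_right 0)"
      by (intro tendsto_intros)+
    then have "((\<lambda>\<delta>. q1 (b - \<delta>)) \<longlongrightarrow> q1 b) (at_right 0)" "((\<lambda>\<delta>. q1 (b + \<delta>)) \<longlongrightarrow> q1 b) (at_right 0)"
      using isCont_tendsto_compose[OF cont1] by auto
    then have "(R \<longlongrightarrow> (if q1 b < 0 then q1 b else - q1 b) + C * (2 * 0)) (at_right 0)"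
      unfolding R_def by (cases "q1 b < 0") (auto intro!: tendsto_eq_intros)
    moreover have "\<forall>\<^sub>F \<delta> in at_right 0. I 0 l \<le> R \<delta>"
      using small sides
    proof eventually_elim
      case (elim \<delta>)
      then show ?case using main[of \<delta>] by (auto simp: R_def split: if_splits)
    qed
    ultimately have "I 0 l \<le> (if q1 b < 0 then q1 b else - q1 b) + C * (2 * 0)"
      by (intro tendsto_lowerbound) auto
    then have "I 0 l \<le> - \<bar>q1 b\<bar>" by (simp split: if_splits)
    then show ?thesis by (simp add: I_def)
  qed
qed

section \<open>Growth of the superlevel sets as the level drops\<close>

lemma crossing_interval:
  fixes q :: "real \<Rightarrow> real"
  assumes "b < d" and c: "continuous_on {b..d} q" and q: "q b = s" "q d \<le> s'" "s' < s"
  obtains x y where "b \<le> x" "x < y" "y \<le> d" "q x = s" "q y = s'"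
    "\<And>t. x < t \<Longrightarrow> t < y \<Longrightarrow> s' < q t \<and> q t < s"
proof -
  have sub: "continuous_on {x..y} q" if "b \<le> x" "y \<le> d" for x y
    using that by (intro continuous_on_subset[OF c]) auto
  have lev: "compact {t\<in>{x..y}. q t = k}" if "b \<le> x" "y \<le> d" for x y k
  proof -
    have "closed {t\<in>{x..y}. q t = k}"
      using continuous_closed_preimage_constant[OF sub[OF that], of k]
        by (simp add: vimage_def Int_def)
    then show ?thesis by (metis (no_types, lifting) bounded_closed_interval bounded_subset
      compact_eq_bounded_closed mem_Collect_eq subsetI)
  qed
  \<comment> \<open>x is the last point at level s, and y the first later point at level s'. Between
    them q stays strictly between the levels, so this interval is counted by q > s' but not by q >=
    s.\<close>
  define C where "C = {t\<in>{b..d}. q t = s}"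
  have "b \<in> C" using assms by (simp add: C_def)
  then obtain x where "x \<in> C" "\<forall>t\<in>C. t \<le> x"
    using compact_attains_sup[of C] lev[of b d s] unfolding C_def[symmetric] by blast
  then have x: "x \<in> {b..d}" "q x = s" "\<And>t. t \<in> {b..d} \<Longrightarrow> q t = s \<Longrightarrow> t \<le> x"
    by (simp_all add: C_def)
  define C' where "C' = {t\<in>{x..d}. q t = s'}"
  have "\<exists>t\<ge>x. t \<le> d \<and> q t = s'" using x q by (intro IVT2' sub) auto
  then have "C' \<noteq> {}" by (auto simp: C'_def)
  moreover have "compact C'" unfolding C'_def using x(1) by (intro lev) auto
  ultimately obtain y where yC: "y \<in> C'" "\<forall>t\<in>C'. y \<le> t"
    using compact_attains_inf[of C'] by blast
  have y: "y \<in> {x..d}" "q y = s'" using yC(1) by (auto simp: C'_def)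
  have ymin: "y \<le> t" if "t \<in> {x..d}" "q t = s'" for t
    using bspec[OF yC(2), of t] that by (simp add: C'_def)
  show ?thesis
  proof
    show "b \<le> x" "q x = s" "y \<le> d" "q y = s'" using x(1,2) y(1,2) by auto
    show "x < y" using x(1,2) y(1,2) q by (cases "x = y") auto
    fix t assume t: "x < t" "t < y"
    have "q t < s"
    proof (rule ccontr)
      assume "\<not> q t < s"
      then have "\<exists>z\<ge>t. z \<le> d \<and> q z = s" using q x(1,2) y(1,2) t by (intro IVT2' sub) auto
      then obtain z where "t \<le> z" "z \<le> d" "q z = s" by blast
      then show False using x(1) x(3)[of z] t by simp
    qed
    moreover have "s' < q t"
    proof (rule ccontr)
      assume "\<not> s' < q t"
      then have "\<exists>z\<ge>x. z \<le> t \<and> q z = s'" using q x(1,2) y(1,2) t by (intro IVT2' sub) auto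
      then obtain z where "x \<le> z" "z \<le> t" "q z = s'" by blast
      then show False using y(1) ymin[of z] t by simp
    qed
    ultimately show "s' < q t \<and> q t < s" by simp
  qed
qed

lemma crossing_interval':
  fixes q :: "real \<Rightarrow> real"
  assumes b: "b \<in> {0..l}" and d: "d \<in> {0..l}" and c: "continuous_on {0..l} q"
    and q: "q b = s" "q d \<le> s'" "s' < s"
  obtains x y where "0 \<le> x" "x < y" "y \<le> l" "\<bar>q x - q y\<bar> = s - s'"
    "\<And>t. x < t \<Longrightarrow> t < y \<Longrightarrow> s' < q t \<and> q t < s"
proof -
  have "b \<noteq> d" using q by auto
  then consider "b < d" | "d < b" by linarith
  then show ?thesis
  proof cases
    case 1
    have "continuous_on {b..d} q" using b d by (intro continuous_on_subset[OF c]) auto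
    from crossing_interval[OF 1 this q] obtain x y where "b \<le> x" "x < y" "y \<le> d" "q x = s" "q y
      = s'"
      "\<And>t. x < t \<Longrightarrow> t < y \<Longrightarrow> s' < q t \<and> q t < s" by metis
    then show ?thesis using b d q by (intro that[of x y]) auto
  next
    case 2
    have "continuous_on {-b..-d} (\<lambda>t. q (- t))" using b d
      by (intro continuous_on_compose2[OF c] continuous_intros) auto
    from crossing_interval[OF _ this, of s s'] 2 q obtain x y where "-b \<le> x" "x < y" "y \<le> -d"
      "q (-x) = s" "q (-y) = s'" "\<And>t. x < t \<Longrightarrow> t < y \<Longrightarrow> s' < q (-t) \<and> q (-t) < s"
      by auto
    moreover have "s' < q t \<and> q t < s" if "-y < t" "t < -x" for t
      using calculation(6)[of "-t"] that by simp
    ultimately show ?thesis using b d q by (intro that[of "-y" "-x"]) auto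
  qed
qed

text \<open>When the level drops by (m + \<epsilon>) r, either all values in the open interval lie
  above the new level, or some crossing interval joins s to it. There the slope is at most m +
  \<epsilon>/2, so by the mean value theorem the interval is longer than r, and it is disjoint from
  q >= s. One such interval already gives the required gain.\<close>

lemma superlevel_measure_growth:
  fixes q q1 :: "real \<Rightarrow> real"
  assumes c: "continuous_on {0..l} q" "continuous_on {0..l} q1"
    and d: "\<And>t. t \<in> {0<..<l} \<Longrightarrow> (q has_real_derivative q1 t) (at t)"
    and m: "0 \<le> m" "\<And>b. b \<in> {0..l} \<Longrightarrow> q b = s \<Longrightarrow> \<bar>q1 b\<bar> \<le> m"
    and b: "b \<in> {0..l}" "q b = s" and "\<epsilon> > 0" "y < l"
    and y: "y \<le> integral {0..l} (\<lambda>t. level_weight 1 s (q t))" and "l > 0"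
  shows "\<forall>\<^sub>F r in at_right 0. y + r < superlevel_measure l q (s - (m + \<epsilon>) * r)"
proof -
  \<comment> \<open>Points at or below level s where the slope is too steep. The hypothesis on the
    level set forbids them at level s itself, so this compact set stays below s by a definite gap
    \<eta>, and the slope bound persists in the band from s - \<eta> to s.\<close>
  define K where "K = {t\<in>{0..l}. m + \<epsilon> / 2 \<le> \<bar>q1 t\<bar>} \<inter> {t\<in>{0..l}. q t \<le> s}"
  have "closed {t\<in>{0..l}. m + \<epsilon> / 2 \<le> \<bar>q1 t\<bar>}" "closed {t\<in>{0..l}. q t \<le> s}"
    by (intro continuous_on_closed_Collect_le continuous_intros c closed_atLeastAtMost)+
  then have "closed K" unfolding K_def by (rule closed_Int)
  moreover have "bounded K" by (rule bounded_subset[of "{0..l}"]) (auto simp: K_def)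
  ultimately have "compact K" by (simp add: compact_eq_bounded_closed)
  have "\<exists>\<eta>>0. \<forall>t\<in>K. q t \<le> s - \<eta>"
  proof (cases "K = {}")
    case False
    moreover have "continuous_on K q" by (rule continuous_on_subset[OF c(1)]) (auto simp: K_def)
    ultimately obtain t where t: "t \<in> K" "\<And>t'. t' \<in> K \<Longrightarrow> q t' \<le> q t"
      using continuous_attains_sup[OF \<open>compact K\<close>] by blast
    have "q t \<noteq> s" using t(1) m(2)[of t] \<open>\<epsilon> > 0\<close> by (auto simp: K_def)
    then show ?thesis using t by (intro exI[of _ "s - q t"]) (auto simp: K_def)
  qed (auto intro: exI[of _ 1])
  then obtain \<eta> where "\<eta> > 0" and \<eta>: "\<And>t. t \<in> K \<Longrightarrow> q t \<le> s - \<eta>" by blast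
  have slope: "\<bar>q1 t\<bar> \<le> m + \<epsilon> / 2" if "t \<in> {0..l}" "s - \<eta> < q t" "q t \<le> s" for t
    using that \<eta>[of t] by (force simp: K_def)
  \<comment> \<open>The first entry keeps the new level inside that band; the second settles the
    case without a crossing, where the superlevel set has full measure l > y + r.\<close>
  have "\<forall>\<^sub>F r in at_right 0. r \<in> {0<..<min (\<eta> / (m + \<epsilon>)) (l - y)}"
    using \<open>\<eta> > 0\<close> \<open>\<epsilon> > 0\<close> m(1) \<open>y < l\<close> by (intro eventually_at_right_real) auto
  then show ?thesis
  proof eventually_elim
    case (elim r)
    define s' where "s' = s - (m + \<epsilon>) * r"
    have "0 < r" "r < l - y" using elim by auto
    have "(m + \<epsilon>) * r < \<eta>" using elim \<open>\<epsilon> > 0\<close> m(1) by (simp add: pos_less_divide_eq mult.commute)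
    have "s' < s" using \<open>0 < r\<close> \<open>\<epsilon> > 0\<close> m(1) by (simp add: s'_def)
    show ?case
    proof (cases "\<exists>d\<in>{0<..<l}. q d \<le> s'")
      case False
      then have "superlevel_measure l q s' = l"
        using \<open>l > 0\<close> by (intro superlevel_measure_below) force+
      then show ?thesis using \<open>r < l - y\<close> by (simp add: s'_def)
    next
      case True
      then obtain e where "e \<in> {0<..<l}" "q e \<le> s'" by blast
      then have "e \<in> {0..l}" by simp
      from crossing_interval'[OF b(1) this c(1) b(2) \<open>q e \<le> s'\<close> \<open>s' < s\<close>]
      obtain x z where xz: "0 \<le> x" "x < z" "z \<le> l" "\<bar>q x - q z\<bar> = s - s'"
        and bt: "\<And>t. x < t \<Longrightarrow> t < z \<Longrightarrow> s' < q t \<and> q t < s" by metis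
      obtain \<xi> where \<xi>: "x < \<xi>" "\<xi> < z" "q z - q x = q1 \<xi> * (z - x)"
      proof (rule mvt[OF \<open>x < z\<close>, of q "\<lambda>t h. q1 t * h"])
        show "continuous_on {x..z} q" using xz by (intro continuous_on_subset[OF c(1)]) auto
        show "(q has_derivative (\<lambda>h. q1 t * h)) (at t)" if "x < t" "t < z" for t
          using d[of t] that xz by (simp add: has_field_derivative_def)
      qed (use that in auto)
      have "\<bar>q1 \<xi>\<bar> \<le> m + \<epsilon> / 2"
        using bt[OF \<xi>(1,2)] xz \<xi> \<open>(m + \<epsilon>) * r < \<eta>\<close> by (intro slope) (auto simp: s'_def)
      then have "\<bar>q1 \<xi>\<bar> * (z - x) \<le> (m + \<epsilon> / 2) * (z - x)" using xz by (intro mult_right_mono) auto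
      moreover have "(m + \<epsilon>) * r = \<bar>q z - q x\<bar>" using xz(4) by (simp add: s'_def abs_minus_commute)
      then have "(m + \<epsilon>) * r = \<bar>q1 \<xi>\<bar> * (z - x)" unfolding \<xi>(3) using xz(2) by (simp add: abs_mult)
      ultimately have "(m + \<epsilon>) * r \<le> (m + \<epsilon> / 2) * (z - x)" by simp
      moreover have "(m + \<epsilon> / 2) * r < (m + \<epsilon>) * r" using \<open>0 < r\<close> \<open>\<epsilon> > 0\<close> by simp
      ultimately have "(m + \<epsilon> / 2) * r < (m + \<epsilon> / 2) * (z - x)" by linarith
      then have "r < z - x" using \<open>\<epsilon> > 0\<close> m(1) by (simp add: mult_less_cancel_left)
      have i1: "(\<lambda>t. level_weight 1 s (q t)) integrable_on {0..l}"
        using level_weight_mult_integrable[of 1 0 l q "\<lambda>t. 1"] c by simp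
      have i0: "(\<lambda>t. level_weight 0 s' (q t)) integrable_on {0..l}"
        using level_weight_mult_integrable[of 0 0 l q "\<lambda>t. 1"] c by simp
      have "{x<..<z} \<inter> {0..l} = {x<..<z}" using xz by auto
      then have "indicat_real {x<..<z} integrable_on {0..l}"
        "integral {0..l} (indicat_real {x<..<z}) = z - x"
        using xz by (simp_all add: integrable_on_indicator integral_indicator)
      then have ind: "(indicat_real {x<..<z} has_integral (z - x)) {0..l}"
        using has_integral_integrable_integral by blast
      have "integral {0..l} (\<lambda>t. level_weight 1 s (q t)) + (z - x)
          = integral {0..l} (\<lambda>t. level_weight 1 s (q t) + indicator {x<..<z} t)"
        using i1 ind by (subst hk_integral_add) (auto simp: integral_unique has_integral_integrable)
      also have "\<dots> \<le> integral {0..l} (\<lambda>t. level_weight 0 s' (q t))"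
      proof (intro integral_le i0 integrable_add i1)
        show "(indicator {x<..<z} :: real \<Rightarrow> real) integrable_on {0..l}" using ind by blast
        show "level_weight 1 s (q t) + indicator {x<..<z} t \<le> level_weight 0 s' (q t)" for t
          using bt[of t] \<open>s' < s\<close> by (auto simp: level_weight_def indicator_def)
      qed
      also have "\<dots> = superlevel_measure l q s'" by (rule integral_level_weight_0[OF c(1)])
      finally show ?thesis using \<open>r < z - x\<close> y by (simp add: s'_def)
    qed
  qed
qed

lemma integral_affine:
  fixes a k :: real assumes "0 \<le> t"
  shows "((\<lambda>r. a + k * (r - y)) has_integral (a * t + k * t\<^sup>2 / 2)) {y..y + t}"
    "((\<lambda>r. a + k * (y - r)) has_integral (a * t + k * t\<^sup>2 / 2)) {y - t..y}"
proof -
  have "((\<lambda>r. a + k * (r - y)) has_integral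
      ((a * (y + t - y) + k * (y + t - y)\<^sup>2 / 2) - (a * (y - y) + k * (y - y)\<^sup>2 / 2))) {y..y + t}"
    using assms by (intro fundamental_theorem_of_calculus)
      (auto intro!: derivative_eq_intros simp: has_real_derivative_iff_has_vector_derivative[symmetric])
  then show "((\<lambda>r. a + k * (r - y)) has_integral (a * t + k * t\<^sup>2 / 2)) {y..y + t}" by simp
  have "((\<lambda>r. a + k * (y - r)) has_integral
      ((- a * (y - y) - k * (y - y)\<^sup>2 / 2) - (- a * (y - (y - t)) - k * (y - (y - t))\<^sup>2 / 2))) {y
        - t..y}"
    using assms by (intro fundamental_theorem_of_calculus)
      (auto intro!: derivative_eq_intros
        simp: has_real_derivative_iff_has_vector_derivative[symmetric] field_simps)
  then show "((\<lambda>r. a + k * (y - r)) has_integral (a * t + k * t\<^sup>2 / 2)) {y - t..y}"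
    by (simp add: add.commute)
qed

text \<open>The second difference of F is the integral of the rearrangement over (y, y + t) minus
  that over (y - t, y). The growth estimate for q bounds the first integrand from below by s - (m +
  \<epsilon>) r at distance r from y; the estimate for - q, taken at l - y, bounds the second from
  above by s + (m + \<epsilon>) r. Here m, minus the weighted integral of q2, dominates every slope
  on the level set.\<close>

lemma rearr_integral_second_difference:
  fixes q q1 q2 :: "real \<Rightarrow> real"
  assumes c: "continuous_on {0..l} q" "continuous_on {0..l} q1" "continuous_on {0..l} q2"
    and d: "\<And>t. t \<in> {0<..<l} \<Longrightarrow> (q has_real_derivative q1 t) (at t)"
      "\<And>t. t \<in> {0<..<l} \<Longrightarrow> (q1 has_real_derivative q2 t) (at t)"
    and neumann: "q1 0 = 0" "q1 l = 0"
    and \<beta>: "0 \<le> \<beta>" "\<beta> \<le> 1" and y: "0 < y" "y < l" and \<epsilon>: "\<epsilon> > 0"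
  defines "s \<equiv> decr_rearr l q y" and "F \<equiv> \<lambda>y. integral {0..y} (decr_rearr l q)"
  shows "\<forall>\<^sub>F t in at_right 0.
    (integral {0..l} (\<lambda>t. level_weight \<beta> s (q t) * q2 t) - \<epsilon>) * t\<^sup>2
      \<le> F (y + t) + F (y - t) - 2 * F y"
proof -
  have l: "l > 0" using y by simp
  define m where "m = - integral {0..l} (\<lambda>t. level_weight \<beta> s (q t) * q2 t)"
  have slope: "\<bar>q1 b\<bar> \<le> m" if "b \<in> {0..l}" "q b = s" for b
    using integral_level_weight_second_derivative_le_slope[OF c d neumann \<beta> that]
      by (simp add: m_def)
  note lev = decr_rearr_level_bounds[OF c(1) y, folded s_def]
  have int: "(\<lambda>t. level_weight \<beta>' s' (q t)) integrable_on {0..l}" if "0 \<le> \<beta>'" "\<beta>' \<le> 1" for \<beta>' s'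
    using level_weight_mult_integrable[of \<beta>' 0 l q "\<lambda>t. 1"] c that by simp
  \<comment> \<open>The growth estimate starts from an actual point at level s. If q stayed strictly
    below or strictly above s, one of the enclosing masses would be 0 or l, contrary to 0 < y <
    l.\<close>
  have hi: "\<exists>t\<in>{0..l}. s \<le> q t"
  proof (rule ccontr)
    assume "\<not> ?thesis"
    then have "integral {0..l} (\<lambda>t. level_weight 1 s (q t)) = integral {0..l} (\<lambda>t. 0)"
      by (intro integral_cong) (force simp: level_weight_def)
    then show False using lev y by simp
  qed
  have lo: "\<exists>t\<in>{0..l}. q t \<le> s"
  proof (rule ccontr)
    assume "\<not> ?thesis"
    then have "integral {0..l} (\<lambda>t. level_weight 0 s (q t)) = integral {0..l} (\<lambda>t. 1)"
      by (intro integral_cong) (force simp: level_weight_def)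
    then show False using lev y by simp
  qed
  have conn: "connected (q ` {0..l})" by (intro connected_continuous_image c) auto
  from hi lo obtain t1 t2 where "t1 \<in> {0..l}" "q t1 \<le> s" "t2 \<in> {0..l}" "s \<le> q t2" by blast
  then have "s \<in> q ` {0..l}" using connectedD_interval[OF conn, of "q t1" "q t2" s] by blast
  then obtain b where b: "b \<in> {0..l}" "q b = s" by blast
  have "0 \<le> m" using slope[OF b] by linarith
  have up: "\<forall>\<^sub>F r in at_right 0. y + r < superlevel_measure l q (s - (m + \<epsilon>) * r)"
    by (rule superlevel_measure_growth[OF c(1,2) d(1) \<open>0 \<le> m\<close> slope b \<epsilon> y(2) lev(2) l])
  have flip: "level_weight 1 (- s') (- x) = 1 - level_weight 0 s' x" for s' x
    by (auto simp: level_weight_def)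
  have "integral {0..l} (\<lambda>t. level_weight 1 (- s) (- q t))
    = l - integral {0..l} (\<lambda>t. level_weight 0 s (q t))"
    unfolding flip using int[of 0 s] l by (subst hk_integral_diff) auto
  then have lev': "l - y \<le> integral {0..l} (\<lambda>t. level_weight 1 (- s) (- q t))" using lev(1)
    by linarith
  have low: "\<forall>\<^sub>F r in at_right 0. (l - y) + r < superlevel_measure l (\<lambda>t. - q t) (- s - (m + \<epsilon>) *
    r)"
  proof (rule superlevel_measure_growth[OF _ _ _ \<open>0 \<le> m\<close> _ b(1) _ \<epsilon> _ lev' l])
    show "continuous_on {0..l} (\<lambda>t. - q t)" "continuous_on {0..l} (\<lambda>t. - q1 t)"
      by (intro continuous_intros c)+
    show "((\<lambda>t. - q t) has_real_derivative - q1 t) (at t)" if "t \<in> {0<..<l}" for t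
      by (rule DERIV_minus[OF d(1)[OF that]])
    show "\<bar>- q1 b\<bar> \<le> m" if "b \<in> {0..l}" "- q b = - s" for b using slope[of b] that by simp
  qed (use b y in auto)
  \<comment> \<open>Only an inequality, because the level set q = s' belongs to neither superlevel
    set.\<close>
  have compl: "superlevel_measure l (\<lambda>t. - q t) (- s') \<le> l - superlevel_measure l q s'" for s'
  proof -
    have "integral {0..l} (\<lambda>t. level_weight 0 (- s') (- q t))
      \<le> integral {0..l} (\<lambda>t. 1 - level_weight 0 s' (q t))"
      using level_weight_mult_integrable[of 0 0 l "\<lambda>t. - q t" "\<lambda>t. 1" "- s'"] c int[of 0 s']
      by (intro integral_le integrable_diff) (auto simp: level_weight_def intro!: continuous_intros)
    also have "\<dots> = l - integral {0..l} (\<lambda>t. level_weight 0 s' (q t))"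
      using int[of 0 s'] l by (subst hk_integral_diff) auto
    finally show ?thesis
      using integral_level_weight_0[OF c(1)] integral_level_weight_0[of l "\<lambda>t. - q t"] c(1)
      by (simp add: continuous_on_minus)
  qed
  obtain \<delta> where "\<delta> > 0" and \<delta>: "\<And>r. 0 < r \<Longrightarrow> r < \<delta> \<Longrightarrow>
      y + r < superlevel_measure l q (s - (m + \<epsilon>) * r) \<and>
      (l - y) + r < superlevel_measure l (\<lambda>t. - q t) (- s - (m + \<epsilon>) * r)"
    using eventually_conj[OF up low] unfolding eventually_at_right_field by auto
  have "\<forall>\<^sub>F t in at_right 0. t \<in> {0<..<min \<delta> (min y (l - y))}"
    using \<open>\<delta> > 0\<close> y by (intro eventually_at_right_real) auto
  then show ?thesis
  proof eventually_elim
    case (elim t)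
    then have t: "0 < t" "t < \<delta>" "t < y" "t < l - y" by auto
    have gt: "s + (- (m + \<epsilon>)) * (r - y) \<le> decr_rearr l q r" if "r \<in> {y..y + t}" for r
    proof (cases "r = y")
      case False
      then have "0 < r - y" "r - y < \<delta>" using that t by auto
      from \<delta>[OF this] have "r < superlevel_measure l q (s - (m + \<epsilon>) * (r - y))" by simp
      then have "s - (m + \<epsilon>) * (r - y) < decr_rearr l q r"
        using less_decr_rearr_iff[OF c(1), of r] that t y by simp
      then show ?thesis by (simp add: algebra_simps)
    qed (simp add: s_def)
    have lt: "decr_rearr l q r \<le> s + (m + \<epsilon>) * (y - r)" if "r \<in> {y - t..y}" for r
    proof (cases "r = y")
      case False
      then have "0 < y - r" "y - r < \<delta>" using that t by auto
      from \<delta>[OF this] have "(l - y) + (y - r) < superlevel_measure l (\<lambda>t. - q t) (- (s + (m + \<epsilon>) *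
        (y - r)))"
        unfolding minus_add_distrib diff_conv_add_uminus by blast
      then have nl: "\<not> r < superlevel_measure l q (s + (m + \<epsilon>) * (y - r))"
        using compl[of "s + (m + \<epsilon>) * (y - r)"] by linarith
      have "0 < r" "r < l" using that t y by auto
      from less_decr_rearr_iff[OF c(1) this] nl show ?thesis by (metis not_less)
    qed (simp add: s_def)
    have i: "decr_rearr l q integrable_on {x..z}" if "0 \<le> x" "z \<le> l" for x z
      using decr_rearr_integrable[OF c(1) l that] .
    have "F (y + t) = F y + integral {y..y + t} (decr_rearr l q)"
      unfolding F_def using t y by (subst hk_integral_combine) (auto intro!: i)
    moreover have "F y = F (y - t) + integral {y - t..y} (decr_rearr l q)"
      unfolding F_def using t y by (subst hk_integral_combine) (auto intro!: i)
    moreover have ge: "s * t + (- (m + \<epsilon>)) * t\<^sup>2 / 2 \<le> integral {y..y + t} (decr_rearr l q)"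
      by (rule has_integral_le[OF integral_affine(1)[of t s
        "- (m + \<epsilon>)" y] integrable_integral[OF i] gt]) (use t y in auto)
    moreover have "integral {y - t..y} (decr_rearr l q) \<le> s * t + (m + \<epsilon>) * t\<^sup>2 / 2"
      by (rule has_integral_le[OF integrable_integral[OF i] integral_affine(2)[of t s
        "m + \<epsilon>" y] lt]) (use t y in auto)
    ultimately have "- ((m + \<epsilon>) * t\<^sup>2) \<le> F (y + t) + F (y - t) - 2 * F y" by (simp add: field_simps)
    then show ?case by (simp add: m_def algebra_simps)
  qed
qed

section \<open>Functions on a cylinder\<close>

lemma second_difference_estimate:
  fixes \<phi> \<phi>1 \<phi>2 :: "real \<Rightarrow> real"
  assumes t: "0 < t"
    and d: "\<And>s. \<bar>s\<bar> \<le> t \<Longrightarrow> (\<phi> has_real_derivative \<phi>1 s) (at s)"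
      "\<And>s. \<bar>s\<bar> \<le> t \<Longrightarrow> (\<phi>1 has_real_derivative \<phi>2 s) (at s)"
    and e: "\<And>s. \<bar>s\<bar> \<le> t \<Longrightarrow> \<bar>\<phi>2 s - a\<bar> \<le> \<epsilon>"
  shows "\<bar>\<phi> t + \<phi> (- t) - 2 * \<phi> 0 - t\<^sup>2 * a\<bar> \<le> \<epsilon> * t\<^sup>2"
proof -
  define diff where "diff = (\<lambda>m::nat. if m = 0 then \<phi> else if m = 1 then \<phi>1 else \<phi>2)"
  have D: "\<forall>m s. m < 2 \<and> - t \<le> s \<and> s \<le> t \<longrightarrow> (diff m has_real_derivative diff (Suc m) s) (at s)"
    using d by (auto simp: diff_def less_2_cases_iff abs_le_iff)
  have tay: "\<exists>\<xi>. \<bar>\<xi>\<bar> \<le> t \<and> \<phi> x = \<phi> 0 + \<phi>1 0 * x + \<phi>2 \<xi> / 2 * x\<^sup>2" if x: "x = t \<or> x = - t" for x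
  proof -
    obtain \<xi> where "if x < 0 then x < \<xi> \<and> \<xi> < 0 else 0 < \<xi> \<and> \<xi> < x"
      "\<phi> x = (\<Sum>m<2. (diff m 0 / fact m) * (x - 0)^m) + (diff 2 \<xi> / fact 2) * (x - 0)^2"
      using Taylor[of 2 diff \<phi> "- t" t 0 x] D t x by (auto simp: diff_def)
    then show ?thesis using x t by (intro exI[of _ \<xi>])
      (auto simp: diff_def numeral_2_eq_2 split: if_splits)
  qed
  obtain \<xi>1 \<xi>2 where x1: "\<bar>\<xi>1\<bar> \<le> t" "\<phi> t = \<phi> 0 + \<phi>1 0 * t + \<phi>2 \<xi>1 / 2 * t\<^sup>2"
    and x2: "\<bar>\<xi>2\<bar> \<le> t" "\<phi> (- t) = \<phi> 0 + \<phi>1 0 * (- t) + \<phi>2 \<xi>2 / 2 * (- t)\<^sup>2"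
    using tay[of t] tay[of "- t"] by blast
  have "\<phi> t + \<phi> (- t) - 2 * \<phi> 0 - t\<^sup>2 * a = ((\<phi>2 \<xi>1 - a) / 2 + (\<phi>2 \<xi>2 - a) / 2) * t\<^sup>2"
    unfolding x1(2) x2(2) by (simp add: field_simps)
  also have "\<bar>\<dots>\<bar> \<le> \<epsilon> * t\<^sup>2"
  proof -
    have "\<bar>(\<phi>2 \<xi>1 - a) / 2 + (\<phi>2 \<xi>2 - a) / 2\<bar> \<le> \<epsilon>"
      using e[OF x1(1)] e[OF x2(1)] by (simp add: abs_le_iff field_simps)
    then show ?thesis unfolding abs_mult by (intro mult_mono) auto
  qed
  finally show ?thesis .
qed

lemma sum_Basis_prod:
  fixes f :: "'a::euclidean_space \<times> real \<Rightarrow> 'b::comm_monoid_add"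
  shows "(\<Sum>b\<in>Basis. f b) = (\<Sum>e\<in>Basis. f (e, 0)) + f (0, 1)"
proof -
  have "sum f Basis = sum f ((\<lambda>e. (e, 0)) ` Basis) + sum f ((\<lambda>v. (0, v)) ` Basis)"
    unfolding Basis_prod_def by (rule sum.union_disjoint) auto
  then show ?thesis by (simp add: sum.reindex inj_on_def)
qed

locale C2_cylinder_function =
  fixes D :: "'a::euclidean_space set" and l :: real
    and w :: "'a \<times> real \<Rightarrow> real" and g :: "'a \<times> real \<Rightarrow> 'a \<times> real"
    and H :: "'a \<times> real \<Rightarrow> 'a \<times> real \<Rightarrow> 'a \<times> real"
  assumes open_D: "open D" and bounded_D: "bounded D" and l_pos: "l > 0"
    and C2: "C2_closure_with (D \<times> {0<..<l}) w g H"
begin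

lemma closure_cylinder: "closure (D \<times> {0<..<l}) = closure D \<times> {0..l}"
  using l_pos by (simp add: closure_Times)

lemma compact_cylinder: "compact (closure D \<times> {0..l})"
  using bounded_D by (intro compact_Times) auto

lemma continuous:
  "continuous_on (closure D \<times> {0..l}) w" "continuous_on (closure D \<times> {0..l}) g"
  "continuous_on (closure D \<times> {0..l}) (\<lambda>p. H p h)"
  using C2 unfolding C2_closure_with_def closure_cylinder by blast+

lemma has_derivative:
  assumes "x \<in> D" "0 < y" "y < l"
  shows "(w has_derivative (\<lambda>h. g (x, y) \<bullet> h)) (at (x, y))"
    "(g has_derivative H (x, y)) (at (x, y))"
  using C2 assms by (auto simp: C2_closure_with_def)

lemma has_derivative_along:
  assumes "(c has_derivative c') (at s)" "c s \<in> D \<times> {0<..<l}"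
  shows "((\<lambda>s. w (c s)) has_derivative (\<lambda>h. g (c s) \<bullet> c' h)) (at s)"
    "((\<lambda>s. g (c s)) has_derivative (\<lambda>h. H (c s) (c' h))) (at s)"
proof -
  obtain x y where xy: "c s = (x, y)" "x \<in> D" "0 < y" "y < l" using assms(2) by auto
  show "((\<lambda>s. w (c s)) has_derivative (\<lambda>h. g (c s) \<bullet> c' h)) (at s)"
    using has_derivative_compose[OF assms(1), of w "\<lambda>h. g (c s) \<bullet> h"] has_derivative(1)[OF xy(2-)]
      xy(1) by simp
  show "((\<lambda>s. g (c s)) has_derivative (\<lambda>h. H (c s) (c' h))) (at s)"
    using has_derivative_compose[OF assms(1), of g "H (c s)"] has_derivative(2)[OF xy(2-)] xy(1)
      by simp
qed

lemma H_scale: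
  assumes "p \<in> D \<times> {0<..<l}" shows "H p (r *\<^sub>R h) = r *\<^sub>R H p h"
proof -
  have "(g has_derivative H p) (at p)" using C2 assms by (auto simp: C2_closure_with_def)
  then have "linear (H p)" by (rule has_derivative_linear)
  then show ?thesis by (rule linear_scale)
qed

lemma derivatives_along_line:
  fixes e h :: "'a \<times> real" and p :: "'a \<times> real"
  assumes "p + s *\<^sub>R e \<in> D \<times> {0<..<l}"
  shows "((\<lambda>s. w (p + s *\<^sub>R e)) has_real_derivative g (p + s *\<^sub>R e) \<bullet> e) (at s)"
    "((\<lambda>s. g (p + s *\<^sub>R e) \<bullet> h) has_real_derivative H (p + s *\<^sub>R e) e \<bullet> h) (at s)"
proof -
  have c: "((\<lambda>s. p + s *\<^sub>R e) has_derivative (\<lambda>r. r *\<^sub>R e)) (at s)"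
    by (auto intro!: derivative_eq_intros)
  show "((\<lambda>s. w (p + s *\<^sub>R e)) has_real_derivative g (p + s *\<^sub>R e) \<bullet> e) (at s)"
    using has_derivative_along(1)[OF c assms]
    by (simp add: has_field_derivative_def mult.commute[of _ "g _ \<bullet> _"])
  have "((\<lambda>s. g (p + s *\<^sub>R e) \<bullet> h) has_derivative (\<lambda>r. H (p + s *\<^sub>R e) (r *\<^sub>R e) \<bullet> h)) (at s)"
    by (rule has_derivative_inner_left[OF has_derivative_along(2)[OF c assms]])
  then show "((\<lambda>s. g (p + s *\<^sub>R e) \<bullet> h) has_real_derivative H (p + s *\<^sub>R e) e \<bullet> h) (at s)"
    by (simp add: has_field_derivative_def H_scale[OF assms] mult.commute[of _ "H _ _ \<bullet> _"])
qed

lemma vertical_slice: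
  assumes x: "x \<in> closure D"
  shows "continuous_on {0..l} (\<lambda>y. w (x, y))" "continuous_on {0..l} (\<lambda>y. g (x, y) \<bullet> h)"
    "continuous_on {0..l} (\<lambda>y. H (x, y) h \<bullet> h)"
  by (intro continuous_intros continuous_on_compose2[OF continuous(1)]
      continuous_on_compose2[OF continuous(2)] continuous_on_compose2[OF continuous(3)]; use x in
        auto)+

lemma vertical_derivatives:
  assumes x: "x \<in> D" and y: "y \<in> {0<..<l}"
  shows "((\<lambda>y. w (x, y)) has_real_derivative g (x, y) \<bullet> (0, 1)) (at y)"
    "((\<lambda>y. g (x, y) \<bullet> (0, 1)) has_real_derivative H (x, y) (0, 1) \<bullet> (0, 1)) (at y)"
  using derivatives_along_line[of "(x, 0)" y "(0, 1)"] assms by simp_all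

lemma integral_vertical_second_derivative:
  assumes x: "x \<in> D" and neumann: "g (x, 0) \<bullet> (0, 1) = 0" and y: "0 \<le> y" "y \<le> l"
  shows "((\<lambda>y. H (x, y) (0, 1) \<bullet> (0, 1)) has_integral g (x, y) \<bullet> (0, 1)) {0..y}"
proof -
  have cl: "x \<in> closure D" using x closure_subset by blast
  have "((\<lambda>y. H (x, y) (0, 1) \<bullet> (0, 1)) has_integral (g (x, y) \<bullet> (0, 1) - g (x, 0) \<bullet> (0, 1)))
    {0..y}"
    using y by (intro fundamental_theorem_of_calculus_interior continuous_on_subset[OF
      vertical_slice(2)[OF cl]])
      (auto simp: has_real_derivative_iff_has_vector_derivative[symmetric] intro!:
        vertical_derivatives(2)[OF x])
  then show ?thesis using neumann by simp
qed

text \<open>Uniformity in y, from uniform continuity of \<open>H\<close> on the compact closed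
  cylinder, is what permits integration against a weight. The estimate is confined to the open
  interval, where \<open>w\<close> is differentiable; the two endpoints are null for the
  integral.\<close>

lemma eventually_uniform_second_difference:
  assumes x: "x \<in> D" and e: "e \<in> Basis" and \<epsilon>: "\<epsilon> > 0"
  shows "\<forall>\<^sub>F t in at_right 0. x + t *\<^sub>R e \<in> D \<and> x - t *\<^sub>R e \<in> D \<and>
    (\<forall>y\<in>{0<..<l}. \<bar>w (x + t *\<^sub>R e, y) + w (x - t *\<^sub>R e, y) - 2 * w (x, y)
      - t\<^sup>2 * (H (x, y) (e, 0) \<bullet> (e, 0))\<bar> \<le> \<epsilon> * t\<^sup>2)"
proof -
  define A where "A = (\<lambda>p. H p (e, 0) \<bullet> (e, 0))"
  have "continuous_on (closure D \<times> {0..l}) A"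
    unfolding A_def by (intro continuous_intros continuous)
  then obtain \<delta> where \<delta>: "\<delta> > 0"
    "\<And>p p'. p \<in> closure D \<times> {0..l} \<Longrightarrow> p' \<in> closure D \<times> {0..l} \<Longrightarrow> dist p' p < \<delta>
      \<Longrightarrow> dist (A p') (A p) < \<epsilon>"
    using compact_uniformly_continuous[OF _ compact_cylinder] \<epsilon>
      unfolding uniformly_continuous_on_def by metis
  obtain R where R: "R > 0" "ball x R \<subseteq> D" using open_D x open_contains_ball by blast
  have "\<forall>\<^sub>F t in at_right 0. t \<in> {0<..<min \<delta> R}"
    using \<delta> R by (intro eventually_at_right_real) auto
  then show ?thesis
  proof eventually_elim
    case (elim t)
    then have t: "0 < t" "t < \<delta>" "t < R" by auto
    have inD: "x + s *\<^sub>R e \<in> D" if "\<bar>s\<bar> \<le> t" for s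
      using that t e R(2) by (auto simp: dist_norm subset_iff)
    have "\<bar>w (x + t *\<^sub>R e, y) + w (x - t *\<^sub>R e, y) - 2 * w (x, y)
      - t\<^sup>2 * (H (x, y) (e, 0) \<bullet> (e, 0))\<bar> \<le> \<epsilon> * t\<^sup>2" if y: "y \<in> {0<..<l}" for y
    proof -
      have line: "(x, y) + s *\<^sub>R (e, 0) \<in> D \<times> {0<..<l}" if "\<bar>s\<bar> \<le> t" for s
        using inD[OF that] y by simp
      have "\<bar>w ((x, y) + t *\<^sub>R (e, 0)) + w ((x, y) + (- t) *\<^sub>R (e, 0)) - 2 * w ((x, y) + 0 *\<^sub>R (e,
        0)) - t\<^sup>2 * A (x, y)\<bar> \<le> \<epsilon> * t\<^sup>2"
      proof (rule second_difference_estimate[OF t(1) derivatives_along_line(1)[OF line]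
        derivatives_along_line(2)[OF line]])
        fix s assume s: "\<bar>s\<bar> \<le> t"
        have "dist ((x, y) + s *\<^sub>R (e, 0)) (x, y) < \<delta>" using s t e
          by (simp add: dist_norm norm_Pair)
        moreover have "(x, y) + s *\<^sub>R (e, 0) \<in> closure D \<times> {0..l}" "(x, y) \<in> closure D \<times> {0..l}"
          using line[OF s] x y closure_subset[of D] by auto
        ultimately have "dist (A ((x, y) + s *\<^sub>R (e, 0))) (A (x, y)) < \<epsilon>" by (intro \<delta>(2))
        then show "\<bar>H ((x, y) + s *\<^sub>R (e, 0)) (e, 0) \<bullet> (e, 0) - A (x, y)\<bar> \<le> \<epsilon>"
          by (simp add: A_def dist_real_def)
      qed
      then show ?thesis by (simp add: A_def)
    qed
    then show ?case using inD[of t] inD[of "- t"] t by simp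
  qed
qed

text \<open>\<open>w\<close> is differentiable only inside, so no derivative is taken at a boundary
  point: the mean value theorem along the normal inside the tangent ball is combined with the
  continuity of \<open>g\<close> up to the closure.\<close>

lemma eventually_uniform_inward_difference:
  assumes x: "x \<in> closure D" and r: "r > 0" "norm \<nu> = 1" "ball (x - r *\<^sub>R \<nu>) r \<subseteq> D" and \<epsilon>: "\<epsilon> > 0"
  shows "\<forall>\<^sub>F t in at_right 0. x - t *\<^sub>R \<nu> \<in> D \<and>
    (\<forall>y\<in>{0<..<l}. \<bar>w (x - t *\<^sub>R \<nu>, y) - w (x, y) + t * (g (x, y) \<bullet> (\<nu>, 0))\<bar> \<le> \<epsilon> * t)"
proof -
  define A where "A = (\<lambda>p. g p \<bullet> (\<nu>, 0))"
  have "continuous_on (closure D \<times> {0..l}) A"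
    unfolding A_def by (intro continuous_intros continuous)
  then obtain \<delta> where \<delta>: "\<delta> > 0"
    "\<And>p p'. p \<in> closure D \<times> {0..l} \<Longrightarrow> p' \<in> closure D \<times> {0..l} \<Longrightarrow> dist p' p < \<delta>
      \<Longrightarrow> dist (A p') (A p) < \<epsilon>"
    using compact_uniformly_continuous[OF _ compact_cylinder] \<epsilon>
      unfolding uniformly_continuous_on_def by metis
  have "\<forall>\<^sub>F t in at_right 0. t \<in> {0<..<min \<delta> r}"
    using \<delta> r by (intro eventually_at_right_real) auto
  then show ?thesis
  proof eventually_elim
    case (elim t)
    then have t: "0 < t" "t < \<delta>" "t < r" by auto
    have inD: "x - s *\<^sub>R \<nu> \<in> D" if "0 < s" "s \<le> t" for s
    proof -
      have "dist (x - r *\<^sub>R \<nu>) (x - s *\<^sub>R \<nu>) = norm ((s - r) *\<^sub>R \<nu>)"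
        by (simp add: dist_norm algebra_simps)
      then show ?thesis using that t r by (intro subsetD[OF r(3)]) simp
    qed
    have "\<bar>w (x - t *\<^sub>R \<nu>, y) - w (x, y) + t * (g (x, y) \<bullet> (\<nu>, 0))\<bar> \<le> \<epsilon> * t" if y:
      "y \<in> {0<..<l}" for y
    proof -
      let ?c = "\<lambda>s. (x, y) + s *\<^sub>R (- \<nu>, 0)"
      have line: "?c s \<in> D \<times> {0<..<l}" if "0 < s" "s \<le> t" for s
        using inD[OF that] y by simp
      have lineK: "?c s \<in> closure D \<times> {0..l}" if "0 \<le> s" "s \<le> t" for s
        using line[of s] that x y closure_subset[of D] by (cases "s = 0") auto
      obtain \<xi> where \<xi>: "0 < \<xi>" "\<xi> < t" "w (?c t) - w (?c 0) = (g (?c \<xi>) \<bullet> (- \<nu>, 0)) * (t - 0)"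
      proof (rule mvt[OF t(1), of "\<lambda>s. w (?c s)" "\<lambda>s h. (g (?c s) \<bullet> (- \<nu>, 0)) * h"])
        show "continuous_on {0..t} (\<lambda>s. w (?c s))"
          using lineK by (intro continuous_on_compose2[OF continuous(1)] continuous_intros) auto
        show "((\<lambda>s. w (?c s)) has_derivative (\<lambda>h. (g (?c s) \<bullet> (- \<nu>, 0)) * h)) (at s)"
          if "0 < s" "s < t" for s
          using derivatives_along_line(1)[OF line[of s]] that
            by (simp add: has_field_derivative_def)
      qed (use that in auto)
      have "dist (?c \<xi>) (x, y) < \<delta>" using \<xi> t r by (simp add: dist_norm norm_Pair)
      moreover have "?c \<xi> \<in> closure D \<times> {0..l}" "(x, y) \<in> closure D \<times> {0..l}"
        using lineK[of \<xi>] lineK[of 0] \<xi> t by auto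
      ultimately have "dist (A (?c \<xi>)) (A (x, y)) < \<epsilon>" by (intro \<delta>(2))
      then have "\<bar>A (x, y) - A (?c \<xi>)\<bar> \<le> \<epsilon>" by (simp add: dist_real_def)
      then have "\<bar>A (x, y) - A (?c \<xi>)\<bar> * t \<le> \<epsilon> * t" using t by (intro mult_right_mono) auto
      moreover have "g (?c \<xi>) \<bullet> (- \<nu>, 0) = - A (?c \<xi>)"
        unfolding A_def inner_minus_right[symmetric] by simp
      then have "w (x - t *\<^sub>R \<nu>, y) - w (x, y) + t * A (x, y) = (A (x, y) - A (?c \<xi>)) * t"
        using \<xi>(3) by (simp add: algebra_simps)
      ultimately show ?thesis using t by (simp add: A_def abs_mult)
    qed
    then show ?case using inD[of t] t by simp
  qed
qed

lemma weighted_slice_integrable: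
  assumes "weight_on {0..l} \<theta>" "x \<in> closure D"
  shows "(\<lambda>y. \<theta> y * w (x, y)) integrable_on {0..l}" "(\<lambda>y. \<theta> y * (g (x, y) \<bullet> h))
    integrable_on {0..l}"
    "(\<lambda>y. \<theta> y * (H (x, y) h \<bullet> h)) integrable_on {0..l}"
  by (intro weight_mult_integrable assms(1) vertical_slice[OF assms(2)])+

lemma eventually_weighted_second_difference:
  assumes \<theta>: "weight_on {0..l} \<theta>"
    and x: "x \<in> D" and e: "e \<in> Basis" and \<epsilon>: "\<epsilon> > 0"
  defines "I \<equiv> \<lambda>x. integral {0..l} (\<lambda>y. \<theta> y * w (x, y))"
  shows "\<forall>\<^sub>F t in at_right 0. x + t *\<^sub>R e \<in> D \<and> x - t *\<^sub>R e \<in> D \<and>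
    \<bar>I (x + t *\<^sub>R e) + I (x - t *\<^sub>R e) - 2 * I x
      - t\<^sup>2 * integral {0..l} (\<lambda>y. \<theta> y * (H (x, y) (e, 0) \<bullet> (e, 0)))\<bar> \<le> \<epsilon> * t\<^sup>2"
proof -
  have "\<epsilon> / l > 0" using \<epsilon> l_pos by simp
  from eventually_uniform_second_difference[OF x e this] show ?thesis
  proof eventually_elim
    case (elim t)
    have cl: "x + t *\<^sub>R e \<in> closure D" "x - t *\<^sub>R e \<in> closure D" "x \<in> closure D"
      using elim x closure_subset[of D] by auto
    note i = weighted_slice_integrable[OF \<theta> cl(1)] weighted_slice_integrable[OF \<theta> cl(2)]
      weighted_slice_integrable[OF \<theta> cl(3)]
    define K where "K = (\<lambda>y. \<theta> y * w (x + t *\<^sub>R e, y) + \<theta> y * w (x - t *\<^sub>R e, y) - 2 * (\<theta> y * w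
      (x, y))
      - t\<^sup>2 * (\<theta> y * (H (x, y) (e, 0) \<bullet> (e, 0))))"
    have "(K has_integral (I (x + t *\<^sub>R e) + I (x - t *\<^sub>R e) - 2 * I x
      - t\<^sup>2 * integral {0..l} (\<lambda>y. \<theta> y * (H (x, y) (e, 0) \<bullet> (e, 0))))) {0..l}"
      unfolding K_def I_def
      by (intro has_integral_diff has_integral_add has_integral_mult_right integrable_integral i)
    then have K: "K integrable_on {0..l}" "integral {0..l} K
      = I (x + t *\<^sub>R e) + I (x - t *\<^sub>R e) - 2 * I x
      - t\<^sup>2 * integral {0..l} (\<lambda>y. \<theta> y * (H (x, y) (e, 0) \<bullet> (e, 0)))"
      by (auto simp: integral_unique)
    have "\<bar>integral {0..l} K\<bar> \<le> \<epsilon> / l * t\<^sup>2 * (l - 0)"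
    proof (rule integral_abs_bound_interval[OF K(1)])
      show "0 \<le> l" using l_pos by simp
      fix y assume y: "y \<in> {0<..<l}"
      have "K y = \<theta> y * (w (x + t *\<^sub>R e, y) + w (x - t *\<^sub>R e, y) - 2 * w (x, y) - t\<^sup>2 * (H (x, y)
        (e, 0) \<bullet> (e, 0)))"
        by (simp add: K_def algebra_simps)
      also have "\<bar>\<dots>\<bar> \<le> 1 * (\<epsilon> / l * t\<^sup>2)"
        unfolding abs_mult using elim y weight_on_bounds[OF \<theta>, of y] by (intro mult_mono) auto
      finally show "\<bar>K y\<bar> \<le> \<epsilon> / l * t\<^sup>2" by simp
    qed
    then show ?case using elim l_pos by (simp add: K(2))
  qed
qed

lemma eventually_weighted_inward_difference:
  assumes \<theta>: "weight_on {0..l} \<theta>"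
    and x: "x \<in> closure D" and r: "r > 0" "norm \<nu> = 1" "ball (x - r *\<^sub>R \<nu>) r \<subseteq> D" and \<epsilon>: "\<epsilon> > 0"
  defines "I \<equiv> \<lambda>x. integral {0..l} (\<lambda>y. \<theta> y * w (x, y))"
  shows "\<forall>\<^sub>F t in at_right 0. x - t *\<^sub>R \<nu> \<in> D \<and>
    \<bar>I (x - t *\<^sub>R \<nu>) - I x + t * integral {0..l} (\<lambda>y. \<theta> y * (g (x, y) \<bullet> (\<nu>, 0)))\<bar> \<le> \<epsilon> * t"
proof -
  have "\<epsilon> / l > 0" using \<epsilon> l_pos by simp
  from eventually_uniform_inward_difference[OF x r this] show ?thesis
  proof eventually_elim
    case (elim t)
    have cl: "x - t *\<^sub>R \<nu> \<in> closure D" using elim closure_subset[of D] by auto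
    note i = weighted_slice_integrable[OF \<theta> cl] weighted_slice_integrable[OF \<theta> x]
    define K where "K = (\<lambda>y. \<theta> y * w (x - t *\<^sub>R \<nu>, y) - \<theta> y * w (x, y) + t * (\<theta> y * (g (x, y) \<bullet>
      (\<nu>, 0))))"
    have "(K has_integral (I (x - t *\<^sub>R \<nu>) - I x
      + t * integral {0..l} (\<lambda>y. \<theta> y * (g (x, y) \<bullet> (\<nu>, 0))))) {0..l}"
      unfolding K_def I_def
      by (intro has_integral_diff has_integral_add has_integral_mult_right integrable_integral i)
    then have K: "K integrable_on {0..l}" "integral {0..l} K = I (x - t *\<^sub>R \<nu>) - I x
      + t * integral {0..l} (\<lambda>y. \<theta> y * (g (x, y) \<bullet> (\<nu>, 0)))"
      by (auto simp: integral_unique)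
    have "\<bar>integral {0..l} K\<bar> \<le> \<epsilon> / l * t * (l - 0)"
    proof (rule integral_abs_bound_interval[OF K(1)])
      show "0 \<le> l" using l_pos by simp
      fix y assume y: "y \<in> {0<..<l}"
      have "K y = \<theta> y * (w (x - t *\<^sub>R \<nu>, y) - w (x, y) + t * (g (x, y) \<bullet> (\<nu>, 0)))"
        by (simp add: K_def algebra_simps)
      also have "\<bar>\<dots>\<bar> \<le> 1 * (\<epsilon> / l * t)"
        unfolding abs_mult using elim y weight_on_bounds[OF \<theta>, of y] by (intro mult_mono) auto
      finally show "\<bar>K y\<bar> \<le> \<epsilon> / l * t" by simp
    qed
    then show ?case using elim l_pos by (simp add: K(2))
  qed
qed

lemma weighted_horizontal_laplacian:
  assumes \<theta>: "weight_on {0..l} \<theta>"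
    and x: "x \<in> D" and eq: "\<And>y. y \<in> {0<..<l} \<Longrightarrow> - laplacian_of H (x, y) = F y"
  shows "(\<Sum>e\<in>Basis. integral {0..l} (\<lambda>y. \<theta> y * (H (x, y) (e, 0) \<bullet> (e, 0)))) =
    - integral {0..l} (\<lambda>y. \<theta> y * F y) - integral {0..l} (\<lambda>y. \<theta> y * (H (x, y) (0, 1) \<bullet> (0, 1)))"
proof -
  have cl: "x \<in> closure D" using x closure_subset by auto
  note i = weighted_slice_integrable(3)[OF \<theta> cl]
  have "integral {0..l} (\<lambda>y. \<theta> y * F y) = integral {0..l}
      (\<lambda>y. - (\<Sum>e\<in>Basis. \<theta> y * (H (x, y) (e, 0) \<bullet> (e, 0))) - \<theta> y * (H (x, y) (0, 1) \<bullet> (0, 1)))"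
  proof (rule integral_spike[of "{0, l}"])
    fix y assume "y \<in> {0..l} - {0, l}"
    then have F: "F y = - (\<Sum>e\<in>Basis. H (x, y) (e, 0) \<bullet> (e, 0)) - H (x, y) (0, 1) \<bullet> (0, 1)"
      using eq[of y] by (simp add: laplacian_of_def sum_Basis_prod)
    show "- (\<Sum>e\<in>Basis. \<theta> y * (H (x, y) (e, 0) \<bullet> (e, 0))) - \<theta> y * (H (x, y) (0, 1) \<bullet> (0, 1))
      = \<theta> y * F y"
      unfolding F sum_distrib_left[symmetric] by (simp add: algebra_simps)
  qed simp
  also have "\<dots> = - (\<Sum>e\<in>Basis. integral {0..l} (\<lambda>y. \<theta> y * (H (x, y) (e, 0) \<bullet> (e, 0))))
      - integral {0..l} (\<lambda>y. \<theta> y * (H (x, y) (0, 1) \<bullet> (0, 1)))"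
    by (intro integral_unique has_integral_diff has_integral_neg has_integral_sum finite_Basis
      integrable_integral i)
  finally show ?thesis by simp
qed

end

text \<open>A common continuity argument for the star function, Jv and weighted integrals:
  monotonicity up to constants gives Lipschitz dependence on the slice in the sup norm, slices
  depend uniformly continuously on x, and \<open>lip\<close> controls y.\<close>

lemma continuous_on_slice_functional:
  fixes u :: "'a::metric_space \<times> real \<Rightarrow> real" and \<Phi> :: "(real \<Rightarrow> real) \<Rightarrow> real \<Rightarrow> real"
  assumes K: "compact K" and u: "continuous_on (K \<times> {0..l}) u" and l: "l > 0"
    and mono: "\<And>q q' d y. \<lbrakk>continuous_on {0..l} q; continuous_on {0..l} q'; d \<ge> 0;
        \<And>t. t \<in> {0..l} \<Longrightarrow> q t \<le> q' t + d; y \<in> {0..l}\<rbrakk> \<Longrightarrow> \<Phi> q y \<le> \<Phi> q' y + d * l"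
    and lip: "\<And>q B y y'. \<lbrakk>continuous_on {0..l} q; \<And>t. t \<in> {0..l} \<Longrightarrow> \<bar>q t\<bar> \<le> B; 0 \<le> y; y \<le> y'; y'
      \<le> l\<rbrakk> \<Longrightarrow>
        \<bar>\<Phi> q y' - \<Phi> q y\<bar> \<le> B * (y' - y)"
  shows "continuous_on (K \<times> {0..l}) (\<lambda>p. \<Phi> (\<lambda>t. u (fst p, t)) (snd p))"
proof -
  have cK: "compact (K \<times> {0..l})" using K by (intro compact_Times) auto
  have sl: "continuous_on {0..l} (\<lambda>t. u (x, t))" if "x \<in> K" for x
    by (rule continuous_on_compose2[OF u]) (use that in \<open>auto intro!: continuous_intros\<close>)
  obtain B0 where B0: "\<And>p. p \<in> K \<times> {0..l} \<Longrightarrow> \<bar>u p\<bar> \<le> B0"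
    using compact_continuous_abs_bound[OF cK u] by blast
  define B where "B = max B0 1"
  have "B > 0" and B: "\<And>p. p \<in> K \<times> {0..l} \<Longrightarrow> \<bar>u p\<bar> \<le> B"
    using B0 by (auto simp: B_def intro: order.trans[OF _ max.cobounded1])
  have uc: "uniformly_continuous_on (K \<times> {0..l}) u"
    by (rule compact_uniformly_continuous[OF u cK])
  show ?thesis unfolding continuous_on_iff
  proof (intro ballI allI impI)
    fix \<epsilon> :: real and p0 assume "p0 \<in> K \<times> {0..l}" and \<epsilon>: "(0::real) < \<epsilon>"
    then obtain x y where p0: "p0 = (x, y)" "x \<in> K" "y \<in> {0..l}" by auto
    define \<eta> where "\<eta> = \<epsilon> / (3 * l)"
    have "\<eta> > 0" using \<epsilon> l by (simp add: \<eta>_def)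
    then obtain \<delta> where \<delta>: "\<delta> > 0" "\<And>p p'. p \<in> K \<times> {0..l} \<Longrightarrow> p' \<in> K \<times> {0..l} \<Longrightarrow> dist p' p < \<delta>
      \<Longrightarrow> dist (u p') (u p) < \<eta>"
      using uc unfolding uniformly_continuous_on_def by metis
    have "dist (\<Phi> (\<lambda>t. u (fst p', t)) (snd p')) (\<Phi> (\<lambda>t. u (fst p0, t)) (snd p0)) < \<epsilon>"
      if p': "p' \<in> K \<times> {0..l}" "dist p' p0 < min \<delta> (\<epsilon> / (3 * B))" for p'
    proof -
      obtain x' y' where xy': "p' = (x', y')" "x' \<in> K" "y' \<in> {0..l}" using p' by auto
      have dx: "dist x' x < \<delta>" using dist_fst_le[of p' p0] p' by (simp add: xy' p0)
      have dy: "\<bar>y' - y\<bar> < \<epsilon> / (3 * B)" using dist_snd_le[of p' p0] p'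
        by (simp add: xy' p0 dist_real_def)
      have close: "\<bar>u (x', t) - u (x, t)\<bar> < \<eta>" if "t \<in> {0..l}" for t
        using \<delta>(2)[of "(x, t)" "(x', t)"] that dx xy' p0 by (simp add: dist_Pair_Pair dist_real_def)
      have "\<Phi> (\<lambda>t. u (x', t)) y' \<le> \<Phi> (\<lambda>t. u (x, t)) y' + \<eta> * l"
        using \<open>\<eta> > 0\<close> close xy' p0 by (intro mono sl) (force simp: abs_less_iff)+
      moreover have "\<Phi> (\<lambda>t. u (x, t)) y' \<le> \<Phi> (\<lambda>t. u (x', t)) y' + \<eta> * l"
        using \<open>\<eta> > 0\<close> close xy' p0 by (intro mono sl) (force simp: abs_less_iff)+
      moreover have "\<bar>\<Phi> (\<lambda>t. u (x, t)) y' - \<Phi> (\<lambda>t. u (x, t)) y\<bar> \<le> B * \<bar>y' - y\<bar>"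
        using lip[OF sl[OF p0(2)], of B y y'] lip[OF sl[OF p0(2)], of B y' y] B p0 xy'
        by (cases "y \<le> y'") (auto simp: abs_minus_commute)
      moreover have "B * \<bar>y' - y\<bar> \<le> \<epsilon> / 3" using dy \<open>B > 0\<close> by (simp add: field_simps)
      moreover have "\<eta> * l = \<epsilon> / 3" using l by (simp add: \<eta>_def)
      ultimately show ?thesis using \<epsilon> by (simp add: p0 xy' dist_real_def abs_le_iff abs_less_iff)
    qed
    then show "\<exists>d>0. \<forall>x'\<in>K \<times> {0..l}. dist x' p0 < d \<longrightarrow>
        dist (\<Phi> (\<lambda>t. u (fst x', t)) (snd x')) (\<Phi> (\<lambda>t. u (fst p0, t)) (snd p0)) < \<epsilon>"
      using \<delta>(1) \<epsilon> \<open>B > 0\<close> by (intro exI[of _ "min \<delta> (\<epsilon> / (3 * B))"]) auto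
  qed
qed

section \<open>The comparison\<close>

text \<open>A subgradient at the rearrangement a of p gives \<phi>(q) >= \<phi>(a) + sg(a) (q - a).
  Since sg(a) is decreasing and the totals agree, the mean value theorem writes the integral of
  sg(a) (q - a) as sg(a 0) - sg(a l) times the integral of q - a over an initial interval; both
  factors are nonnegative.\<close>

lemma integral_convex_le_of_majorized:
  fixes p q \<phi> :: "real \<Rightarrow> real"
  assumes p: "continuous_on {0..l} p" and q: "continuous_on {0..l} q" and l: "l > 0"
    and maj: "\<And>y. y \<in> {0..l} \<Longrightarrow> integral {0..y} (decr_rearr l p) \<le> integral {0..y} q"
    and total: "integral {0..l} p = integral {0..l} q"
    and \<phi>: "convex_on UNIV \<phi>"
  shows "integral {0..l} (\<lambda>y. \<phi> (p y)) \<le> integral {0..l} (\<lambda>y. \<phi> (q y))"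
proof -
  \<comment> \<open>The right derivative of \<phi>, as the infimum of its difference quotients to
    the right.\<close>
  define sg where "sg = (\<lambda>x. Inf ((\<lambda>t. (\<phi> x - \<phi> t) / (x - t)) ` ({x<..} \<inter> UNIV)))"
  have sg: "\<phi> x + sg x * (y - x) \<le> \<phi> y" for x y
    unfolding sg_def using convex_le_Inf_differential[OF \<phi>, of x y] by simp
  have sg_mono: "sg x \<le> sg y" if "x \<le> y" for x y
  proof (cases "x = y")
    case False
    then have "(sg x - sg y) * (y - x) \<le> 0" using sg[of x y] sg[of y x] by (simp add: algebra_simps)
    then show ?thesis using False that by (simp add: mult_le_0_iff)
  qed simp
  have \<phi>c: "continuous_on UNIV \<phi>" by (rule convex_on_continuous[OF open_UNIV \<phi>])
  obtain B where B: "\<And>y. y \<in> {0..l} \<Longrightarrow> \<bar>p y\<bar> \<le> B"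
    using compact_continuous_abs_bound[OF compact_Icc p] by blast
  have bd: "- B \<le> p y \<and> p y \<le> B" if "y \<in> {0<..<l}" for y using B[of y] that by auto
  \<comment> \<open>The rearrangement with its endpoint values replaced by the bounds B and - B and
    extended constantly, so that it is decreasing up to and beyond the endpoints.\<close>
  define a where "a = (\<lambda>t. if t \<le> 0 then B else if l \<le> t then - B else decr_rearr l p t)"
  have spike: "h (a t) = h (decr_rearr l p t)" if "t \<in> {0..l} - {0, l}" for h :: "real \<Rightarrow> real" and t
    using that by (auto simp: a_def)
  have "B \<ge> 0" using B[of 0] l by auto
  have a_anti: "a t' \<le> a t" if "t \<le> t'" for t t'
    using that decr_rearr_antimono[OF p, of t t'] decr_rearr_bounds[OF p, of t "-B" B]
      decr_rearr_bounds[OF p, of t' "-B" B] bd \<open>B \<ge> 0\<close> by (auto simp: a_def)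
  have ia: "a integrable_on {0..l}" "integral {0..y} a = integral {0..y} (decr_rearr l p)"
    if "y \<in> {0..l}" for y
  proof -
    have "decr_rearr l p integrable_on {0..l}" by (rule decr_rearr_integrable[OF p l]) auto
    then show "a integrable_on {0..l}"
      by (rule integrable_spike[of _ _ "{0, l}"]) (use spike[of _ "\<lambda>x. x"] in auto)
    show "integral {0..y} a = integral {0..y} (decr_rearr l p)"
      by (rule integral_spike[of "{0, l}"]) (use that spike[of _ "\<lambda>x. x"] in auto)
  qed
  have i\<phi>a: "(\<lambda>t. \<phi> (a t)) integrable_on {0..l}"
    by (rule integrable_spike[OF equimeasurable_integral(1)[OF p l \<phi>c], of "{0, l}"])
      (use spike[of _ \<phi>] in auto)
  have \<phi>a: "integral {0..l} (\<lambda>t. \<phi> (a t)) = integral {0..l} (\<lambda>t. \<phi> (p t))"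
    unfolding equimeasurable_integral(2)[OF p l \<phi>c, symmetric]
    by (rule integral_spike[of "{0, l}"]) (use spike[of _ \<phi>] in auto)
  define F where "F = (\<lambda>t. q t - a t)"
  have iq: "q integrable_on {0..y}" if "y \<in> {0..l}" for y
    using that by (intro integrable_continuous_interval continuous_on_subset[OF q]) auto
  have iF: "F integrable_on {0..l}" unfolding F_def using iq[of l] ia(1)[of l] l
    by (intro integrable_diff) auto
  have F_int: "integral {0..y} F = integral {0..y} q - integral {0..y} (decr_rearr l p)"
    if "y \<in> {0..l}" for y
  proof -
    have "a integrable_on {0..y}" using ia(1)[of l] that by (auto intro: integrable_on_subinterval)
    then show ?thesis unfolding F_def ia(2)[OF that, symmetric]
      using iq[OF that] by (intro hk_integral_diff)
  qed
  obtain \<xi> where \<xi>: "\<xi> \<in> {0..l}" "((\<lambda>x. - sg (a x) * F x) has_integral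
      (- sg (a 0) * integral {0..\<xi>} F + - sg (a l) * integral {\<xi>..l} F)) {0..l}"
    using second_mean_value_theorem_full[OF iF, of "\<lambda>x. - sg (a x)"] l sg_mono a_anti by auto
  have "integral {0..l} F = 0"
    using F_int[of l] l total integral_decr_rearr_total[OF p l] by simp
  then have "integral {\<xi>..l} F = - integral {0..\<xi>} F"
    using hk_integral_combine[of 0 \<xi> l F] \<xi>(1) iF by simp
  then have "((\<lambda>x. - (- sg (a x) * F x)) has_integral (sg (a 0) - sg (a l)) * integral {0..\<xi>} F)
    {0..l}"
    using has_integral_neg[OF \<xi>(2)] by (simp add: algebra_simps)
  then have I: "((\<lambda>x. sg (a x) * F x) has_integral (sg (a 0) - sg (a l)) * integral {0..\<xi>} F)
    {0..l}" by simp
  have "0 \<le> (sg (a 0) - sg (a l)) * integral {0..\<xi>} F"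
    using F_int[OF \<xi>(1)] maj[OF \<xi>(1)] sg_mono[OF a_anti[of 0 l]] l
      by (intro mult_nonneg_nonneg) auto
  then have "integral {0..l} (\<lambda>t. \<phi> (p t)) \<le> integral {0..l} (\<lambda>t. \<phi> (a t) + sg (a t) * F t)"
    using \<phi>a I i\<phi>a by (subst hk_integral_add) (auto simp: integral_unique has_integral_integrable)
  also have "\<dots> \<le> integral {0..l} (\<lambda>y. \<phi> (q y))"
  proof (rule integral_le)
    show "(\<lambda>t. \<phi> (a t) + sg (a t) * F t) integrable_on {0..l}" using i\<phi>a I
      by (intro integrable_add) auto
    show "(\<lambda>y. \<phi> (q y)) integrable_on {0..l}"
      by (intro integrable_continuous_interval continuous_on_compose2[OF \<phi>c q]) auto
  qed (use sg in \<open>simp add: F_def\<close>)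
  finally show ?thesis .
qed

lemma hopf_contradiction:
  fixes w :: "'a::euclidean_space \<Rightarrow> real"
  assumes r: "r > 0" and \<nu>: "norm \<nu> = 1" and cont: "continuous_on (cball (z - r *\<^sub>R \<nu>) r) w"
    and sub: "\<And>p. p \<in> ball (z - r *\<^sub>R \<nu>) r \<Longrightarrow> weakly_subharmonic_at w p"
    and le: "\<And>p. p \<in> cball (z - r *\<^sub>R \<nu>) r \<Longrightarrow> w p \<le> M"
    and less: "\<And>p. p \<in> ball (z - r *\<^sub>R \<nu>) r \<Longrightarrow> w p < M"
    and lower: "\<And>\<epsilon>. \<epsilon> > 0 \<Longrightarrow> \<forall>\<^sub>F t in at_right 0. M - \<epsilon> * t \<le> w (z - t *\<^sub>R \<nu>)"
  shows False
proof -
  obtain \<kappa> where \<kappa>: "\<kappa> > 0" "\<And>p. r / 2 \<le> norm (p - (z - r *\<^sub>R \<nu>)) \<Longrightarrow> norm (p - (z - r *\<^sub>R \<nu>)) \<le> r \<Longrightarrow>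
      w p \<le> M - \<kappa> * (r\<^sup>2 - (norm (p - (z - r *\<^sub>R \<nu>)))\<^sup>2)"
    using hopf_boundary_estimate[OF r cont sub le less] by metis
  \<comment> \<open>Half of the forced drop rate \<kappa> r.\<close>
  have "\<kappa> * r / 2 > 0" using \<kappa> r by simp
  note 1 = lower[OF this]
  have 2: "\<forall>\<^sub>F t in at_right 0. t \<in> {0<..<r / 2}" using r by (intro eventually_at_right_real) auto
  have "\<forall>\<^sub>F t in at_right (0::real). False"
    using 1 2
  proof eventually_elim
    case (elim t)
    have "norm (z - t *\<^sub>R \<nu> - (z - r *\<^sub>R \<nu>)) = norm ((r - t) *\<^sub>R \<nu>)" by (simp add: algebra_simps)
    then have n: "norm (z - t *\<^sub>R \<nu> - (z - r *\<^sub>R \<nu>)) = r - t" using elim \<nu> by simp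
    have "w (z - t *\<^sub>R \<nu>) \<le> M - \<kappa> * (r\<^sup>2 - (r - t)\<^sup>2)"
      using \<kappa>(2)[of "z - t *\<^sub>R \<nu>"] elim unfolding n by simp
    moreover have "t * r \<le> r\<^sup>2 - (r - t)\<^sup>2"
    proof -
      have "t * t \<le> t * r" using elim by (intro mult_left_mono) auto
      then show ?thesis by (simp add: power2_eq_square algebra_simps)
    qed
    then have "\<kappa> * (t * r) \<le> \<kappa> * (r\<^sup>2 - (r - t)\<^sup>2)" using \<kappa>(1) by (intro mult_left_mono) auto
    ultimately have "\<kappa> * (t * r) \<le> \<kappa> * r / 2 * t" using elim(1) by linarith
    moreover have "\<kappa> * (t * r) > 0" using \<kappa>(1) elim(2) r by simp
    ultimately show False by (simp add: mult.commute)
  qed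
  then show False by simp
qed

text \<open>The hypothesis \<open>robin\<close> is one side of the boundary condition in increments:
  minus the outer normal derivative is at least \<alpha> h. For \<alpha> > 0 it makes h rise from a
  positive boundary maximum into D, which is absurd, and an interior maximum is first carried to the
  frontier by the strong maximum principle. For \<alpha> = 0 the condition only says that h does not
  drop at first order, and Hopf's lemma excludes a maximum attained on the frontier alone.\<close>

lemma robin_maximum_principle:
  fixes D :: "'a::euclidean_space set" and h :: "'a \<Rightarrow> real"
  assumes D: "smooth_bounded_domain D" and cont: "continuous_on (closure D) h"
    and sub: "\<And>x. x \<in> D \<Longrightarrow> weakly_subharmonic_at h x" and "\<alpha> \<ge> 0"
    and robin: "\<And>x \<epsilon>. x \<in> frontier D \<Longrightarrow> \<epsilon> > 0 \<Longrightarrow> \<forall>\<^sub>F t in at_right 0.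
      x - t *\<^sub>R outer_normal D x \<in> D \<and> h x + t * (\<alpha> * h x) - \<epsilon> * t \<le> h (x - t *\<^sub>R outer_normal D x)"
  shows "\<alpha> > 0 \<Longrightarrow> x \<in> D \<Longrightarrow> h x \<le> 0" "\<alpha> = 0 \<Longrightarrow> x \<in> D \<Longrightarrow> y \<in> D \<Longrightarrow> h x = h y"
proof -
  have "open D" "connected D" "D \<noteq> {}" "bounded D" using D by (auto simp: smooth_bounded_domain_def)
  have "compact (closure D)" "closure D \<noteq> {}" using \<open>bounded D\<close> \<open>D \<noteq> {}\<close> by auto
  then obtain z where z: "z \<in> closure D" "\<And>x. x \<in> closure D \<Longrightarrow> h x \<le> h z"
    using continuous_attains_sup[OF _ _ cont] by blast
  have sup: "h x \<le> h z" if "x \<in> D" for x using that z(2) closure_subset by blast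
  have const: "h x = h z" if "y \<in> D" "h y = h z" "x \<in> D" for x y
    by (rule strong_maximum_principle[OF \<open>open D\<close> \<open>connected D\<close> continuous_on_subset[OF cont
      closure_subset] sub sup that])
  have neg: "\<alpha> * h b < 0" if b: "b \<in> frontier D" "h b = h z" and nc: "\<And>y. y \<in> D \<Longrightarrow> h y \<noteq> h z" for b
  proof (rule ccontr)
    assume "\<not> \<alpha> * h b < 0"
    define \<nu> where "\<nu> = outer_normal D b"
    obtain R where R: "R > 0" "norm \<nu> = 1" "ball (b - R *\<^sub>R \<nu>) R \<subseteq> D"
      using interior_ball_condition[OF D b(1)] unfolding \<nu>_def by (metis order_refl)
    have cb: "cball (b - R *\<^sub>R \<nu>) R \<subseteq> closure D"
      using closure_mono[OF R(3)] R(1) by simp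
    show False
    proof (rule hopf_contradiction[OF R(1,2), of b h "h z"])
      show "continuous_on (cball (b - R *\<^sub>R \<nu>) R) h" by (rule continuous_on_subset[OF cont cb])
      show "weakly_subharmonic_at h p" if "p \<in> ball (b - R *\<^sub>R \<nu>) R" for p using that R(3) sub
        by blast
      show "h p \<le> h z" if "p \<in> cball (b - R *\<^sub>R \<nu>) R" for p using that cb z(2) by blast
      show "h p < h z" if "p \<in> ball (b - R *\<^sub>R \<nu>) R" for p
        using that R(3) sup[of p] nc[of p] by (metis less_le subsetD)
      show "\<forall>\<^sub>F t in at_right 0. h z - \<epsilon> * t \<le> h (b - t *\<^sub>R \<nu>)" if "\<epsilon> > 0" for \<epsilon>
        using robin[OF b(1) that] eventually_at_right_less[of "0::real"]
      proof eventually_elim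
        case (elim t)
        have "0 \<le> t * (\<alpha> * h b)" using elim \<open>\<not> \<alpha> * h b < 0\<close> by simp
        then show ?case using elim b(2) by (simp add: \<nu>_def)
      qed
    qed
  qed
  have zD: "z \<in> D \<or> z \<in> frontier D" using z(1) closure_Un_frontier[of D] by auto
  show "h x = h y" if "\<alpha> = 0" "x \<in> D" "y \<in> D"
    using const neg zD that by (metis less_irrefl mult_zero_left)
  show "h x \<le> 0" if "\<alpha> > 0" "x \<in> D"
  proof (rule ccontr)
    assume "\<not> h x \<le> 0"
    then have pos: "h z > 0" using sup[OF that(2)] by linarith
    have "\<exists>b\<in>frontier D. h b = h z"
    proof (cases "z \<in> D")
      case True
      have "frontier D \<noteq> {}" using \<open>D \<noteq> {}\<close> \<open>bounded D\<close> not_bounded_UNIV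
        by (auto simp: frontier_eq_empty)
      then obtain b where "b \<in> frontier D" by blast
      moreover have "h b = h z"
        by (rule continuous_constant_on_closure[OF cont])
          (use const[OF True refl] calculation in \<open>auto simp: frontier_def\<close>)
      ultimately show ?thesis by blast
    qed (use zD in blast)
    then obtain b where b: "b \<in> frontier D" "h b = h z" by blast
    have "\<alpha> * h z / 2 > 0" using pos that by simp
    from robin[OF b(1) this] have "\<forall>\<^sub>F t in at_right (0::real). False"
      using eventually_at_right_less[of "0::real"]
    proof eventually_elim
      case (elim t)
      then have "h z + t * (\<alpha> * h z) - \<alpha> * h z / 2 * t \<le> h z"
        using sup[of "b - t *\<^sub>R outer_normal D b"] unfolding b(2) by linarith
      then have "t * (\<alpha> * h z) \<le> 0" by (simp add: algebra_simps)
      moreover have "t * (\<alpha> * h z) > 0" using elim pos that by simp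
      ultimately show False by linarith
    qed
    then show False by simp
  qed
qed

section \<open>Integration over the cylinder\<close>

lemma measure_open_pos:
  fixes D :: "'a::euclidean_space set"
  assumes "open D" "D \<noteq> {}" "bounded D"
  shows "measure lborel D > 0"
proof -
  have "D \<in> lmeasurable" using assms by (simp add: lmeasurable_open)
  moreover have "\<not> negligible D" using assms open_not_negligible by blast
  ultimately have "measure lebesgue D \<noteq> 0" by (simp add: negligible_iff_measure)
  moreover have "measure lebesgue D = measure lborel D" using \<open>open D\<close>
    by (simp add: measure_completion)
  ultimately show ?thesis by (simp add: less_le)
qed

text \<open>Fubini's theorem in the form that evaluates the zero mean of u - v on the cylinder once
  its slice integrals are known to be one constant.\<close>

lemma cylinder_integral:
  fixes d :: "'a::euclidean_space \<times> real \<Rightarrow> real"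
  assumes D: "open D" "bounded D" and l: "l > 0" and d: "continuous_on (closure D \<times> {0..l}) d"
  shows "d integrable_on D \<times> {0<..<l}"
    "(\<And>x. x \<in> D \<Longrightarrow> integral {0..l} (\<lambda>y. d (x, y)) = c) \<Longrightarrow>
      integral (D \<times> {0<..<l}) d = c * measure lborel D"
proof -
  define \<Omega> where "\<Omega> = D \<times> {0<..<l}"
  have sub: "\<Omega> \<subseteq> closure D \<times> {0..l}" unfolding \<Omega>_def using closure_subset[of D] by auto
  have "open \<Omega>" "bounded \<Omega>" unfolding \<Omega>_def using D by (auto intro!: open_Times bounded_Times)
  have "compact (closure D \<times> {0..l})" using D by (intro compact_Times) auto
  then obtain B where B: "\<And>p. p \<in> closure D \<times> {0..l} \<Longrightarrow> \<bar>d p\<bar> \<le> B"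
    using compact_continuous_abs_bound[OF _ d] by blast
  have int: "set_integrable lborel \<Omega> d" unfolding set_integrable_def
  proof (rule integrableI_bounded_set[of \<Omega> _ _ B])
    show "\<Omega> \<in> sets lborel" using \<open>open \<Omega>\<close> by simp
    show "(\<lambda>x. indicat_real \<Omega> x *\<^sub>R d x) \<in> borel_measurable lborel"
      using borel_measurable_continuous_on_indicator[OF _ continuous_on_subset[OF d sub]] \<open>open \<Omega>\<close>
        by simp
    show "emeasure lborel \<Omega> < \<infinity>" using \<open>bounded \<Omega>\<close> by (rule emeasure_bounded_finite)
    show "AE x in lborel. x \<in> \<Omega> \<longrightarrow> norm (indicat_real \<Omega> x *\<^sub>R d x) \<le> B"
      using B sub by (intro AE_I2) (auto simp: subset_iff)
  qed auto
  show "d integrable_on D \<times> {0<..<l}"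
    using set_borel_integral_eq_integral(1)[OF int] by (simp add: \<Omega>_def)
  assume c: "\<And>x. x \<in> D \<Longrightarrow> integral {0..l} (\<lambda>y. d (x, y)) = c"
  have int': "integrable (lborel \<Otimes>\<^sub>M lborel) (\<lambda>p. indicat_real \<Omega> p * d p)"
    using int unfolding set_integrable_def lborel_prod by simp
  have inner: "(\<integral>y. indicat_real \<Omega> (x, y) * d (x, y) \<partial>lborel) = c * indicat_real D x" for x
  proof (cases "x \<in> D")
    case True
    have "continuous_on {0..l} (\<lambda>y. d (x, y))"
      by (rule continuous_on_compose2[OF d]) (use True closure_subset[of D] in \<open>auto intro!:
        continuous_intros\<close>)
    then have "set_integrable lborel {0..l} (\<lambda>y. d (x, y))"
      by (rule borel_integrable_atLeastAtMost')
    then have "set_integrable lborel {0<..<l} (\<lambda>y. d (x, y))" by (rule set_integrable_subset) auto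
    from set_borel_integral_eq_integral(2)[OF this] c[OF True]
    have "(LINT y:{0<..<l}|lborel. d (x, y)) = c" by (simp add: integral_open_interval_real)
    then show ?thesis using True by (simp add: set_lebesgue_integral_def \<Omega>_def indicator_times)
  qed (simp add: \<Omega>_def indicator_times)
  have "integral \<Omega> d = (\<integral>p. indicat_real \<Omega> p * d p \<partial>(lborel \<Otimes>\<^sub>M lborel))"
    using set_borel_integral_eq_integral(2)[OF int]
      unfolding lborel_prod set_lebesgue_integral_def by simp
  also have "\<dots> = (\<integral>x. (\<integral>y. indicat_real \<Omega> (x, y) * d (x, y) \<partial>lborel) \<partial>lborel)"
    by (rule lborel_pair.integral_fst'[OF int', symmetric])
  also have "\<dots> = c * measure lborel D" unfolding inner using D by simp
  finally show "integral (D \<times> {0<..<l}) d = c * measure lborel D" by (simp add: \<Omega>_def)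
qed

text \<open>This is the indicator of \<open>t \<le> y\<close>; as a level weight it inherits measurability.\<close>

definition initial_weight :: "real \<Rightarrow> real \<Rightarrow> real" where
  "initial_weight y t = level_weight 1 (- y) (- t)"

lemma weight_on_initial_weight: "weight_on {0..l} (initial_weight y)"
  unfolding initial_weight_def[abs_def] by (intro weight_on_level_weight continuous_intros) auto

lemma integral_initial_weight:
  fixes g :: "real \<Rightarrow> real"
  assumes "0 \<le> y" "y \<le> l"
  shows "integral {0..l} (\<lambda>t. initial_weight y t * g t) = integral {0..y} g"
proof -
  have "integral {0..l} (\<lambda>t. initial_weight y t * g t)
    = integral {0..l} (\<lambda>t. if t \<in> {0..y} then g t else 0)"
    by (rule integral_cong) (auto simp: initial_weight_def level_weight_def)
  also have "\<dots> = integral ({0..l} \<inter> {0..y}) g"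
    by (simp only: integral_restrict_Int Int_commute)
  also have "{0..l} \<inter> {0..y} = {0..y}" using assms by auto
  finally show ?thesis .
qed

section \<open>Comparison of the two boundary value problems\<close>

locale rearranged_cylinder_problem =
  fixes D :: "'a::euclidean_space set"
    and l \<alpha> :: real
    and f u v :: "'a \<times> real \<Rightarrow> real"
    and gu gv :: "'a \<times> real \<Rightarrow> 'a \<times> real"
    and Hu Hv :: "'a \<times> real \<Rightarrow> 'a \<times> real \<Rightarrow> 'a \<times> real"
  assumes D: "smooth_bounded_domain D"
    and l: "l > 0"
    and alpha: "\<alpha> \<ge> 0"
    and fcont: "continuous_on (closure (D \<times> {0<..<l})) f"
    and solves_u: "solves_mixed_problem D l \<alpha> f u gu Hu"
    and solves_v: "solves_mixed_problem D l \<alpha> (sharp l f) v gv Hv"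
    and mean0: "\<alpha> = 0 \<Longrightarrow> integral (D \<times> {0<..<l}) u = 0 \<and> integral (D \<times> {0<..<l}) v = 0"
begin

lemma domain: "open D" "connected D" "D \<noteq> {}" "bounded D"
  using D by (auto simp: smooth_bounded_domain_def)

sublocale U: C2_cylinder_function D l u gu Hu
  using domain l solves_u by unfold_locales (auto simp: solves_mixed_problem_def)

sublocale V: C2_cylinder_function D l v gv Hv
  using domain l solves_v by unfold_locales (auto simp: solves_mixed_problem_def)

lemma equation:
  assumes "x \<in> D" "y \<in> {0<..<l}"
  shows "- laplacian_of Hu (x, y) = f (x, y)" "- laplacian_of Hv (x, y)
    = decr_rearr l (\<lambda>t. f (x, t)) y"
  using assms solves_u solves_v by (auto simp: solves_mixed_problem_def sharp_def)

lemma neumann: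
  assumes "x \<in> D"
  shows "gu (x, 0) \<bullet> (0, 1) = 0" "gu (x, l) \<bullet> (0, 1) = 0" "gv (x, 0) \<bullet> (0, 1) = 0"
    "gv (x, l) \<bullet> (0, 1) = 0"
proof -
  have "gu (x, 0) \<bullet> - (0, 1) = 0" "gv (x, 0) \<bullet> - (0, 1) = 0"
    using assms solves_u solves_v by (auto simp: solves_mixed_problem_def)
  then show "gu (x, 0) \<bullet> (0, 1) = 0" "gv (x, 0) \<bullet> (0, 1) = 0"
    by (simp_all only: inner_minus_right neg_equal_0_iff_equal)
  show "gu (x, l) \<bullet> (0, 1) = 0" "gv (x, l) \<bullet> (0, 1) = 0"
    using assms solves_u solves_v by (auto simp: solves_mixed_problem_def)
qed

lemma robin:
  assumes "x \<in> frontier D" "y \<in> {0..l}"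
  shows "gu (x, y) \<bullet> (outer_normal D x, 0) = - \<alpha> * u (x, y)" "gv (x, y) \<bullet> (outer_normal D x, 0)
    = - \<alpha> * v (x, y)"
  using assms solves_u solves_v by (auto simp: solves_mixed_problem_def eq_neg_iff_add_eq_0)

lemma f_slice: "x \<in> D \<Longrightarrow> continuous_on {0..l} (\<lambda>y. f (x, y))"
  by (rule continuous_on_compose2[OF fcont]) (use closure_subset[of D] in \<open>auto simp:
    U.closure_cylinder intro!: continuous_intros\<close>)

text \<open>One functional for two uses: both weights 1 give the difference of the slice integrals,
  and a frozen optimal weight together with the indicator of t <= y gives the function that touches
  \<open>star_diff\<close> from below.\<close>

definition weighted_diff :: "(real \<Rightarrow> real) \<Rightarrow> (real \<Rightarrow> real) \<Rightarrow> 'a \<Rightarrow> real" where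
  "weighted_diff \<theta> \<zeta> x = integral {0..l} (\<lambda>y. \<theta> y * u (x, y)) - integral {0..l} (\<lambda>y. \<zeta> y * v (x,
    y))"

text \<open>Q is the horizontal Laplacian of \<open>weighted_diff\<close>. The two equations trade
  the horizontal second derivatives for source terms and vertical ones, which can be treated on a
  single slice.\<close>

lemma weighted_diff_second_difference:
  assumes \<theta>: "weight_on {0..l} \<theta>"
    and \<zeta>: "weight_on {0..l} \<zeta>"
    and x: "x \<in> D" and \<epsilon>: "\<epsilon> > 0"
  defines "K \<equiv> weighted_diff \<theta> \<zeta>"
  defines "Q \<equiv> integral {0..l} (\<lambda>y. \<zeta> y * decr_rearr l (\<lambda>t. f (x, t)) y) + integral {0..l} (\<lambda>y. \<zeta>
    y * (Hv (x, y) (0, 1) \<bullet> (0, 1)))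
    - integral {0..l} (\<lambda>y. \<theta> y * f (x, y)) - integral {0..l} (\<lambda>y. \<theta> y * (Hu (x, y) (0, 1) \<bullet> (0,
      1)))"
  shows "\<forall>\<^sub>F t in at_right 0. (\<forall>e\<in>Basis. x + t *\<^sub>R e \<in> D \<and> x - t *\<^sub>R e \<in> D) \<and>
    \<bar>(\<Sum>e\<in>Basis. K (x + t *\<^sub>R e) + K (x - t *\<^sub>R e) - 2 * K x) - t\<^sup>2 * Q\<bar> \<le> \<epsilon> * t\<^sup>2"
proof -
  \<comment> \<open>The error is shared by two solutions and \<open>DIM('a)\<close>
    directions.\<close>
  define \<epsilon>' where "\<epsilon>' = \<epsilon> / (2 * DIM('a))"
  have "\<epsilon>' > 0" using \<epsilon> by (simp add: \<epsilon>'_def)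
  define hu hv where "hu = (\<lambda>e. integral {0..l} (\<lambda>y. \<theta> y * (Hu (x, y) (e, 0) \<bullet> (e, 0))))"
    and "hv = (\<lambda>e. integral {0..l} (\<lambda>y. \<zeta> y * (Hv (x, y) (e, 0) \<bullet> (e, 0))))"
  have Q: "Q = (\<Sum>e\<in>Basis. hu e - hv e)"
    using U.weighted_horizontal_laplacian[OF \<theta> x, of "\<lambda>y. f (x, y)"]
      V.weighted_horizontal_laplacian[OF \<zeta> x, of "decr_rearr l (\<lambda>t. f (x, t))"] equation[OF x]
    unfolding Q_def hu_def hv_def sum_subtractf by simp
  have "\<forall>\<^sub>F t in at_right 0. \<forall>e\<in>Basis. (x + t *\<^sub>R e \<in> D \<and> x - t *\<^sub>R e \<in> D) \<and>
      \<bar>K (x + t *\<^sub>R e) + K (x - t *\<^sub>R e) - 2 * K x - t\<^sup>2 * (hu e - hv e)\<bar> \<le> 2 * \<epsilon>' * t\<^sup>2"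
  proof (intro eventually_ball_finite finite_Basis ballI)
    fix e :: 'a assume e: "e \<in> Basis"
    from U.eventually_weighted_second_difference[OF \<theta> x e \<open>\<epsilon>' > 0\<close>]
      V.eventually_weighted_second_difference[OF \<zeta> x e \<open>\<epsilon>' > 0\<close>]
    show "\<forall>\<^sub>F t in at_right 0. (x + t *\<^sub>R e \<in> D \<and> x - t *\<^sub>R e \<in> D) \<and>
      \<bar>K (x + t *\<^sub>R e) + K (x - t *\<^sub>R e) - 2 * K x - t\<^sup>2 * (hu e - hv e)\<bar> \<le> 2 * \<epsilon>' * t\<^sup>2"
    proof eventually_elim
      case (elim t)
      then show ?case unfolding K_def weighted_diff_def hu_def hv_def right_diff_distrib by linarith
    qed
  qed
  then show ?thesis
  proof eventually_elim
    case (elim t)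
    have "(\<Sum>e\<in>Basis. K (x + t *\<^sub>R e) + K (x - t *\<^sub>R e) - 2 * K x) - t\<^sup>2 * Q
      = (\<Sum>e\<in>Basis. K (x + t *\<^sub>R e) + K (x - t *\<^sub>R e) - 2 * K x - t\<^sup>2 * (hu e - hv e))"
      unfolding Q sum_distrib_left by (rule sum_subtractf[symmetric])
    also have "\<bar>\<dots>\<bar> \<le> (\<Sum>e\<in>(Basis::'a set). 2 * \<epsilon>' * t\<^sup>2)"
      using elim by (intro order.trans[OF sum_abs] sum_mono) auto
    also have "\<dots> = \<epsilon> * t\<^sup>2" by (simp add: \<epsilon>'_def)
    finally show ?case using elim by blast
  qed
qed

text \<open>The Robin condition holds at every height with the same \<alpha>, so it survives
  integration against the weights: the outer normal derivative of K is - \<alpha> K.\<close>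

lemma weighted_diff_inward:
  assumes \<theta>: "weight_on {0..l} \<theta>"
    and \<zeta>: "weight_on {0..l} \<zeta>"
    and x: "x \<in> frontier D" and \<epsilon>: "\<epsilon> > 0"
  defines "K \<equiv> weighted_diff \<theta> \<zeta>" and "\<nu> \<equiv> outer_normal D x"
  shows "\<forall>\<^sub>F t in at_right 0. x - t *\<^sub>R \<nu> \<in> D \<and> \<bar>K (x - t *\<^sub>R \<nu>) - K x - t * (\<alpha> * K x)\<bar> \<le> \<epsilon> * t"
proof -
  have cl: "x \<in> closure D" using x by (simp add: frontier_def)
  obtain R where R: "R > 0" "norm \<nu> = 1" "ball (x - R *\<^sub>R \<nu>) R \<subseteq> D"
    using interior_ball_condition[OF D x] unfolding \<nu>_def by (metis order_refl)
  have "integral {0..l} (\<lambda>y. \<theta> y * (gu (x, y) \<bullet> (\<nu>, 0)))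
    = integral {0..l} (\<lambda>y. - \<alpha> * (\<theta> y * u (x, y)))"
    by (rule integral_cong) (simp add: \<nu>_def robin(1)[OF x])
  then have gu: "integral {0..l} (\<lambda>y. \<theta> y * (gu (x, y) \<bullet> (\<nu>, 0)))
    = - \<alpha> * integral {0..l} (\<lambda>y. \<theta> y * u (x, y))" by simp
  have "integral {0..l} (\<lambda>y. \<zeta> y * (gv (x, y) \<bullet> (\<nu>, 0)))
    = integral {0..l} (\<lambda>y. - \<alpha> * (\<zeta> y * v (x, y)))"
    by (rule integral_cong) (simp add: \<nu>_def robin(2)[OF x])
  then have gv: "integral {0..l} (\<lambda>y. \<zeta> y * (gv (x, y) \<bullet> (\<nu>, 0)))
    = - \<alpha> * integral {0..l} (\<lambda>y. \<zeta> y * v (x, y))" by simp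
  have "\<epsilon> / 2 > 0" using \<epsilon> by simp
  from U.eventually_weighted_inward_difference[OF \<theta> cl R this]
    V.eventually_weighted_inward_difference[OF \<zeta> cl R this]
  show ?thesis
  proof eventually_elim
    case (elim t)
    define a b a' b' where "a = integral {0..l} (\<lambda>y. \<theta> y * u (x, y))" "b
      = integral {0..l} (\<lambda>y. \<zeta> y * v (x, y))"
      and "a' = integral {0..l} (\<lambda>y. \<theta> y * u (x - t *\<^sub>R \<nu>, y))" "b'
        = integral {0..l} (\<lambda>y. \<zeta> y * v (x - t *\<^sub>R \<nu>, y))"
    note defs = this
    have "\<bar>a' - a + t * (- \<alpha> * a)\<bar> \<le> \<epsilon> / 2 * t" "\<bar>b' - b + t * (- \<alpha> * b)\<bar> \<le> \<epsilon> / 2 * t"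
      using elim unfolding gu gv defs by auto
    moreover have "(a' - b') - (a - b) - t * (\<alpha> * (a - b))
      = (a' - a + t * (- \<alpha> * a)) - (b' - b + t * (- \<alpha> * b))"
      by (simp add: algebra_simps)
    ultimately have "\<bar>(a' - b') - (a - b) - t * (\<alpha> * (a - b))\<bar> \<le> \<epsilon> * t" by linarith
    then show ?case using elim unfolding K_def weighted_diff_def defs by simp
  qed
qed

lemma weighted_diff_continuous:
  assumes \<theta>: "weight_on {0..l} \<theta>"
    and \<zeta>: "weight_on {0..l} \<zeta>"
  shows "continuous_on (closure D) (weighted_diff \<theta> \<zeta>)"
proof -
  have *: "continuous_on (closure D) (\<lambda>x. integral {0..l} (\<lambda>y. \<eta> y * w (x, y)))"
    if \<eta>: "weight_on {0..l} \<eta>"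
      and w: "continuous_on (closure D \<times> {0..l}) w" for \<eta> and w :: "'a \<times> real \<Rightarrow> real"
  proof -
    \<comment> \<open>This functional is constant in y; the result is then read off along y =
      0.\<close>
    have "continuous_on (closure D \<times> {0..l}) (\<lambda>p. (\<lambda>q y. integral {0..l} (\<lambda>t. \<eta> t * q t)) (\<lambda>t. w
      (fst p, t)) (snd p))"
    proof (rule continuous_on_slice_functional[OF _ w l])
      show "compact (closure D)" using domain by simp
      show "integral {0..l} (\<lambda>t. \<eta> t * q t) \<le> integral {0..l} (\<lambda>t. \<eta> t * q' t) + d * l"
        if q: "continuous_on {0..l} q" "continuous_on {0..l} q'" "d \<ge> 0" "\<And>t. t \<in> {0..l} \<Longrightarrow> q t
          \<le> q' t + d" for q q' d
      proof -
        note i = weight_mult_integrable[OF \<eta>]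
        have "integral {0..l} (\<lambda>t. \<eta> t * q t) \<le> integral {0..l} (\<lambda>t. \<eta> t * q' t + d)"
        proof (intro integral_le integrable_add i q integrable_continuous_interval
          continuous_intros)
          fix t assume t: "t \<in> {0..l}"
          have "\<eta> t * q t \<le> \<eta> t * (q' t + d)"
            using q(4)[OF t] weight_on_bounds[OF \<eta> t] by (intro mult_left_mono) auto
          also have "\<dots> \<le> \<eta> t * q' t + d" using weight_on_bounds[OF \<eta> t] q(3)
            by (simp add: algebra_simps mult_left_le)
          finally show "\<eta> t * q t \<le> \<eta> t * q' t + d" .
        qed
        also have "\<dots> = integral {0..l} (\<lambda>t. \<eta> t * q' t) + integral {0..l} (\<lambda>t. d)"
          by (intro hk_integral_add i q integrable_continuous_interval continuous_intros)
        finally show ?thesis using l by (simp add: mult.commute)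
      qed
      show "\<bar>integral {0..l} (\<lambda>t. \<eta> t * q t) - integral {0..l} (\<lambda>t. \<eta> t * q t)\<bar> \<le> B * (y' - y)"
        if "\<And>t. t \<in> {0..l} \<Longrightarrow> \<bar>q t\<bar> \<le> B" "y \<le> y'" for q B y and y' :: real
      proof -
        have "B \<ge> 0" using that(1)[of 0] l by auto
        then show ?thesis using that(2) by simp
      qed
    qed
    from continuous_on_compose2[OF this, of "closure D" "\<lambda>x. (x, 0)"] l show ?thesis
      by (force intro!: continuous_intros)
  qed
  show ?thesis unfolding weighted_diff_def
    by (intro continuous_on_diff * \<theta> \<zeta> U.continuous V.continuous)
qed

text \<open>Integrated over the whole interval, both equations have the same source term, and the zero
  mean condition removes the constant that the Neumann case leaves undetermined.\<close>

lemma integral_slice_eq: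
  assumes "x \<in> D"
  shows "integral {0..l} (\<lambda>y. u (x, y)) = integral {0..l} (\<lambda>y. v (x, y))"
proof -
  define h where "h = weighted_diff (\<lambda>y. 1) (\<lambda>y. 1)"
  have h: "h x = integral {0..l} (\<lambda>y. u (x, y)) - integral {0..l} (\<lambda>y. v (x, y))" for x
    by (simp add: h_def weighted_diff_def)
  have cont: "continuous_on (closure D) h"
    unfolding h_def by (intro weighted_diff_continuous) (auto simp: weight_on_def)
  have small: "\<forall>\<^sub>F t in at_right 0. \<bar>\<Sum>e\<in>Basis. h (x + t *\<^sub>R e) + h (x - t *\<^sub>R e) - 2 * h x\<bar>
    \<le> \<epsilon> * t\<^sup>2"
    if x: "x \<in> D" and \<epsilon>: "\<epsilon> > 0" for x \<epsilon>
  proof -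
    \<comment> \<open>The Neumann conditions at both ends remove the vertical terms of Q, so that h
      becomes harmonic in the weak sense: h and - h are both weakly subharmonic.\<close>
    have z: "integral {0..l} (\<lambda>y. Hu (x, y) (0, 1) \<bullet> (0, 1)) = 0"
      "integral {0..l} (\<lambda>y. Hv (x, y) (0, 1) \<bullet> (0, 1)) = 0"
      using U.integral_vertical_second_derivative[OF x, of l]
        V.integral_vertical_second_derivative[OF x, of l]
        neumann[OF x] l by (auto simp: integral_unique)
    have m: "weight_on {0..l} (\<lambda>y. 1)" by (simp add: weight_on_def)
    have "integral {0..l} (decr_rearr l (\<lambda>t. f (x, t))) = integral {0..l} (\<lambda>y. f (x, y))"
      by (rule integral_decr_rearr_total[OF f_slice[OF x] l])
    with weighted_diff_second_difference[OF m m x \<epsilon>] show ?thesis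
      unfolding h_def[symmetric] by (auto simp: z elim!: eventually_mono)
  qed
  have sub: "weakly_subharmonic_at h x" if "x \<in> D" for x
    unfolding weakly_subharmonic_at_def using small[OF that]
      by (force simp: abs_le_iff elim!: eventually_mono)
  have neg: "weakly_subharmonic_at (\<lambda>x. - h x) x" if "x \<in> D" for x
    unfolding weakly_subharmonic_at_def
  proof (intro allI impI)
    fix \<epsilon> :: real assume "\<epsilon> > 0"
    from small[OF that this] show "\<forall>\<^sub>F t in at_right 0. - \<epsilon> * t\<^sup>2 \<le>
        (\<Sum>b\<in>Basis. - h (x + t *\<^sub>R b) + - h (x - t *\<^sub>R b) - 2 * - h x)"
    proof eventually_elim
      case (elim t)
      have "(\<Sum>b\<in>Basis. - h (x + t *\<^sub>R b) + - h (x - t *\<^sub>R b) - 2 * - h x) =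
        - (\<Sum>b\<in>Basis. h (x + t *\<^sub>R b) + h (x - t *\<^sub>R b) - 2 * h x)"
        unfolding sum_negf[symmetric] by (intro sum.cong) auto
      then show ?case using elim by linarith
    qed
  qed
  have bdry: "\<forall>\<^sub>F t in at_right 0. x - t *\<^sub>R outer_normal D x \<in> D \<and>
      \<bar>h (x - t *\<^sub>R outer_normal D x) - h x - t * (\<alpha> * h x)\<bar> \<le> \<epsilon> * t"
        if "x \<in> frontier D" "\<epsilon> > 0" for x \<epsilon>
    unfolding h_def by (rule weighted_diff_inward[OF _ _ that]) (auto simp: weight_on_def)
  have bdry1: "\<forall>\<^sub>F t in at_right 0. x - t *\<^sub>R outer_normal D x \<in> D \<and>
      h x + t * (\<alpha> * h x) - \<epsilon> * t \<le> h (x - t *\<^sub>R outer_normal D x)"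
        if "x \<in> frontier D" "\<epsilon> > 0" for x \<epsilon>
    using bdry[OF that] by (auto elim!: eventually_mono simp: abs_le_iff)
  have bdry2: "\<forall>\<^sub>F t in at_right 0. x - t *\<^sub>R outer_normal D x \<in> D \<and>
      - h x + t * (\<alpha> * - h x) - \<epsilon> * t \<le> - h (x - t *\<^sub>R outer_normal D x)"
        if "x \<in> frontier D" "\<epsilon> > 0" for x \<epsilon>
    using bdry[OF that] by (auto elim!: eventually_mono simp: abs_le_iff)
  have "h x = 0"
  proof (cases "\<alpha> = 0")
    case False
    then have "\<alpha> > 0" using alpha by simp
    from robin_maximum_principle(1)[OF D cont sub alpha bdry1 this assms]
      robin_maximum_principle(1)[OF D continuous_on_minus[OF cont] neg alpha bdry2 this assms]
    show ?thesis by simp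
  next
    case True
    have const: "h x' = h x" if "x' \<in> D" for x' 
      by (rule robin_maximum_principle(2)[OF D cont sub alpha bdry1 True that assms])
    define d where "d = (\<lambda>p. u p - v p)"
    have cd: "continuous_on (closure D \<times> {0..l}) d"
      unfolding d_def by (intro continuous_intros U.continuous V.continuous)
    note fub = cylinder_integral[OF domain(1,4) l]
    have "integral (D \<times> {0<..<l}) d = 0"
      using mean0[OF True] fub(1)[OF U.continuous(1)] fub(1)[OF V.continuous(1)] unfolding d_def
      by (subst hk_integral_diff) auto
    moreover have "integral {0..l} (\<lambda>y. d (x', y)) = h x" if "x' \<in> D" for x'
    proof -
      have "x' \<in> closure D" using that closure_subset by blast
      from U.vertical_slice(1)[OF this] V.vertical_slice(1)[OF this]
      have "integral {0..l} (\<lambda>y. d (x', y)) = integral {0..l} (\<lambda>y. u (x', y)) - integral {0..l}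
        (\<lambda>y. v (x', y))"
        unfolding d_def by (intro hk_integral_diff integrable_continuous_interval)
      then show ?thesis using const[OF that] h[of x'] by simp
    qed
    then have "integral (D \<times> {0<..<l}) d = h x * measure lborel D" by (rule fub(2)[OF cd])
    moreover have "measure lborel D > 0" by (rule measure_open_pos[OF domain(1,3,4)])
    ultimately show ?thesis by simp
  qed
  then show ?thesis by (simp add: h)
qed

definition star_diff :: "'a \<times> real \<Rightarrow> real" where
  "star_diff p = star l u p - Jop v p"

lemma star_eq: "star l w (x, y) = integral {0..y} (decr_rearr l (\<lambda>t. w (x, t)))" for w ::
  "'a \<times> real \<Rightarrow> real"
  by (simp add: star_def sharp_def)

lemma star_diff_continuous: "continuous_on (closure D \<times> {0..l}) star_diff"
proof -
  have "compact (closure D)" using domain by simp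
  have 1: "continuous_on (closure D \<times> {0..l}) (\<lambda>p. (\<lambda>q y. integral {0..y} (decr_rearr l q)) (\<lambda>t. u
    (fst p, t)) (snd p))"
  proof (rule continuous_on_slice_functional[OF \<open>compact (closure D)\<close> U.continuous(1) l])
    fix q q' :: "real \<Rightarrow> real" and d y
    assume *: "continuous_on {0..l} q" "continuous_on {0..l} q'" "0 \<le> d" "\<And>t. t \<in> {0..l} \<Longrightarrow> q t
      \<le> q' t + d" "y \<in> {0..l}"
    have "integral {0..y} (decr_rearr l q) \<le> integral {0..y} (decr_rearr l q') + d * y"
      by (rule rearr_integral_mono_bound[OF *(1,2) _ _ *(4)]) (use *(5) in auto)
    also have "d * y \<le> d * l" by (rule mult_left_mono) (use *(3,5) in auto)
    finally show "integral {0..y} (decr_rearr l q) \<le> integral {0..y} (decr_rearr l q') + d * l"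
      by simp
  qed (rule rearr_integral_lipschitz; use l in auto)
  have 2: "continuous_on (closure D \<times> {0..l}) (\<lambda>p. (\<lambda>q y. integral {0..y} q) (\<lambda>t. v (fst p, t))
    (snd p))"
  proof (rule continuous_on_slice_functional[OF \<open>compact (closure D)\<close> V.continuous(1) l])
    fix q q' :: "real \<Rightarrow> real" and d y
    assume *: "continuous_on {0..l} q" "continuous_on {0..l} q'" "0 \<le> d" "\<And>t. t \<in> {0..l} \<Longrightarrow> q t
      \<le> q' t + d" "y \<in> {0..l}"
    have i: "q integrable_on {0..y}" "q' integrable_on {0..y}"
      using *(5) by (auto intro!: integrable_continuous_interval intro: continuous_on_subset[OF
        *(1)] continuous_on_subset[OF *(2)])
    have "integral {0..y} q \<le> integral {0..y} (\<lambda>t. q' t + d)"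
      using *(4,5) by (intro integral_le i integrable_add integrable_continuous_interval
        continuous_intros) auto
    also have "\<dots> = integral {0..y} q' + integral {0..y} (\<lambda>t. d)"
      by (intro hk_integral_add i integrable_continuous_interval continuous_intros)
    also have "\<dots> = integral {0..y} q' + d * y" using *(5) by simp
    also have "\<dots> \<le> integral {0..y} q' + d * l"
      by (intro add_left_mono mult_left_mono) (use *(3,5) in auto)
    finally show "integral {0..y} q \<le> integral {0..y} q' + d * l" .
  next
    fix q :: "real \<Rightarrow> real" and B y y'
    assume *: "continuous_on {0..l} q" "\<And>t. t \<in> {0..l} \<Longrightarrow> \<bar>q t\<bar> \<le> B" "0 \<le> y" "y \<le> y'" "y' \<le> l"
    have i: "q integrable_on {a..b}" if "0 \<le> a" "b \<le> l" for a b
      using that by (intro integrable_continuous_interval continuous_on_subset[OF *(1)]) auto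
    have "integral {0..y'} q - integral {0..y} q = integral {y..y'} q"
      using hk_integral_combine[of 0 y y' q] *(3-5) i by simp
    then show "\<bar>integral {0..y'} q - integral {0..y} q\<bar> \<le> B * (y' - y)"
      using integral_abs_bound_interval[of q y y' B] i * by simp
  qed
  show ?thesis
    using continuous_on_diff[OF 1 2]
    by (simp add: star_diff_def[abs_def] star_def sharp_def Jop_def case_prod_unfold)
qed

text \<open>Bathtub principle: at each point the star function is touched from below by an integral
  against a frozen weight, and this integral is as smooth in \<open>x\<close> as \<open>u\<close> is.\<close>

lemma touching_weight:
  assumes x: "x \<in> closure D" and y: "0 < y" "y < l"
  defines "s \<equiv> decr_rearr l (\<lambda>t. u (x, t)) y"
  obtains \<beta> \<theta> where "0 \<le> \<beta>" "\<beta> \<le> 1" "\<theta> = (\<lambda>t. level_weight \<beta> s (u (x, t)))"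
    "weight_on {0..l} \<theta>" "integral {0..l} \<theta> = y"
    "weighted_diff \<theta> (initial_weight y) x = star_diff (x, y)"
    "\<And>x'. x' \<in> closure D \<Longrightarrow> weighted_diff \<theta> (initial_weight y) x' \<le> star_diff (x', y)"
proof -
  note q = U.vertical_slice(1)[OF x]
  obtain \<beta> where \<beta>: "0 \<le> \<beta>" "\<beta> \<le> 1" "integral {0..l} (\<lambda>t. level_weight \<beta> s (u (x, t))) = y"
    "integral {0..l} (\<lambda>t. level_weight \<beta> s (u (x, t)) * u (x, t))
      = integral {0..y} (decr_rearr l (\<lambda>t. u (x, t)))"
    by (rule optimal_weight[OF q y, folded s_def])
  define \<theta> where "\<theta> = (\<lambda>t. level_weight \<beta> s (u (x, t)))"
  have \<theta>: "weight_on {0..l} \<theta>" "integral {0..l} \<theta> = y"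
    unfolding \<theta>_def using \<beta> weight_on_level_weight[OF \<beta>(1,2) q] by auto
  have "weighted_diff \<theta> (initial_weight y) x = star_diff (x, y)"
    using y \<beta>(4)
    by (simp add: \<theta>_def weighted_diff_def star_diff_def star_eq Jop_def integral_initial_weight)
  moreover have "weighted_diff \<theta> (initial_weight y) x' \<le> star_diff (x', y)"
    if "x' \<in> closure D" for x'
    using weighted_integral_le_rearr[OF U.vertical_slice(1)[OF that] y \<theta>] y
    by (simp add: weighted_diff_def star_diff_def star_eq Jop_def integral_initial_weight)
  ultimately show ?thesis using that \<beta>(1,2) \<theta> \<theta>_def by blast
qed

lemma Jop_second_difference:
  assumes x: "x \<in> D" and y: "0 < y" "y < l" and \<epsilon>: "\<epsilon> > 0"
  shows "\<forall>\<^sub>F t in at_right 0. \<bar>Jop v (x, y + t) + Jop v (x, y - t) - 2 * Jop v (x, y) - t\<^sup>2 * (gv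
    (x, y) \<bullet> (0, 1))\<bar> \<le> \<epsilon> * t\<^sup>2"
proof -
  have cl: "x \<in> closure D" using x closure_subset by blast
  have J: "((\<lambda>r. Jop v (x, y + r)) has_real_derivative v (x, y + r)) (at r)"
    if "0 < y + r" "y + r < l" for r
  proof -
    have "((\<lambda>z. integral {0..z} (\<lambda>t. v (x, t))) has_real_derivative v (x, y + r)) (at (y + r)
      within {0..l})"
      using that by (intro integral_has_real_derivative V.vertical_slice(1)[OF cl]) auto
    then have "((\<lambda>z. Jop v (x, z)) has_real_derivative v (x, y + r)) (at (y + r))"
      using that by (simp add: Jop_def at_within_Icc_at)
    then have "((\<lambda>r. Jop v (x, y + r)) has_real_derivative v (x, y + r) * 1) (at r)"
      by (rule DERIV_chain2[where f = "\<lambda>z. Jop v (x, z)" and g = "\<lambda>r. y + r"])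
        (auto intro!: derivative_eq_intros)
    then show ?thesis by simp
  qed
  have V: "((\<lambda>r. v (x, y + r)) has_real_derivative gv (x, y + r) \<bullet> (0, 1)) (at r)"
    if "0 < y + r" "y + r < l" for r
  proof -
    have "((\<lambda>z. v (x, z)) has_real_derivative gv (x, y + r) \<bullet> (0, 1)) (at (y + r))"
      using V.vertical_derivatives(1)[OF x, of "y + r"] that by simp
    then have "((\<lambda>r. v (x, y + r)) has_real_derivative gv (x, y + r) \<bullet> (0, 1) * 1) (at r)"
      by (rule DERIV_chain2[where f = "\<lambda>z. v (x, z)" and g = "\<lambda>r. y + r"])
        (auto intro!: derivative_eq_intros)
    then show ?thesis by simp
  qed
  have "isCont (\<lambda>y. gv (x, y) \<bullet> (0, 1)) y"
    using V.vertical_derivatives(2)[OF x, of y] y by (auto intro: DERIV_isCont)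
  then obtain \<delta> where \<delta>: "\<delta> > 0" "\<And>z. \<bar>z - y\<bar> < \<delta> \<Longrightarrow> \<bar>gv (x, z) \<bullet> (0, 1) - gv (x, y) \<bullet> (0, 1)\<bar> < \<epsilon>"
    using \<epsilon> unfolding continuous_at_eps_delta dist_real_def by blast
  have "\<forall>\<^sub>F t in at_right 0. t \<in> {0<..<min \<delta> (min y (l - y))}"
    using \<delta>(1) y by (intro eventually_at_right_real) auto
  then show ?thesis
  proof eventually_elim
    case (elim t)
    have "\<bar>Jop v (x, y + t) + Jop v (x, y + - t) - 2 * Jop v (x, y + 0) - t\<^sup>2 * (gv (x, y) \<bullet> (0,
      1))\<bar> \<le> \<epsilon> * t\<^sup>2"
    proof (rule second_difference_estimate)
      show "((\<lambda>r. Jop v (x, y + r)) has_real_derivative v (x, y + r)) (at r)" if "\<bar>r\<bar> \<le> t" for r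
        using that elim by (intro J) auto
      show "((\<lambda>r. v (x, y + r)) has_real_derivative gv (x, y + r) \<bullet> (0, 1)) (at r)"
        if "\<bar>r\<bar> \<le> t" for r
        using that elim by (intro V) auto
      show "\<bar>gv (x, y + r) \<bullet> (0, 1) - gv (x, y) \<bullet> (0, 1)\<bar> \<le> \<epsilon>" if "\<bar>r\<bar> \<le> t" for r
        using \<delta>(2)[of "y + r"] that elim by simp
    qed (use elim in auto)
    then show ?case by simp
  qed
qed

text \<open>Up to errors of size \<epsilon> t^2, the horizontal differences contribute at least t^2
  (S + G - T - L) through the touching function K, and the vertical ones at least t^2 (L - G). Here
  L is the weighted integral of u_yy, and G = v_y equals the integral of v_yy over (0, y) by the
  Neumann condition at the bottom. L and G cancel, and T <= S is the bathtub inequality for f,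
  tested with the weight that is optimal for u.\<close>

lemma star_diff_subharmonic:
  assumes x: "x \<in> D" and y: "0 < y" "y < l"
  shows "weakly_subharmonic_at star_diff (x, y)"
  unfolding weakly_subharmonic_at_def
proof (intro allI impI)
  fix \<epsilon> :: real assume \<epsilon>: "\<epsilon> > 0"
  then have \<epsilon>3: "\<epsilon> / 3 > 0" by simp
  have cl: "x \<in> closure D" using x closure_subset by blast
  obtain \<beta> \<theta> where \<beta>: "0 \<le> \<beta>" "\<beta> \<le> 1"
    and \<theta>_eq: "\<theta> = (\<lambda>t. level_weight \<beta> (decr_rearr l (\<lambda>t. u (x, t)) y) (u (x, t)))"
    and \<theta>: "weight_on {0..l} \<theta>" "integral {0..l} \<theta> = y"
    and eq: "weighted_diff \<theta> (initial_weight y) x = star_diff (x, y)"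
    and le: "\<And>x'. x' \<in> closure D \<Longrightarrow> weighted_diff \<theta> (initial_weight y) x' \<le> star_diff (x', y)"
    using touching_weight[OF cl y] by metis
  define K where "K = weighted_diff \<theta> (initial_weight y)"
  define L where "L = integral {0..l} (\<lambda>t. \<theta> t * (Hu (x, t) (0, 1) \<bullet> (0, 1)))"
  define S where "S = integral {0..y} (decr_rearr l (\<lambda>t. f (x, t)))"
  define T where "T = integral {0..l} (\<lambda>t. \<theta> t * f (x, t))"
  define G where "G = gv (x, y) \<bullet> (0, 1)"
  have TS: "T \<le> S" unfolding T_def S_def
    by (rule weighted_integral_le_rearr[OF f_slice[OF x] y \<theta>])
  have Sz: "integral {0..l} (\<lambda>t. initial_weight y t * decr_rearr l (\<lambda>t. f (x, t)) t) = S"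
    using y by (simp add: S_def integral_initial_weight)
  have Gz: "integral {0..l} (\<lambda>t. initial_weight y t * (Hv (x, t) (0, 1) \<bullet> (0, 1))) = G"
    using y V.integral_vertical_second_derivative[OF x neumann(3)[OF x], of y]
    by (simp add: G_def integral_initial_weight integral_unique)
  have 1: "\<forall>\<^sub>F t in at_right 0. (\<forall>e\<in>Basis. x + t *\<^sub>R e \<in> D \<and> x - t *\<^sub>R e \<in> D) \<and>
    \<bar>(\<Sum>e\<in>Basis. K (x + t *\<^sub>R e) + K (x - t *\<^sub>R e) - 2 * K x) - t\<^sup>2 * (S + G - T - L)\<bar> \<le> \<epsilon> / 3 * t\<^sup>2"
    using weighted_diff_second_difference[OF \<theta>(1) weight_on_initial_weight[of _ y] x \<epsilon>3, folded
      K_def L_def T_def, unfolded Sz Gz] .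
  have 2: "\<forall>\<^sub>F t in at_right 0. (L - \<epsilon> / 3) * t\<^sup>2 \<le>
      star l u (x, y + t) + star l u (x, y - t) - 2 * star l u (x, y)"
    unfolding star_eq L_def \<theta>_eq
    by (rule rearr_integral_second_difference[OF U.vertical_slice[OF cl] _ _ _ _ \<beta> y \<epsilon>3])
      (use U.vertical_derivatives[OF x] neumann[OF x] in auto)
  have 3: "\<forall>\<^sub>F t in at_right 0. \<bar>Jop v (x, y + t) + Jop v (x, y - t) - 2 * Jop v (x, y) - t\<^sup>2 * G\<bar>
    \<le> \<epsilon> / 3 * t\<^sup>2"
    unfolding G_def by (rule Jop_second_difference[OF x y \<epsilon>3])
  from 1 2 3 show "\<forall>\<^sub>F t in at_right 0. - \<epsilon> * t\<^sup>2 \<le> (\<Sum>b\<in>Basis. star_diff ((x, y) + t *\<^sub>R b)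
      + star_diff ((x, y) - t *\<^sub>R b) - 2 * star_diff (x, y))"
  proof eventually_elim
    case (elim t)
    \<comment> \<open>K equals \<open>star_diff\<close> at x and lies below it at the neighbours, so
      its second differences are the smaller ones.\<close>
    have "(\<Sum>e\<in>Basis. K (x + t *\<^sub>R e) + K (x - t *\<^sub>R e) - 2 * K x) \<le>
      (\<Sum>e\<in>Basis. star_diff (x + t *\<^sub>R e, y) + star_diff (x - t *\<^sub>R e, y) - 2 * star_diff (x, y))"
    proof (rule sum_mono)
      fix e :: 'a assume "e \<in> Basis"
      then have "x + t *\<^sub>R e \<in> closure D" "x - t *\<^sub>R e \<in> closure D"
        using elim(1) closure_subset[of D] by auto
      from le[OF this(1)] le[OF this(2)]
      show "K (x + t *\<^sub>R e) + K (x - t *\<^sub>R e) - 2 * K x \<le>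
        star_diff (x + t *\<^sub>R e, y) + star_diff (x - t *\<^sub>R e, y) - 2 * star_diff (x, y)"
        by (simp add: K_def eq)
    qed
    moreover have "t\<^sup>2 * (S + G - T - L) - \<epsilon> / 3 * t\<^sup>2
      \<le> (\<Sum>e\<in>Basis. K (x + t *\<^sub>R e) + K (x - t *\<^sub>R e) - 2 * K x)"
      using elim(1) by linarith
    moreover have "(L - \<epsilon> / 3) * t\<^sup>2 - (t\<^sup>2 * G + \<epsilon> / 3 * t\<^sup>2) \<le>
        star_diff (x, y + t) + star_diff (x, y - t) - 2 * star_diff (x, y)"
      using elim(2) abs_le_D1[OF elim(3)] by (simp add: star_diff_def)
    moreover have "0 \<le> t\<^sup>2 * (S - T)" using TS by simp
    then have "- \<epsilon> * t\<^sup>2 \<le> t\<^sup>2 * (S + G - T - L) - \<epsilon> / 3 * t\<^sup>2 + ((L - \<epsilon> / 3) * t\<^sup>2 - (t\<^sup>2 * G + \<epsilon>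
      / 3 * t\<^sup>2))"
      by (simp add: algebra_simps)
    ultimately show ?case unfolding sum_Basis_prod by simp
  qed
qed

lemma star_diff_bottom: "star_diff (x, 0) = 0"
  by (simp add: star_diff_def star_eq Jop_def)

lemma star_diff_top:
  assumes "x \<in> closure D" shows "star_diff (x, l) = 0"
proof (rule continuous_constant_on_closure[OF _ _ assms])
  show "continuous_on (closure D) (\<lambda>x. star_diff (x, l))"
    by (rule continuous_on_compose2[OF star_diff_continuous])
      (use l in \<open>auto intro!: continuous_intros\<close>)
  fix x assume x: "x \<in> D"
  then have "x \<in> closure D" using closure_subset by blast
  then show "star_diff (x, l) = 0"
    using integral_decr_rearr_total[OF U.vertical_slice(1) l] integral_slice_eq[OF x]
    by (simp add: star_diff_def star_eq Jop_def)
qed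

lemma star_diff_nonpos:
  assumes "p \<in> closure D \<times> {0..l}"
  shows "star_diff p \<le> 0"
proof (rule ccontr)
  assume "\<not> star_diff p \<le> 0"
  obtain z where z: "z \<in> closure D \<times> {0..l}" "\<And>q. q \<in> closure D \<times> {0..l} \<Longrightarrow> star_diff q
    \<le> star_diff z"
    using continuous_attains_sup[OF U.compact_cylinder _ star_diff_continuous] assms by blast
  define M where "M = star_diff z"
  have "M > 0" using z(2)[OF assms] \<open>\<not> star_diff p \<le> 0\<close> by (simp add: M_def)
  define \<Omega> where "\<Omega> = D \<times> {0<..<l}"
  have \<Omega>: "open \<Omega>" "connected \<Omega>" unfolding \<Omega>_def using domain
    by (auto intro!: open_Times connected_Times)
  have cl\<Omega>: "closure \<Omega> = closure D \<times> {0..l}" unfolding \<Omega>_def by (rule U.closure_cylinder)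
  have cont: "continuous_on (closure \<Omega>) star_diff" unfolding cl\<Omega> by (rule star_diff_continuous)
  have sub: "weakly_subharmonic_at star_diff q" if "q \<in> \<Omega>" for q
    using that star_diff_subharmonic by (auto simp: \<Omega>_def)
  have le: "star_diff q \<le> M" if "q \<in> closure \<Omega>" for q using that z(2) by (simp add: M_def cl\<Omega>)
  have less: "star_diff q < M" if q: "q \<in> \<Omega>" for q
  proof (rule ccontr)
    assume "\<not> star_diff q < M"
    then have qM: "star_diff q = M" using le[of q] q closure_subset[of \<Omega>] by force
    have const: "star_diff q' = M" if "q' \<in> \<Omega>" for q'
      by (rule strong_maximum_principle[OF \<Omega> continuous_on_subset[OF cont closure_subset] sub _ q
        qM that])
        (use le closure_subset in auto)
    \<comment> \<open>A constant value M > 0 would extend to the bottom, where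
      \<open>star_diff\<close> vanishes.\<close>
    have "(fst z, 0) \<in> closure \<Omega>" using z(1) l by (auto simp: cl\<Omega>)
    from continuous_constant_on_closure[OF cont const this] show False
      using star_diff_bottom \<open>M > 0\<close> by simp
  qed
  obtain x y where xy: "z = (x, y)" "x \<in> closure D" "y \<in> {0..l}" using z(1) by auto
  have "y \<noteq> 0" "y \<noteq> l" using \<open>M > 0\<close> star_diff_bottom star_diff_top[OF xy(2)]
    by (auto simp: M_def xy(1))
  then have y: "0 < y" "y < l" using xy(3) by auto
  have "x \<notin> D" using less[of z] y by (auto simp: \<Omega>_def xy(1) M_def)
  then have x: "x \<in> frontier D" using xy(2) domain(1) by (simp add: frontier_def interior_open)
  define \<nu> where "\<nu> = outer_normal D x"
  obtain R where R: "R > 0" "norm \<nu> = 1" "\<And>r. 0 < r \<Longrightarrow> r \<le> R \<Longrightarrow> ball (x - r *\<^sub>R \<nu>) r \<subseteq> D"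
    using interior_ball_condition[OF D x] unfolding \<nu>_def by metis
  \<comment> \<open>The ball tangent to the lateral boundary at z projects into a tangent ball of D,
    and r <= min y (l - y) keeps it between bottom and top.\<close>
  define r where "r = min R (min y (l - y))"
  have r: "0 < r" "r \<le> R" "r \<le> y" "r \<le> l - y" using R y by (auto simp: r_def)
  have ball: "ball (z - r *\<^sub>R (\<nu>, 0)) r \<subseteq> \<Omega>"
  proof
    fix q assume q: "q \<in> ball (z - r *\<^sub>R (\<nu>, 0)) r"
    have "dist (x - r *\<^sub>R \<nu>) (fst q) < r" "dist y (snd q) < r"
      using q dist_fst_le[of "z - r *\<^sub>R (\<nu>, 0)" q] dist_snd_le[of "z - r *\<^sub>R (\<nu>, 0)" q]
        by (simp_all add: xy(1))
    then have "fst q \<in> D" "snd q \<in> {0<..<l}" using R(3)[OF r(1,2)] r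
      by (auto simp: dist_real_def subset_iff)
    then show "q \<in> \<Omega>" by (simp add: \<Omega>_def mem_Times_iff)
  qed
  then have cball: "cball (z - r *\<^sub>R (\<nu>, 0)) r \<subseteq> closure \<Omega>" using closure_mono[OF ball] r(1) by simp
  obtain \<theta> where \<theta>: "weight_on {0..l} \<theta>"
    and eq: "weighted_diff \<theta> (initial_weight y) x = star_diff (x, y)"
    and le': "\<And>x'. x' \<in> closure D \<Longrightarrow> weighted_diff \<theta> (initial_weight y) x' \<le> star_diff (x', y)"
    using touching_weight[OF xy(2) y] by metis
  show False
  proof (rule hopf_contradiction[OF r(1), of "(\<nu>, 0)" z star_diff M])
    show "norm (\<nu>, 0::real) = 1" using R(2) by (simp add: norm_Pair)
    show "continuous_on (cball (z - r *\<^sub>R (\<nu>, 0)) r) star_diff"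
      by (rule continuous_on_subset[OF cont cball])
    show "weakly_subharmonic_at star_diff q" "star_diff q < M"
      if "q \<in> ball (z - r *\<^sub>R (\<nu>, 0)) r" for q
      using that ball sub less by blast+
    show "star_diff q \<le> M" if "q \<in> cball (z - r *\<^sub>R (\<nu>, 0)) r" for q using that cball le by blast
    fix \<epsilon> :: real assume "\<epsilon> > 0"
    \<comment> \<open>Robin condition for the touching function: moving inward by t changes it by t
      \<alpha> M >= 0 up to \<epsilon> t. Since \<open>star_diff\<close> lies above it and agrees
      with it at z, \<open>star_diff\<close> cannot drop at first order as Hopf's lemma
      demands.\<close>
    have "\<forall>\<^sub>F t in at_right 0. x - t *\<^sub>R \<nu> \<in> D \<and>
        \<bar>weighted_diff \<theta> (initial_weight y) (x - t *\<^sub>R \<nu>) - M - t * (\<alpha> * M)\<bar> \<le> \<epsilon> * t"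
      using weighted_diff_inward[OF \<theta> weight_on_initial_weight x \<open>\<epsilon> > 0\<close>, of y]
      by (simp add: eq \<nu>_def M_def xy(1))
    then show "\<forall>\<^sub>F t in at_right 0. M - \<epsilon> * t \<le> star_diff (z - t *\<^sub>R (\<nu>, 0))"
      using eventually_at_right_less[of "0::real"]
    proof eventually_elim
      case (elim t)
      then have "x - t *\<^sub>R \<nu> \<in> closure D" using closure_subset by blast
      from le'[OF this] elim(1)
      have "M + t * (\<alpha> * M) - \<epsilon> * t \<le> star_diff (x - t *\<^sub>R \<nu>, y)" by linarith
      moreover have "0 \<le> t * (\<alpha> * M)" using elim(2) alpha \<open>M > 0\<close> by simp
      ultimately show ?case by (simp add: xy(1))
    qed
  qed
qed

end

theorem theorem1p3:
  fixes D :: "'a::euclidean_space set"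
    and l \<alpha> :: real
    and f u v :: "'a \<times> real \<Rightarrow> real"
    and gu gv :: "'a \<times> real \<Rightarrow> 'a \<times> real"
    and Hu Hv :: "'a \<times> real \<Rightarrow> 'a \<times> real \<Rightarrow> 'a \<times> real"
  assumes D: "smooth_bounded_domain D"
    and l: "l > 0"
    and alpha: "\<alpha> \<ge> 0"
    and fL2: "f integrable_on (D \<times> {0<..<l})" "(\<lambda>p. (f p)\<^sup>2) integrable_on (D \<times> {0<..<l})"
    and fcont: "continuous_on (closure (D \<times> {0<..<l})) f"
    and fsharpcont: "continuous_on (closure (D \<times> {0<..<l})) (sharp l f)"
    and u: "solves_mixed_problem D l \<alpha> f u gu Hu"
    and v: "solves_mixed_problem D l \<alpha> (sharp l f) v gv Hv"
    and mean0: "\<alpha> = 0 \<Longrightarrow>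
       integral (D \<times> {0<..<l}) f = 0 \<and> integral (D \<times> {0<..<l}) u = 0 \<and>
       integral (D \<times> {0<..<l}) v = 0"
  shows "(\<forall>x\<in>D. \<forall>y\<in>{0..l}. star l u (x, y) \<le> Jop v (x, y)) \<and>
         (\<forall>x\<in>D. \<forall>\<phi>::real \<Rightarrow> real. convex_on UNIV \<phi> \<longrightarrow>
            integral {0..l} (\<lambda>y. \<phi> (u (x, y))) \<le> integral {0..l} (\<lambda>y. \<phi> (v (x, y))))"
proof -
  interpret rearranged_cylinder_problem D l \<alpha> f u v gu gv Hu Hv
    using D l alpha fcont u v mean0 by unfold_locales auto
  have star: "star l u (x, y) \<le> Jop v (x, y)" if "x \<in> D" "y \<in> {0..l}" for x y
    using star_diff_nonpos[of "(x, y)"] that closure_subset[of D] by (auto simp: star_diff_def)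
  moreover have "integral {0..l} (\<lambda>y. \<phi> (u (x, y))) \<le> integral {0..l} (\<lambda>y. \<phi> (v (x, y)))"
    if x: "x \<in> D" and "convex_on UNIV \<phi>" for x and \<phi> :: "real \<Rightarrow> real"
  proof (rule integral_convex_le_of_majorized[of l "\<lambda>y. u (x, y)" "\<lambda>y. v (x, y)" \<phi>])
    have "x \<in> closure D" using x closure_subset by blast
    then show "continuous_on {0..l} (\<lambda>y. u (x, y))" "continuous_on {0..l} (\<lambda>y. v (x, y))"
      using U.vertical_slice(1) V.vertical_slice(1) by blast+
    show "integral {0..y} (decr_rearr l (\<lambda>y. u (x, y))) \<le> integral {0..y} (\<lambda>y. v (x, y))"
      if "y \<in> {0..l}" for y
      using star[OF x that] by (simp add: star_eq Jop_def)
  qed (use that l integral_slice_eq in auto)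
  ultimately show ?thesis by blast
qed

end
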